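(* Let $K$ be a perfect field, $n\ge1$, $k\ge1$, $\mathfrak{q}=\langle X_1,\dots,X_n\rangle\subseteq K[X_1,\dots,X_n]$, $S=K[X_1,\dots,X_n]/\mathfrak{q}^k$, and let $\epsilon_S:\Omega^1_{S/K}\to\mathfrak{q}/\mathfrak{q}^k$ be the Euler form of $S/K$. Then: (a) The sequence of $S$-linear maps $$0\longrightarrow\Omega^n_{S/K}\xrightarrow{\ \epsilon_S^{(n)}\ }\cdots\xrightarrow{\ \epsilon_S^{(3)}\ }\Omega^2_{S/K}\xrightarrow{\ \epsilon_S^{(2)}\ }\Omega^1_{S/K}\xrightarrow{\ \epsilon_S\ }\mathfrak{q}/\mathfrak{q}^k\longrightarrow0$$ is a complex, where $\epsilon_S^{(i)}(w_1\wedge\cdots\wedge w_i)=\sum_{j=1}^i(-1)^{j-1}\epsilon_S(w_j)\,w_1\wedge\cdots\wedge\widehat{w_j}\wedge\cdots\wedge w_i$ for $i\ge2$ and $w_1,\dots,w_i\in\Omega^1_{S/K}$. (b) Let $i\ge1$, and assume that $\mathrm{char}(K)=0$ or that $\mathrm{char}(K)>0$ is not a divisor of $i$. Then the sequence of $K$-vector spaces $$0\longrightarrow(\Omega^n_{S/K})_i\xrightarrow{\ \epsilon_S^{(n)}\ }\cdots\xrightarrow{\ \epsilon_S^{(3)}\ }(\Omega^2_{S/K})_i\xrightarrow{\ \epsilon_S^{(2)}\ }(\Omega^1_{S/K})_i\xrightarrow{\ \epsilon_S\ }(\mathfrak{q}/\mathfrak{q}^k)_i\longrightarrow0$$ is 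exact.
   Context: $S$ carries the standard grading. $\Omega^m_{S/K}=\Lambda^m_S\Omega^1_{S/K}$ is the module of Kähler differential $m$-forms, graded so that $\deg(dx_j)=1$, where $x_j$ is the image of $X_j$ in $S$. The Euler form $\epsilon_S:\Omega^1_{S/K}\to\mathfrak{q}/\mathfrak{q}^k$ is the $S$-linear map given by $\epsilon_S(df)=\deg(f)\cdot f$ for every homogeneous $f\in S$; in particular $\epsilon_S(dx_j)=x_j$. A hat means that the factor is omitted, and the subscript $i$ on modules denotes the homogeneous component of degree $i$. *)

theory Defs
  imports
    "HOL-Library.Cardinality"
    "HOL-Library.Poly_Mapping"
    "HOL-Algebra.Algebra"
    "HOL-Algebra.Algebraic_Closure_Type"
begin

definition perfect_field :: "'a::field itself \<Rightarrow> bool" where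
  "perfect_field _ \<longleftrightarrow> CHAR('a) = 0 \<or> (\<forall>x::'a. \<exists>y. y ^ CHAR('a) = x)"


section \<open>Modules over a commutative ring\<close>

text \<open>The multiplicative fields of the record type \<^typ>\<open>('r, 'm) module\<close> play no role for
  modules and are left \<^const>\<open>undefined\<close>.\<close>

definition mod_hom ::
  "('r, 'x) ring_scheme \<Rightarrow> ('r, 'm, 'y) module_scheme \<Rightarrow> ('r, 'n, 'z) module_scheme \<Rightarrow> ('m \<Rightarrow> 'n) set"
  where
  "mod_hom R M N = {h \<in> carrier M \<rightarrow> carrier N.
     (\<forall>x\<in>carrier M. \<forall>y\<in>carrier M. h (x \<oplus>\<^bsub>M\<^esub> y) = h x \<oplus>\<^bsub>N\<^esub> h y) \<and>
     (\<forall>a\<in>carrier R. \<forall>x\<in>carrier M. h (a \<odot>\<^bsub>M\<^esub> x) = a \<odot>\<^bsub>N\<^esub> h x)}"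

definition mod_span :: "('r, 'x) ring_scheme \<Rightarrow> ('r, 'm, 'y) module_scheme \<Rightarrow> 'm set \<Rightarrow> 'm set" where
  "mod_span R M A = \<Inter>{N. submodule N R M \<and> A \<subseteq> N}"

definition mod_quot ::
  "('r, 'm, 'y) module_scheme \<Rightarrow> 'm set \<Rightarrow> ('r, 'm set) module" where
  "mod_quot M N = \<lparr>carrier = a_rcosets\<^bsub>M\<^esub> N, monoid.mult = undefined, monoid.one = undefined,
     ring.zero = N, ring.add = set_add M, module.smult = (\<lambda>a U. \<Union>u\<in>U. N +>\<^bsub>M\<^esub> (a \<odot>\<^bsub>M\<^esub> u))\<rparr>"

definition free_mod :: "('r, 'x) ring_scheme \<Rightarrow> 'b set \<Rightarrow> ('r, 'b \<Rightarrow> 'r) module" where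
  "free_mod R B = \<lparr>carrier = {c. (\<forall>b. c b \<in> carrier R) \<and> (\<forall>b. b \<notin> B \<longrightarrow> c b = \<zero>\<^bsub>R\<^esub>)
       \<and> finite {b. c b \<noteq> \<zero>\<^bsub>R\<^esub>}},
     monoid.mult = undefined, monoid.one = undefined, ring.zero = (\<lambda>_. \<zero>\<^bsub>R\<^esub>),
     ring.add = (\<lambda>c c' b. c b \<oplus>\<^bsub>R\<^esub> c' b), module.smult = (\<lambda>a c b. a \<otimes>\<^bsub>R\<^esub> c b)\<rparr>"

definition free_gen :: "('r, 'x) ring_scheme \<Rightarrow> 'b \<Rightarrow> 'b \<Rightarrow> 'r" where
  "free_gen R b = (\<lambda>b'. if b' = b then \<one>\<^bsub>R\<^esub> else \<zero>\<^bsub>R\<^esub>)"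


section \<open>Kaehler differentials\<close>

text \<open>\<open>B\<close> is the image of the base ring in \<open>R\<close>; only this image enters
  the relations of the module of differentials of \<open>R\<close> over the base ring.\<close>

definition kaehler_rels :: "('r, 'x) ring_scheme \<Rightarrow> 'r set \<Rightarrow> ('r \<Rightarrow> 'r) set" where
  "kaehler_rels R B = (let F = free_mod R (carrier R); \<delta> = free_gen R in
     {\<delta> (f \<oplus>\<^bsub>R\<^esub> g) \<ominus>\<^bsub>F\<^esub> (\<delta> f \<oplus>\<^bsub>F\<^esub> \<delta> g) | f g. f \<in> carrier R \<and> g \<in> carrier R} \<union>
     {\<delta> (f \<otimes>\<^bsub>R\<^esub> g) \<ominus>\<^bsub>F\<^esub> (f \<odot>\<^bsub>F\<^esub> \<delta> g \<oplus>\<^bsub>F\<^esub> g \<odot>\<^bsub>F\<^esub> \<delta> f) | f g. f \<in> carrier R \<and> g \<in> carrier R} \<union>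
     \<delta> ` B)"

definition kaehler :: "('r, 'x) ring_scheme \<Rightarrow> 'r set \<Rightarrow> ('r, ('r \<Rightarrow> 'r) set) module" where
  "kaehler R B = (let F = free_mod R (carrier R) in mod_quot F (mod_span R F (kaehler_rels R B)))"

definition kaehler_d :: "('r, 'x) ring_scheme \<Rightarrow> 'r set \<Rightarrow> 'r \<Rightarrow> ('r \<Rightarrow> 'r) set" where
  "kaehler_d R B f = (let F = free_mod R (carrier R) in
     mod_span R F (kaehler_rels R B) +>\<^bsub>F\<^esub> free_gen R f)"


section \<open>Exterior powers\<close>

definition tuples :: "('r, 'm, 'y) module_scheme \<Rightarrow> nat \<Rightarrow> 'm list set" where
  "tuples M m = {ws. length ws = m \<and> set ws \<subseteq> carrier M}"

definition ext_rels :: "('r, 'x) ring_scheme \<Rightarrow> ('r, 'm, 'y) module_scheme \<Rightarrow> nat \<Rightarrow> ('m list \<Rightarrow> 'r) set"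
  where
  "ext_rels R M m = (let F = free_mod R (tuples M m); \<delta> = free_gen R in
     {\<delta> (us @ [x \<oplus>\<^bsub>M\<^esub> y] @ vs) \<ominus>\<^bsub>F\<^esub> (\<delta> (us @ [x] @ vs) \<oplus>\<^bsub>F\<^esub> \<delta> (us @ [y] @ vs)) | us x y vs.
        us @ [x] @ vs \<in> tuples M m \<and> y \<in> carrier M} \<union>
     {\<delta> (us @ [a \<odot>\<^bsub>M\<^esub> x] @ vs) \<ominus>\<^bsub>F\<^esub> a \<odot>\<^bsub>F\<^esub> \<delta> (us @ [x] @ vs) | us a x vs.
        us @ [x] @ vs \<in> tuples M m \<and> a \<in> carrier R} \<union>
     {\<delta> (us @ [x] @ vs @ [x] @ zs) | us x vs zs. us @ [x] @ vs @ [x] @ zs \<in> tuples M m})"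

definition ext_power ::
  "('r, 'x) ring_scheme \<Rightarrow> ('r, 'm, 'y) module_scheme \<Rightarrow> nat \<Rightarrow> ('r, ('m list \<Rightarrow> 'r) set) module" where
  "ext_power R M m = (let F = free_mod R (tuples M m) in mod_quot F (mod_span R F (ext_rels R M m)))"

text \<open>\<open>wedge R M [w\<^sub>1, \<dots>, w\<^sub>m]\<close> is \<open>w\<^sub>1 \<and> \<dots> \<and> w\<^sub>m\<close>, an element of the \<open>m\<close>-th exterior power.\<close>

definition wedge ::
  "('r, 'x) ring_scheme \<Rightarrow> ('r, 'm, 'y) module_scheme \<Rightarrow> 'm list \<Rightarrow> ('m list \<Rightarrow> 'r) set" where
  "wedge R M ws = (let F = free_mod R (tuples M (length ws)) in
     mod_span R F (ext_rels R M (length ws)) +>\<^bsub>F\<^esub> free_gen R ws)"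

text \<open>The alternating sum defining the contraction of \<open>w\<^sub>1 \<and> \<dots> \<and> w\<^sub>m\<close> with \<open>e\<close>. List positions
  start at \<open>0\<close>, so the sign of the term at position \<open>j\<close> is \<open>(-1)\<^sup>j\<close>.\<close>

definition contract_wedge ::
  "('r, 'x) ring_scheme \<Rightarrow> ('r, 'm, 'y) module_scheme \<Rightarrow> ('m \<Rightarrow> 'r) \<Rightarrow> 'm list \<Rightarrow> ('m list \<Rightarrow> 'r) set"
  where
  "contract_wedge R M e ws =
     (\<Oplus>\<^bsub>ext_power R M (length ws - 1)\<^esub> j\<in>{..<length ws}.
        ((\<ominus>\<^bsub>R\<^esub> \<one>\<^bsub>R\<^esub>) [^]\<^bsub>R\<^esub> j \<otimes>\<^bsub>R\<^esub> e (ws ! j))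
          \<odot>\<^bsub>ext_power R M (length ws - 1)\<^esub> wedge R M (take j ws @ drop (Suc j) ws))"

text \<open>The linear maps below are determined by their values on generators. Since functions in HOL
  are total, uniqueness additionally requires them to be fixed off the carrier (\<^const>\<open>extensional\<close>).\<close>

definition contraction ::
  "('r, 'x) ring_scheme \<Rightarrow> ('r, 'm, 'y) module_scheme \<Rightarrow> ('m \<Rightarrow> 'r) \<Rightarrow> nat
     \<Rightarrow> ('m list \<Rightarrow> 'r) set \<Rightarrow> ('m list \<Rightarrow> 'r) set" where
  "contraction R M e m = (THE h.
     h \<in> extensional (carrier (ext_power R M m)) \<and>
     h \<in> mod_hom R (ext_power R M m) (ext_power R M (m - 1)) \<and>
     (\<forall>ws\<in>tuples M m. h (wedge R M ws) = contract_wedge R M e ws))"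

text \<open>The first exterior power of \<open>M\<close> is canonically \<open>M\<close>, but a different HOL type; a linear map
  \<open>e\<close> on \<open>M\<close> is transported along this identification.\<close>

definition on_ext1 ::
  "('r, 'x) ring_scheme \<Rightarrow> ('r, 'm, 'y) module_scheme \<Rightarrow> ('r, 'n, 'z) module_scheme \<Rightarrow> ('m \<Rightarrow> 'n)
     \<Rightarrow> ('m list \<Rightarrow> 'r) set \<Rightarrow> 'n" where
  "on_ext1 R M N e = (THE h.
     h \<in> extensional (carrier (ext_power R M 1)) \<and>
     h \<in> mod_hom R (ext_power R M 1) N \<and>
     (\<forall>w\<in>carrier M. h (wedge R M [w]) = e w))"


section \<open>The truncated polynomial ring\<close>

text \<open>Polynomials over \<open>'a\<close> in the \<open>CARD('n)\<close> variables indexed by \<open>'n\<close>: finitely supported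
  functions from exponent vectors to coefficients, with the convolution product.\<close>

type_synonym ('a, 'n) mpoly = "('n \<Rightarrow>\<^sub>0 nat) \<Rightarrow>\<^sub>0 'a"

text \<open>Elements of \<open>S\<close>, of \<open>\<Omega>\<^sup>1\<close> and of the exterior powers of \<open>\<Omega>\<^sup>1\<close>.\<close>

type_synonym ('a, 'n) trunc = "('a, 'n) mpoly set"
type_synonym ('a, 'n) diff1 = "(('a, 'n) trunc \<Rightarrow> ('a, 'n) trunc) set"
type_synonym ('a, 'n) dform = "(('a, 'n) diff1 list \<Rightarrow> ('a, 'n) trunc) set"

definition mpoly_ring :: "('a::field, 'n::finite) mpoly ring" where
  "mpoly_ring = ring_of_type_algebra"

definition mpoly_var :: "'n \<Rightarrow> ('a::field, 'n::finite) mpoly" where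
  "mpoly_var j = Poly_Mapping.single (Poly_Mapping.single j 1) 1"

definition mpoly_const :: "'a \<Rightarrow> ('a::field, 'n::finite) mpoly" where
  "mpoly_const c = Poly_Mapping.single 0 c"

definition mpoly_homog :: "nat \<Rightarrow> ('a::field, 'n::finite) mpoly set" where
  "mpoly_homog d = {f. \<forall>\<alpha>\<in>Poly_Mapping.keys f. (\<Sum>j\<in>UNIV. Poly_Mapping.lookup \<alpha> j) = d}"

definition var_ideal :: "('a::field, 'n::finite) mpoly set" where
  "var_ideal = genideal mpoly_ring {mpoly_var j | j. True}"

definition var_ideal_pow :: "nat \<Rightarrow> ('a::field, 'n::finite) mpoly set" where
  "var_ideal_pow k = var_ideal [^]\<^bsub>ideals_set mpoly_ring\<^esub> k"

definition trunc_ring :: "nat \<Rightarrow> ('a::field, 'n::finite) trunc ring" where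
  "trunc_ring k = mpoly_ring Quot var_ideal_pow k"

definition residue :: "nat \<Rightarrow> ('a::field, 'n::finite) mpoly \<Rightarrow> ('a, 'n) trunc" where
  "residue k f = var_ideal_pow k +>\<^bsub>mpoly_ring\<^esub> f"

definition trunc_scalars :: "nat \<Rightarrow> ('a::field, 'n::finite) trunc set" where
  "trunc_scalars k = {residue k (mpoly_const c) | c. True}"

definition trunc_comp :: "nat \<Rightarrow> nat \<Rightarrow> ('a::field, 'n::finite) trunc set" where
  "trunc_comp k d = residue k ` mpoly_homog d"

text \<open>The \<open>S\<close>-module \<open>\<qq>/\<qq>\<^sup>k\<close> and its homogeneous components.\<close>

definition trunc_max :: "nat \<Rightarrow> (('a::field, 'n::finite) trunc, ('a, 'n) trunc) module" where
  "trunc_max k = \<lparr>carrier = residue k ` var_ideal, monoid.mult = undefined, monoid.one = undefined,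
     ring.zero = \<zero>\<^bsub>trunc_ring k\<^esub>, ring.add = ring.add (trunc_ring k), module.smult = monoid.mult (trunc_ring k)\<rparr>"

definition trunc_max_comp :: "nat \<Rightarrow> nat \<Rightarrow> ('a::field, 'n::finite) trunc set" where
  "trunc_max_comp k i = carrier (trunc_max k) \<inter> trunc_comp k i"


section \<open>Differential forms and the Euler form\<close>

definition kdiffs :: "nat \<Rightarrow> (('a::field, 'n::finite) trunc, ('a, 'n) diff1) module" where
  "kdiffs k = kaehler (trunc_ring k) (trunc_scalars k)"

definition diff_d :: "nat \<Rightarrow> ('a::field, 'n::finite) trunc \<Rightarrow> ('a, 'n) diff1" where
  "diff_d k = kaehler_d (trunc_ring k) (trunc_scalars k)"

definition dforms :: "nat \<Rightarrow> nat \<Rightarrow> (('a::field, 'n::finite) trunc, ('a, 'n) dform) module" where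
  "dforms k m = ext_power (trunc_ring k) (kdiffs k) m"

definition dwedge :: "nat \<Rightarrow> ('a::field, 'n::finite) diff1 list \<Rightarrow> ('a, 'n) dform" where
  "dwedge k = wedge (trunc_ring k) (kdiffs k)"

text \<open>The degree \<open>i\<close> component of the \<open>m\<close>-forms consists of the finite sums of forms
  \<open>s dx\<^bsub>j\<^sub>1\<^esub> \<and> \<dots> \<and> dx\<^bsub>j\<^sub>m\<^esub>\<close> with \<open>s\<close> homogeneous of degree \<open>i - m\<close>.\<close>

definition dforms_comp :: "nat \<Rightarrow> nat \<Rightarrow> nat \<Rightarrow> ('a::field, 'n::finite) dform set" where
  "dforms_comp k m i = generate (add_monoid (dforms k m))
     {s \<odot>\<^bsub>dforms k m\<^esub> dwedge k (map (\<lambda>j. diff_d k (residue k (mpoly_var j))) js) | s d js.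
        length js = m \<and> s \<in> trunc_comp k d \<and> d + m = i}"

definition euler_form :: "nat \<Rightarrow> ('a::field, 'n::finite) diff1 \<Rightarrow> ('a, 'n) trunc" where
  "euler_form k = (THE e.
     e \<in> extensional (carrier (kdiffs k)) \<and>
     e \<in> mod_hom (trunc_ring k) (kdiffs k) (trunc_max k) \<and>
     (\<forall>d. \<forall>f\<in>trunc_comp k d. e (diff_d k f) = [d] \<cdot>\<^bsub>trunc_ring k\<^esub> f))"

definition euler_map1 :: "nat \<Rightarrow> ('a::field, 'n::finite) dform \<Rightarrow> ('a, 'n) trunc" where
  "euler_map1 k = on_ext1 (trunc_ring k) (kdiffs k) (trunc_max k) (euler_form k)"

definition euler_map :: "nat \<Rightarrow> nat \<Rightarrow> ('a::field, 'n::finite) dform \<Rightarrow> ('a, 'n) dform" where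
  "euler_map k m = contraction (trunc_ring k) (kdiffs k) (euler_form k) m"

end

theory Submission
  imports Defs
begin

text \<open>
  The maps of the complex are contractions with the Euler vector field, so that part (a) is the
  usual cancellation of signs. For part (b), let \<open>d\<close> be the exterior derivative on
  \<open>\<Omega>\<^bsub>S/K\<^esub>\<close>. Cartan's formula says that \<open>\<epsilon> d + d \<epsilon>\<close> is multiplication by \<open>i\<close> in degree
  \<open>i\<close>, which is a contracting homotopy once \<open>i\<close> is invertible in \<open>K\<close>; at the left end one uses
  \<open>\<Omega>\<^sup>n\<^sup>+\<^sup>1 = 0\<close>. Forms are calculated with in coordinates: a family of polynomials indexed by lists
  of variables represents a form, and the point is that \<open>d\<close> maps families that represent
  \<open>0\<close> to families that represent \<open>0\<close>.
\<close>

text \<open>The modules of forms over S are not free: every f in q^k imposes df = 0, so a form has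
  many coordinate families. Moreover d is not S-linear, whereas kernels of presentations are
  accessible only through submodules that contain their generators. Hence the families to look at
  are those all of whose polynomial multiples have a derivative that represents 0. Relations survive
  d for two reasons. If df = 0, then d(g df) = dg \<and> df + g ddf, where the first term contains
  df and the second vanishes because second partial derivatives are symmetric while wedges
  alternate. And a factor that occurs twice has coefficients a_i a_j, which are symmetric together
  with all their derivatives. Both cancellations pair off-diagonal terms and use alternation on the
  diagonal, so they work in every characteristic. Since dx_j has degree 1, d and the contraction
  preserve the degree. The scalar in Cartan's formula is deg f + m = i for a coefficient f of an
  m-form, the same at every place of the complex, so a single condition on i settles exactness
  everywhere.\<close>

abbreviation "lookup \<equiv> Poly_Mapping.lookup"
abbreviation "keys \<equiv> Poly_Mapping.keys"

section \<open>Families of finite support as free modules, and linear extension\<close>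

definition scale :: "'p::comm_ring_1 \<Rightarrow> ('b \<Rightarrow>\<^sub>0 'p) \<Rightarrow> ('b \<Rightarrow>\<^sub>0 'p)" where
  "scale f = Poly_Mapping.map ((*) f)"

lemma lookup_scale [simp]: "lookup (scale f c) b = f * lookup c b"
  unfolding scale_def by transfer (simp add: when_def)

interpretation scale: Modules.module "scale :: 'p::comm_ring_1 \<Rightarrow> ('b \<Rightarrow>\<^sub>0 'p) \<Rightarrow> _"
  by unfold_locales (auto intro!: poly_mapping_eqI simp: lookup_add algebra_simps)

abbreviation gen :: "'b \<Rightarrow> ('b \<Rightarrow>\<^sub>0 'p::comm_ring_1)" where
  "gen b \<equiv> Poly_Mapping.single b 1"

lemma scale_gen [simp]: "scale f (gen b) = Poly_Mapping.single b f"
  by (auto intro!: poly_mapping_eqI simp: lookup_single when_def)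

lemma sum_gen: "c = (\<Sum>b\<in>keys c. scale (lookup c b) (gen b))"
  by (rule poly_mapping_eqI)
    (simp add: lookup_sum lookup_single when_def in_keys_iff)

lemma subspace_sum_gen:
  assumes "scale.subspace W" and "\<And>b. b \<in> keys c \<Longrightarrow> scale (lookup c b) (gen b) \<in> W"
  shows "c \<in> W"
  using assms(2) by (subst sum_gen[of c]) (intro scale.subspace_sum assms(1))

definition lin_ext :: "('b \<Rightarrow> ('c \<Rightarrow>\<^sub>0 'p)) \<Rightarrow> ('b \<Rightarrow>\<^sub>0 'p) \<Rightarrow> ('c \<Rightarrow>\<^sub>0 'p::comm_ring_1)" where
  "lin_ext \<phi> c = (\<Sum>b\<in>keys c. scale (lookup c b) (\<phi> b))"

lemma lin_ext_superset:
  assumes "finite A" "keys c \<subseteq> A"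
  shows "lin_ext \<phi> c = (\<Sum>b\<in>A. scale (lookup c b) (\<phi> b))"
  unfolding lin_ext_def by (rule sum.mono_neutral_left) (use assms in \<open>auto simp: in_keys_iff\<close>)

lemma lin_ext_add: "lin_ext \<phi> (c + d) = lin_ext \<phi> c + lin_ext \<phi> d"
proof -
  let ?A = "keys c \<union> keys d"
  have "keys (c + d) \<subseteq> ?A" by (rule keys_add)
  then show ?thesis
    by (simp add: lin_ext_superset[of ?A] lookup_add scale.scale_left_distrib sum.distrib)
qed

lemma lin_ext_scale: "lin_ext \<phi> (scale f c) = scale f (lin_ext \<phi> c)"
proof -
  have "keys (scale f c) \<subseteq> keys c" by (auto simp: in_keys_iff)
  then show ?thesis
    by (simp add: lin_ext_superset[of "keys c"] scale.scale_sum_right)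
qed

lemma lin_ext_gen [simp]: "lin_ext \<phi> (gen b) = \<phi> b"
  by (simp add: lin_ext_superset[of "{b}"])

lemma lin_ext_zero [simp]: "lin_ext \<phi> 0 = 0"
  by (simp add: lin_ext_def)

lemma lin_ext_uminus: "lin_ext \<phi> (- c) = - lin_ext \<phi> c"
  using lin_ext_scale[of \<phi> "-1" c] by simp

lemma lin_ext_diff: "lin_ext \<phi> (c - d) = lin_ext \<phi> c - lin_ext \<phi> d"
  using lin_ext_add[of \<phi> c "-d"] by (simp add: lin_ext_uminus)

lemma lin_ext_sum: "lin_ext \<phi> (sum f A) = (\<Sum>x\<in>A. lin_ext \<phi> (f x))"
  by (induction A rule: infinite_finite_induct) (auto simp: lin_ext_add)

lemma subspace_vimage_lin_ext:
  "scale.subspace W \<Longrightarrow> scale.subspace {c. lin_ext \<phi> c \<in> W}"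
  by (auto simp: scale.subspace_def lin_ext_add lin_ext_scale)


section \<open>Presented modules\<close>

locale ring_presentation =
  fixes R :: "('r, 'x) ring_scheme" and res :: "'p::comm_ring_1 \<Rightarrow> 'r"
  assumes cring: "cring R" and range_res: "range res = carrier R"
    and res_add: "res (f + g) = res f \<oplus>\<^bsub>R\<^esub> res g"
    and res_mult: "res (f * g) = res f \<otimes>\<^bsub>R\<^esub> res g"
    and res_one: "res 1 = \<one>\<^bsub>R\<^esub>"
begin

sublocale R: cring R by (rule cring)

lemma res_closed [simp]: "res f \<in> carrier R"
  using range_res by blast

lemma res_zero: "res 0 = \<zero>\<^bsub>R\<^esub>"
  using res_add[of 0 0] R.add.l_cancel_one[of "res 0" "res 0"] by simp

lemma res_uminus: "res (- f) = \<ominus>\<^bsub>R\<^esub> res f"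
  using res_add[of "-f" f] by (intro R.minus_equality[symmetric]) (auto simp: res_zero)

lemma res_diff: "res (f - g) = res f \<ominus>\<^bsub>R\<^esub> res g"
  using res_add[of f "-g"] by (simp add: res_uminus R.minus_eq)

definition rep :: "'r \<Rightarrow> 'p" where "rep a = inv_into UNIV res a"

lemma res_rep [simp]: "a \<in> carrier R \<Longrightarrow> res (rep a) = a"
  unfolding rep_def using range_res by (simp add: f_inv_into_f)

lemma res_eq_iff: "res f = res g \<longleftrightarrow> res (f - g) = \<zero>\<^bsub>R\<^esub>"
  by (simp add: res_diff R.r_right_minus_eq)

lemma res_ideal: "res f = \<zero>\<^bsub>R\<^esub> \<Longrightarrow> res (g * f) = \<zero>\<^bsub>R\<^esub>"
  by (simp add: res_mult)

lemma res_surj: "a \<in> carrier R \<Longrightarrow> \<exists>f. a = res f"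
  using range_res by blast

lemma free_mod_module: "Module.module R (free_mod R B)"
proof -
  have fin: "finite {b. c b \<oplus>\<^bsub>R\<^esub> d b \<noteq> \<zero>\<^bsub>R\<^esub>}"
    if "finite {b. c b \<noteq> \<zero>\<^bsub>R\<^esub>}" "finite {b. d b \<noteq> \<zero>\<^bsub>R\<^esub>}" for c d :: "'b \<Rightarrow> 'r"
    by (rule finite_subset[OF _ finite_UnI[OF that]]) auto
  have fin2: "finite {b. a \<otimes>\<^bsub>R\<^esub> c b \<noteq> \<zero>\<^bsub>R\<^esub>}" if "finite {b. c b \<noteq> \<zero>\<^bsub>R\<^esub>}" "a \<in> carrier R" for a and c :: "'b \<Rightarrow> 'r"
    by (rule finite_subset[OF _ that(1)]) (use that(2) in auto)
  have "abelian_group (free_mod R B)"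
  proof (rule abelian_groupI)
    fix x assume x: "x \<in> carrier (free_mod R B)"
    show "\<exists>y\<in>carrier (free_mod R B). y \<oplus>\<^bsub>free_mod R B\<^esub> x = \<zero>\<^bsub>free_mod R B\<^esub>"
    proof
      show "(\<lambda>b. \<ominus>\<^bsub>R\<^esub> x b) \<in> carrier (free_mod R B)"
        using x by (auto simp: free_mod_def elim!: rev_finite_subset)
      show "(\<lambda>b. \<ominus>\<^bsub>R\<^esub> x b) \<oplus>\<^bsub>free_mod R B\<^esub> x = \<zero>\<^bsub>free_mod R B\<^esub>"
        using x by (auto simp: free_mod_def R.l_neg)
    qed
  qed (auto simp: free_mod_def R.a_ac fin)
  then show ?thesis
    by (rule Module.moduleI[OF cring])
      (auto simp: free_mod_def fin2 R.l_distr R.r_distr R.m_assoc)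
qed

end

lemma (in Module.module) mod_span_submodule:
  assumes "A \<subseteq> carrier M"
  shows "submodule (mod_span R M A) R M" and "A \<subseteq> mod_span R M A"
proof -
  have c: "submodule (carrier M) R M" by (rule carrier_is_submodule)
  show "submodule (mod_span R M A) R M"
    unfolding mod_span_def
  proof (rule submoduleI)
    show "\<Inter> {N. submodule N R M \<and> A \<subseteq> N} \<subseteq> carrier M" using c assms by blast
  qed (auto dest: submoduleE submodule.axioms(1) subgroup.one_closed[of _ "add_monoid M", simplified]
        submodule.smult_closed)
qed (auto simp: mod_span_def)

text \<open>A module given by generators \<open>B\<close> and relations \<open>rels\<close>. Coefficients are
  taken in the type \<open>'p\<close>, which maps onto the ring, so that calculations take place in the
  type class \<open>ab_group_add\<close>, modulo the kernel of \<open>cl\<close>.\<close>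

locale module_presentation = ring_presentation R res
  for R :: "('r, 'x) ring_scheme" and res :: "'p::comm_ring_1 \<Rightarrow> 'r" +
  fixes M :: "('r, 'm, 'y) module_scheme" and cl :: "('b \<Rightarrow>\<^sub>0 'p) \<Rightarrow> 'm"
    and B :: "'b set" and rels :: "('b \<Rightarrow>\<^sub>0 'p) set"
  assumes range_cl: "range cl = carrier M"
    and cl_add: "\<And>a b. cl (a + b) = cl a \<oplus>\<^bsub>M\<^esub> cl b"
    and cl_scale: "\<And>f a. cl (scale f a) = res f \<odot>\<^bsub>M\<^esub> cl a"
    and cl_zero: "cl 0 = \<zero>\<^bsub>M\<^esub>"
    and cl_cancel: "\<And>a b. cl a = cl b \<Longrightarrow> cl (a - b) = \<zero>\<^bsub>M\<^esub>"
    and cl_outside: "\<And>b. b \<notin> B \<Longrightarrow> cl (gen b) = \<zero>\<^bsub>M\<^esub>"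
    and cl_rels: "\<And>c. c \<in> rels \<Longrightarrow> cl c = \<zero>\<^bsub>M\<^esub>"
    and cl_min: "\<And>W c. \<lbrakk>scale.subspace W; \<And>f b. res f = \<zero>\<^bsub>R\<^esub> \<Longrightarrow> scale f (gen b) \<in> W;
      \<And>b. b \<notin> B \<Longrightarrow> gen b \<in> W; rels \<subseteq> W; cl c = \<zero>\<^bsub>M\<^esub>\<rbrakk> \<Longrightarrow> c \<in> W"
begin

definition ker :: "('b \<Rightarrow>\<^sub>0 'p) set" where "ker = {c. cl c = \<zero>\<^bsub>M\<^esub>}"

lemma cl_closed [simp]: "cl a \<in> carrier M"
  using range_cl by blast

lemma cl_surj: "x \<in> carrier M \<Longrightarrow> \<exists>c. x = cl c"
  using range_cl by blast

lemma abelian: "abelian_group M"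
proof (rule abelian_groupI)
  fix x assume "x \<in> carrier M"
  then obtain a where "x = cl a" using cl_surj by blast
  then have "cl (- a) \<oplus>\<^bsub>M\<^esub> x = \<zero>\<^bsub>M\<^esub>" by (simp add: cl_zero flip: cl_add)
  then show "\<exists>y\<in>carrier M. y \<oplus>\<^bsub>M\<^esub> x = \<zero>\<^bsub>M\<^esub>" by force
qed (auto dest!: cl_surj simp: cl_zero[symmetric] add_ac simp flip: cl_add)

sublocale M: abelian_group M by (rule abelian)

lemma cl_uminus: "cl (- a) = \<ominus>\<^bsub>M\<^esub> cl a"
  by (rule M.minus_equality[symmetric]) (auto simp: cl_zero simp flip: cl_add)

lemma cl_eq_iff: "cl a = cl b \<longleftrightarrow> a - b \<in> ker"
proof
  assume "a - b \<in> ker"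
  then have "cl (a - b + b) = cl b" by (simp only: cl_add ker_def) simp
  then show "cl a = cl b" by simp
qed (simp add: ker_def cl_cancel)

lemma cl_sum: "cl (\<Sum>x\<in>A. f x) = (\<Oplus>\<^bsub>M\<^esub>x\<in>A. cl (f x))" if "finite A"
  using that by (induction A) (auto simp: cl_zero cl_add)

lemma ker_subspace: "scale.subspace ker"
proof -
  have "res f \<odot>\<^bsub>M\<^esub> \<zero>\<^bsub>M\<^esub> = \<zero>\<^bsub>M\<^esub>" for f
    using cl_scale[of f 0] by (simp add: cl_zero)
  then show ?thesis by (auto simp: scale.subspace_def ker_def cl_zero cl_add cl_scale)
qed

lemmas ker_closed = scale.subspace_0[OF ker_subspace] scale.subspace_add[OF ker_subspace]
  scale.subspace_diff[OF ker_subspace] scale.subspace_neg[OF ker_subspace]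
  scale.subspace_scale[OF ker_subspace] scale.subspace_sum[OF ker_subspace]

lemma ker_res: "res f = \<zero>\<^bsub>R\<^esub> \<Longrightarrow> scale f c \<in> ker"
  using cl_scale[of f c] cl_scale[of 0 c] by (simp add: ker_def cl_zero res_zero)

text \<open>The induction principle for relations: a submodule contains the kernel once it contains
  the relators, the symbols outside \<open>B\<close> and all multiples by elements killed by
  \<open>res\<close>. The well-definedness proofs below apply it with \<open>W\<close> the preimage
  of a submodule.\<close>

lemma ker_min:
  assumes "scale.subspace W" "\<And>f b. res f = \<zero>\<^bsub>R\<^esub> \<Longrightarrow> scale f (gen b) \<in> W"
    "\<And>b. b \<notin> B \<Longrightarrow> gen b \<in> W" "\<And>c. c \<in> rels \<Longrightarrow> c \<in> W"
  shows "ker \<subseteq> W"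
  unfolding ker_def using cl_min[OF assms(1-3) subsetI[OF assms(4)]] by blast

text \<open>Maps out of a presented module are given on representatives. The target is a bare record
  with the laws that the argument uses, so that it may be \<open>trunc_max\<close>; the map is
  restricted to the carrier because the maps to be constructed are pinned down by
  \<open>extensional\<close>.\<close>

lemma lift:
  fixes N :: "('r, 'n, 'z) module_scheme"
  assumes g: "\<And>c. g c \<in> carrier N" "\<And>a b. g (a + b) = g a \<oplus>\<^bsub>N\<^esub> g b"
      "\<And>f a. g (scale f a) = res f \<odot>\<^bsub>N\<^esub> g a" "\<And>c. c \<in> ker \<Longrightarrow> g c = \<zero>\<^bsub>N\<^esub>"
    and N: "\<And>x. x \<in> carrier N \<Longrightarrow> \<zero>\<^bsub>N\<^esub> \<oplus>\<^bsub>N\<^esub> x = x"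
  shows "\<exists>h. h \<in> extensional (carrier M) \<and> h \<in> mod_hom R M N \<and> (\<forall>c. h (cl c) = g c)"
proof -
  define h where "h = restrict (\<lambda>x. g (SOME c. cl c = x)) (carrier M)"
  have *: "h (cl c) = g c" for c
  proof -
    define a where "a = (SOME a. cl a = cl c)"
    have "cl a = cl c" unfolding a_def by (rule someI[of _ c]) simp
    then have "g (a - c + c) = g c" using g(2)[of "a - c" c]
      using g N by (simp add: cl_eq_iff)
    then show ?thesis by (simp add: h_def a_def)
  qed
  have "h \<in> mod_hom R M N"
    unfolding mod_hom_def
    by (auto dest!: cl_surj res_surj simp: * g(1,2,3) simp flip: cl_add cl_scale)
  then show ?thesis using * by (intro exI[of _ h]) (auto simp: h_def)
qed

text \<open>The representatives on which two linear maps agree form a submodule that contains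
  \<open>ker\<close>. Generation by \<open>G\<close> is therefore demanded only modulo
  \<open>ker\<close>: the dx_j generate the differentials, but not the free module on all
  symbols.\<close>

lemma hom_ext:
  fixes N :: "('r, 'n, 'z) module_scheme"
  assumes h: "h \<in> mod_hom R M N" "h' \<in> mod_hom R M N"
    and G: "\<And>W. \<lbrakk>scale.subspace W; ker \<subseteq> W; \<And>c. c \<in> G \<Longrightarrow> c \<in> W\<rbrakk> \<Longrightarrow> W = UNIV"
    and eq: "\<And>c. c \<in> G \<Longrightarrow> h (cl c) = h' (cl c)"
    and N: "\<And>x. x \<in> carrier N \<Longrightarrow> \<zero>\<^bsub>R\<^esub> \<odot>\<^bsub>N\<^esub> x = \<zero>\<^bsub>N\<^esub>"
    and x: "x \<in> carrier M"
  shows "h x = h' x"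
proof -
  have *: "f \<zero>\<^bsub>M\<^esub> = \<zero>\<^bsub>N\<^esub>" if "f \<in> mod_hom R M N" for f
  proof -
    have "f \<zero>\<^bsub>M\<^esub> \<in> carrier N" "f (\<zero>\<^bsub>R\<^esub> \<odot>\<^bsub>M\<^esub> \<zero>\<^bsub>M\<^esub>) = \<zero>\<^bsub>R\<^esub> \<odot>\<^bsub>N\<^esub> f \<zero>\<^bsub>M\<^esub>"
      using that by (auto simp: mod_hom_def)
    then show ?thesis using N cl_scale[of 0 0] by (simp add: cl_zero res_zero)
  qed
  then have z: "h \<zero>\<^bsub>M\<^esub> = h' \<zero>\<^bsub>M\<^esub>" by (simp only: *[OF h(1)] *[OF h(2)])
  let ?W = "{c. h (cl c) = h' (cl c)}"
  have "scale.subspace ?W"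
    using h z by (auto simp: scale.subspace_def mod_hom_def cl_zero cl_add cl_scale)
  then have "?W = UNIV"
    by (rule G) (use eq z in \<open>auto simp: ker_def\<close>)
  then show ?thesis using cl_surj[OF x] by auto
qed

lemma hom_ext_gen:
  fixes N :: "('r, 'n, 'z) module_scheme"
  assumes h: "h \<in> mod_hom R M N" "h' \<in> mod_hom R M N"
    and eq: "\<And>b. b \<in> B \<Longrightarrow> h (cl (gen b)) = h' (cl (gen b))"
    and N: "\<And>x. x \<in> carrier N \<Longrightarrow> \<zero>\<^bsub>R\<^esub> \<odot>\<^bsub>N\<^esub> x = \<zero>\<^bsub>N\<^esub>"
    and x: "x \<in> carrier M"
  shows "h x = h' x"
proof (rule hom_ext[OF h _ _ N x])
  fix W :: "('b \<Rightarrow>\<^sub>0 'p) set" assume W: "scale.subspace W" "ker \<subseteq> W" "\<And>c. c \<in> gen ` B \<Longrightarrow> c \<in> W"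
  have "gen b \<in> W" for b
    using W(2) W(3)[of "gen b"] cl_outside[of b] by (cases "b \<in> B") (auto simp: ker_def)
  then show "W = UNIV"
    using subspace_sum_gen[OF W(1) scale.subspace_scale[OF W(1)]] by blast
qed (use eq in auto)

lemma smult_zero: "x \<in> carrier M \<Longrightarrow> \<zero>\<^bsub>R\<^esub> \<odot>\<^bsub>M\<^esub> x = \<zero>\<^bsub>M\<^esub>"
  using cl_scale[of 0] cl_surj by (metis cl_zero scale.scale_zero_left res_zero)

end

section \<open>Quotients of free modules as presented modules\<close>

context ring_presentation
begin

definition reduce :: "'b set \<Rightarrow> ('b \<Rightarrow>\<^sub>0 'p) \<Rightarrow> 'b \<Rightarrow> 'r" where
  "reduce B c = (\<lambda>b. if b \<in> B then res (lookup c b) else \<zero>\<^bsub>R\<^esub>)"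

lemma reduce_closed: "reduce B c \<in> carrier (free_mod R B)"
proof -
  have "{b. reduce B c b \<noteq> \<zero>\<^bsub>R\<^esub>} \<subseteq> keys c" by (auto simp: reduce_def in_keys_iff res_zero)
  then show ?thesis using finite_subset[OF _ finite_keys]
    by (auto simp: free_mod_def) (auto simp: reduce_def)
qed

lemma reduce_add: "reduce B (a + b) = reduce B a \<oplus>\<^bsub>free_mod R B\<^esub> reduce B b"
  by (auto simp: reduce_def free_mod_def lookup_add res_add)

lemma reduce_scale: "reduce B (scale f a) = res f \<odot>\<^bsub>free_mod R B\<^esub> reduce B a"
  by (auto simp: reduce_def free_mod_def res_mult)

lemma reduce_zero: "reduce B 0 = \<zero>\<^bsub>free_mod R B\<^esub>"
  by (auto simp: reduce_def free_mod_def res_zero)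

lemma reduce_uminus: "reduce B (- a) = \<ominus>\<^bsub>free_mod R B\<^esub> reduce B a"
proof -
  interpret F: Module.module R "free_mod R B" by (rule free_mod_module)
  show ?thesis
    by (rule F.minus_equality[symmetric]) (auto simp: reduce_zero reduce_closed simp flip: reduce_add)
qed

lemma reduce_diff: "reduce B (a - b) = reduce B a \<ominus>\<^bsub>free_mod R B\<^esub> reduce B b"
  using reduce_add[of B a "- b"] by (simp add: reduce_uminus a_minus_def)

lemma reduce_gen: "b \<in> B \<Longrightarrow> reduce B (gen b) = free_gen R b"
  by (auto simp: reduce_def free_gen_def lookup_single when_def res_zero res_one fun_eq_iff)

lemma reduce_surj:
  assumes x: "x \<in> carrier (free_mod R B)"
  shows "\<exists>c. x = reduce B c"
proof -
  have fin: "finite {b. rep (x b) \<noteq> 0 \<and> x b \<noteq> \<zero>\<^bsub>R\<^esub>}"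
    using x by (auto simp: free_mod_def)
  \<comment> \<open>The lift that \<open>rep\<close> picks for zero may be a nonzero element of the
    kernel of \<open>res\<close>. The case distinction keeps the support finite.\<close>
  define c where "c = Abs_poly_mapping (\<lambda>b. if x b = \<zero>\<^bsub>R\<^esub> then 0 else rep (x b))"
  have "{b. (if x b = \<zero>\<^bsub>R\<^esub> then 0 else rep (x b)) \<noteq> 0} = {b. rep (x b) \<noteq> 0 \<and> x b \<noteq> \<zero>\<^bsub>R\<^esub>}"
    by auto
  with fin have "lookup c = (\<lambda>b. if x b = \<zero>\<^bsub>R\<^esub> then 0 else rep (x b))"
    unfolding c_def by (intro lookup_Abs_poly_mapping) simp
  then have "x = reduce B c"
    using x by (auto simp: reduce_def free_mod_def res_zero fun_eq_iff)
  then show ?thesis ..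
qed

text \<open>The axiom to work for is minimality. Reduction of coefficients carries a submodule
  \<open>W\<close> of families to a submodule of the free module, and this contains the span of the
  relations once \<open>W\<close> contains the relators. So an element of the kernel has the same
  reduction as some element of \<open>W\<close>.\<close>

lemma free_module_presentation:
  fixes B :: "'b set" and rels :: "('b \<Rightarrow>\<^sub>0 'p) set"
  assumes A: "A = reduce B ` rels"
  defines "F \<equiv> free_mod R B"
  defines "N \<equiv> mod_span R F A"
  shows "module_presentation R res (mod_quot F N) (\<lambda>c. N +>\<^bsub>F\<^esub> reduce B c) B rels"
proof -
  interpret F: Module.module R F unfolding F_def by (rule free_mod_module)
  note reduce_closed = reduce_closed[of B, folded F_def]
    and reduce_add = reduce_add[of B, folded F_def]
    and reduce_scale = reduce_scale[of B, folded F_def]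
    and reduce_zero = reduce_zero[of B, folded F_def]
    and reduce_uminus = reduce_uminus[of B, folded F_def]
    and reduce_surj = reduce_surj[of _ B, folded F_def]
  have sub: "submodule N R F" "A \<subseteq> N"
    unfolding N_def using F.mod_span_submodule[of A] reduce_closed by (auto simp: A)
  interpret N: abelian_subgroup N F
    by (rule abelian_subgroupI3)
      (use sub(1) F.abelian_group_axioms in \<open>auto simp: additive_subgroup_def submodule_def\<close>)
  have N_zero: "N +>\<^bsub>F\<^esub> reduce B c = N \<longleftrightarrow> reduce B c \<in> N" for c
    using N.a_rcos_self[OF reduce_closed[of c]] N.a_rcos_const by blast
  have addN: "(N +>\<^bsub>F\<^esub> reduce B a) <+>\<^bsub>F\<^esub> (N +>\<^bsub>F\<^esub> reduce B b) = N +>\<^bsub>F\<^esub> reduce B (a + b)" for a b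
    by (simp add: N.a_rcos_sum reduce_closed reduce_add)
  \<comment> \<open>Scalar multiplication in \<open>mod_quot\<close> is a union over the members of
    a coset. All sets in this union are one and the same coset, since multiples of \<open>N\<close>
    stay in \<open>N\<close>.\<close>
  have smultN: "(\<Union>u\<in>N +>\<^bsub>F\<^esub> reduce B a. N +>\<^bsub>F\<^esub> (res f \<odot>\<^bsub>F\<^esub> u)) = N +>\<^bsub>F\<^esub> reduce B (scale f a)" for f a
  proof -
    have "N +>\<^bsub>F\<^esub> (res f \<odot>\<^bsub>F\<^esub> u) = N +>\<^bsub>F\<^esub> reduce B (scale f a)" if u: "u \<in> N +>\<^bsub>F\<^esub> reduce B a" for u
    proof -
      obtain v where v: "v \<in> N" "u = v \<oplus>\<^bsub>F\<^esub> reduce B a"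
        using u by (auto simp: a_r_coset_def r_coset_def)
      have "res f \<odot>\<^bsub>F\<^esub> u = res f \<odot>\<^bsub>F\<^esub> v \<oplus>\<^bsub>F\<^esub> reduce B (scale f a)"
        using v by (simp add: F.smult_r_distr reduce_scale reduce_closed)
      moreover have "res f \<odot>\<^bsub>F\<^esub> v \<in> N"
        using sub(1) v(1) by (simp add: submodule.smult_closed)
      ultimately have "res f \<odot>\<^bsub>F\<^esub> u \<in> N +>\<^bsub>F\<^esub> reduce B (scale f a)"
        by (auto simp: a_r_coset_def r_coset_def)
      then show ?thesis
        using F.a_repr_independence N.a_subgroup reduce_closed
        by (metis N.additive_subgroup_axioms additive_subgroup.a_subgroup)
    qed
    moreover have "reduce B a \<in> N +>\<^bsub>F\<^esub> reduce B a" by (rule N.a_rcos_self[OF reduce_closed])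
    ultimately show ?thesis by blast
  qed
  show ?thesis
  proof (unfold_locales, goal_cases)
    case 1
    show ?case
      by (force simp: mod_quot_def A_RCOSETS_def' image_iff intro: reduce_closed dest!: reduce_surj)
  next
    case (2 a b) then show ?case by (simp add: mod_quot_def addN)
  next
    case (3 f a) then show ?case by (simp add: mod_quot_def smultN)
  next
    case 4 then show ?case by (simp add: mod_quot_def reduce_zero N.a_subset)
  next
    case (5 a b)
    then have "(N +>\<^bsub>F\<^esub> reduce B a) <+>\<^bsub>F\<^esub> (N +>\<^bsub>F\<^esub> reduce B (-b)) = (N +>\<^bsub>F\<^esub> reduce B b) <+>\<^bsub>F\<^esub> (N +>\<^bsub>F\<^esub> reduce B (-b))"
      by simp
    then show ?case by (simp add: addN mod_quot_def reduce_zero N.a_subset)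
  next
    case (6 b)
    then have "reduce B (gen b) = reduce B 0"
      by (auto simp: reduce_def lookup_single when_def res_zero)
    then show ?case by (simp add: mod_quot_def reduce_zero N.a_subset)
  next
    case (7 c)
    then show ?case using sub(2) by (auto simp: A mod_quot_def N_zero)
  next
    case (8 W c)
    have "submodule (reduce B ` W) R F"
    proof (rule F.submoduleI)
      show "\<zero>\<^bsub>F\<^esub> \<in> reduce B ` W"
        using scale.subspace_0[OF 8(1)] by (force simp flip: reduce_zero)
    qed (auto simp: reduce_closed scale.subspace_neg[OF 8(1)] scale.subspace_add[OF 8(1)]
        scale.subspace_scale[OF 8(1)] dest!: res_surj simp flip: reduce_uminus reduce_add reduce_scale)
    moreover have "A \<subseteq> reduce B ` W" using 8(4) by (auto simp: A)
    ultimately have "N \<subseteq> reduce B ` W" unfolding N_def mod_span_def by blast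
    moreover have "reduce B c \<in> N" using 8(5) by (simp add: mod_quot_def N_zero)
    ultimately obtain d where d: "d \<in> W" "reduce B c = reduce B d" by blast
    \<comment> \<open>Equal reductions mean that each coefficient of \<open>c - d\<close> is killed
      by \<open>res\<close> or belongs to a symbol outside \<open>B\<close>; \<open>W\<close>
      contains both kinds of terms.\<close>
    have "c - d \<in> W"
    proof (rule subspace_sum_gen[OF 8(1)])
      fix b
      show "scale (lookup (c - d) b) (gen b) \<in> W"
      proof (cases "b \<in> B")
        case True
        then have "res (lookup (c - d) b) = \<zero>\<^bsub>R\<^esub>"
          using fun_cong[OF d(2), of b] by (simp add: reduce_def lookup_minus flip: res_eq_iff)
        then show ?thesis by (rule 8(2))
      next
        case False
        then show ?thesis by (intro scale.subspace_scale[OF 8(1)] 8(3))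
      qed
    qed
    then show ?case using scale.subspace_add[OF 8(1) _ d(1)] by fastforce
  qed
qed

end


section \<open>Presentations of differentials and exterior powers\<close>

context ring_presentation
begin

text \<open>The scalars of the Leibniz relator must lie in \<open>'p\<close>, so its two factors are
  given by preimages \<open>f\<close> and \<open>g\<close>. Other preimages change the relator by
  terms that \<open>reduce\<close> kills.\<close>

definition kaehler_relators :: "'r set \<Rightarrow> ('r \<Rightarrow>\<^sub>0 'p) set" where
  "kaehler_relators K =
     {gen (a \<oplus>\<^bsub>R\<^esub> b) - (gen a + gen b) | a b. a \<in> carrier R \<and> b \<in> carrier R} \<union>
     {gen (res (f * g)) - (scale f (gen (res g)) + scale g (gen (res f))) | f g. True} \<union> gen ` K"

definition kaehler_cl :: "'r set \<Rightarrow> ('r \<Rightarrow>\<^sub>0 'p) \<Rightarrow> ('r \<Rightarrow> 'r) set" where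
  "kaehler_cl K c = mod_span R (free_mod R (carrier R)) (kaehler_rels R K)
     +>\<^bsub>free_mod R (carrier R)\<^esub> reduce (carrier R) c"

lemma kaehler_pres:
  assumes K: "K \<subseteq> carrier R"
  shows "module_presentation R res (kaehler R K) (kaehler_cl K) (carrier R) (kaehler_relators K)"
proof -
  have g: "reduce (carrier R) (gen a) = free_gen R a" if "a \<in> carrier R" for a
    using that by (rule reduce_gen)
  have "kaehler_rels R K = reduce (carrier R) ` kaehler_relators K"
    unfolding kaehler_rels_def kaehler_relators_def Let_def image_Un
  proof (intro arg_cong2[where f = "(\<union>)"], goal_cases)
    case 1
    have *: "free_gen R (a \<oplus>\<^bsub>R\<^esub> b) \<ominus>\<^bsub>free_mod R (carrier R)\<^esub>
        (free_gen R a \<oplus>\<^bsub>free_mod R (carrier R)\<^esub> free_gen R b)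
      = reduce (carrier R) (gen (a \<oplus>\<^bsub>R\<^esub> b) - (gen a + gen b))"
      if "a \<in> carrier R" "b \<in> carrier R" for a b
      using that by (simp add: reduce_diff reduce_add g)
    show ?case
      by (simp only: set_eq_iff image_iff mem_Collect_eq bex_simps) (use * in metis)
  next
    case 2
    have "free_gen R (res f \<otimes>\<^bsub>R\<^esub> res h) \<ominus>\<^bsub>free_mod R (carrier R)\<^esub>
        (res f \<odot>\<^bsub>free_mod R (carrier R)\<^esub> free_gen R (res h)
          \<oplus>\<^bsub>free_mod R (carrier R)\<^esub> res h \<odot>\<^bsub>free_mod R (carrier R)\<^esub> free_gen R (res f))
      = reduce (carrier R) (gen (res (f * h)) - (scale f (gen (res h)) + scale h (gen (res f))))" for f h
      by (simp add: reduce_diff reduce_add reduce_scale g res_mult del: scale_gen)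
    then show ?case
      by (simp add: set_eq_iff image_iff del: scale_gen) (metis res_surj res_closed)
  next
    case 3
    show ?case using K g by (auto simp: image_iff) (metis subsetD)+
  qed
  from free_module_presentation[OF this] show ?thesis
    unfolding kaehler_def kaehler_cl_def[abs_def] Let_def .
qed

lemma kaehler_d_eq: "a \<in> carrier R \<Longrightarrow> kaehler_d R K a = kaehler_cl K (gen a)"
  by (simp add: kaehler_d_def kaehler_cl_def reduce_gen Let_def)

end

section \<open>Exterior powers: multilinearity, alternation and signs\<close>

locale exterior_powers = ring_presentation R res
  for R :: "('r, 'x) ring_scheme" and res :: "'p::comm_ring_1 \<Rightarrow> 'r" +
  fixes M :: "('r, 'm, 'y) module_scheme"
  assumes M_add: "\<lbrakk>x \<in> carrier M; y \<in> carrier M\<rbrakk> \<Longrightarrow> x \<oplus>\<^bsub>M\<^esub> y \<in> carrier M"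
    and M_smult: "\<lbrakk>a \<in> carrier R; x \<in> carrier M\<rbrakk> \<Longrightarrow> a \<odot>\<^bsub>M\<^esub> x \<in> carrier M"
begin

definition ext_relators :: "nat \<Rightarrow> ('m list \<Rightarrow>\<^sub>0 'p) set" where
  "ext_relators m =
     {gen (us @ [x \<oplus>\<^bsub>M\<^esub> y] @ vs) - (gen (us @ [x] @ vs) + gen (us @ [y] @ vs)) | us x y vs.
        us @ [x] @ vs \<in> tuples M m \<and> y \<in> carrier M} \<union>
     {gen (us @ [res f \<odot>\<^bsub>M\<^esub> x] @ vs) - scale f (gen (us @ [x] @ vs)) | us f x vs.
        us @ [x] @ vs \<in> tuples M m} \<union>
     {gen (us @ [x] @ vs @ [x] @ zs) | us x vs zs. us @ [x] @ vs @ [x] @ zs \<in> tuples M m}"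

definition ext_cl :: "nat \<Rightarrow> ('m list \<Rightarrow>\<^sub>0 'p) \<Rightarrow> ('m list \<Rightarrow> 'r) set" where
  "ext_cl m c = mod_span R (free_mod R (tuples M m)) (ext_rels R M m)
     +>\<^bsub>free_mod R (tuples M m)\<^esub> reduce (tuples M m) c"

lemma ext_power_pres: "module_presentation R res (ext_power R M m) (ext_cl m) (tuples M m) (ext_relators m)"
proof -
  let ?B = "tuples M m" and ?F = "free_mod R (tuples M m)"
  have g: "reduce ?B (gen a) = free_gen R a" if "a \<in> ?B" for a
    using that by (rule reduce_gen)
  have "ext_rels R M m = reduce ?B ` ext_relators m"
    unfolding ext_rels_def ext_relators_def Let_def image_Un
  proof (intro arg_cong2[where f = "(\<union>)"], goal_cases)
    case 1
    have *: "free_gen R (us @ [x \<oplus>\<^bsub>M\<^esub> y] @ vs) \<ominus>\<^bsub>?F\<^esub> (free_gen R (us @ [x] @ vs) \<oplus>\<^bsub>?F\<^esub> free_gen R (us @ [y] @ vs))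
      = reduce ?B (gen (us @ [x \<oplus>\<^bsub>M\<^esub> y] @ vs) - (gen (us @ [x] @ vs) + gen (us @ [y] @ vs)))"
      if "us @ [x] @ vs \<in> ?B" "y \<in> carrier M" for us x y vs
      unfolding reduce_diff reduce_add by (subst (1 2 3) g) (use that M_add in \<open>auto simp: tuples_def\<close>)
    show ?case
      by (simp only: set_eq_iff image_iff mem_Collect_eq bex_simps) (use * in metis)
  next
    case 2
    have *: "free_gen R (us @ [res f \<odot>\<^bsub>M\<^esub> x] @ vs) \<ominus>\<^bsub>?F\<^esub> res f \<odot>\<^bsub>?F\<^esub> free_gen R (us @ [x] @ vs)
      = reduce ?B (gen (us @ [res f \<odot>\<^bsub>M\<^esub> x] @ vs) - scale f (gen (us @ [x] @ vs)))"
      if "us @ [x] @ vs \<in> ?B" for us f x vs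
      unfolding reduce_diff reduce_scale by (subst (1 2) g) (use that M_smult in \<open>auto simp: tuples_def\<close>)
    show ?case
      by (simp only: set_eq_iff image_iff mem_Collect_eq bex_simps) (use * res_surj res_closed in metis)
  next
    case 3
    show ?case
      by (simp only: set_eq_iff image_iff mem_Collect_eq bex_simps) (use g in metis)
  qed
  from free_module_presentation[OF this] show ?thesis
    unfolding ext_power_def ext_cl_def[abs_def] Let_def .
qed

sublocale ext: module_presentation R res "ext_power R M m" "ext_cl m" "tuples M m" "ext_relators m" for m
  by (rule ext_power_pres)

abbreviation "wker \<equiv> ext.ker"

lemma wedge_eq: "ws \<in> tuples M m \<Longrightarrow> wedge R M ws = ext_cl m (gen ws)"
  by (simp add: wedge_def ext_cl_def reduce_gen Let_def tuples_def)

lemma ker_ext_relators: "c \<in> ext_relators m \<Longrightarrow> c \<in> wker m"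
  by (simp add: ext.ker_def ext.cl_rels)

lemma wker_add:
  assumes "us @ x # vs \<in> tuples M m" "y \<in> carrier M"
  shows "gen (us @ (x \<oplus>\<^bsub>M\<^esub> y) # vs) - (gen (us @ x # vs) + gen (us @ y # vs)) \<in> wker m"
  using assms by (intro ker_ext_relators) (auto simp: ext_relators_def)

lemma wker_smult:
  assumes "us @ x # vs \<in> tuples M m"
  shows "gen (us @ (res f \<odot>\<^bsub>M\<^esub> x) # vs) - scale f (gen (us @ x # vs)) \<in> wker m"
  using assms by (intro ker_ext_relators) (auto simp: ext_relators_def simp del: scale_gen)

lemma wker_alt:
  assumes "us @ x # vs @ x # zs \<in> tuples M m"
  shows "gen (us @ x # vs @ x # zs) \<in> wker m"
  using assms by (intro ker_ext_relators) (auto simp: ext_relators_def simp del: scale_gen)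

text \<open>Polarization: expand the vanishing wedge with the sum of \<open>x\<close> and
  \<open>y\<close> in both slots and discard the two diagonal terms.\<close>

lemma wker_swap:
  assumes "us @ x # vs @ y # zs \<in> tuples M m"
  shows "gen (us @ x # vs @ y # zs) + gen (us @ y # vs @ x # zs) \<in> wker m"
proof -
  let ?g = "\<lambda>a b. gen (us @ a # vs @ b # zs) :: 'm list \<Rightarrow>\<^sub>0 'p"
  let ?s = "x \<oplus>\<^bsub>M\<^esub> y"
  have t: "us @ a # vs @ b # zs \<in> tuples M m" if "a \<in> carrier M" "b \<in> carrier M" for a b
    using assms that by (auto simp: tuples_def)
  have xy: "x \<in> carrier M" "y \<in> carrier M" "?s \<in> carrier M"
    using assms M_add by (auto simp: tuples_def)
  have r: "?g a ?s - (?g a x + ?g a y) \<in> wker m" if "a \<in> carrier M" for a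
    using wker_add[of "us @ a # vs" x zs m y] t[OF that] xy by simp
  have l: "?g ?s ?s - (?g x ?s + ?g y ?s) \<in> wker m"
    using wker_add[of us x "vs @ ?s # zs" m y] t xy by simp
  have d: "?g a a \<in> wker m" if "a \<in> carrier M" for a
    using wker_alt t that by blast
  have "?g x y + ?g y x = ?g ?s ?s - (?g ?s ?s - (?g x ?s + ?g y ?s)) - (?g x ?s - (?g x x + ?g x y))
     - (?g y ?s - (?g y x + ?g y y)) - ?g x x - ?g y y"
    by (simp add: algebra_simps)
  also have "\<dots> \<in> wker m"
    by (rule d[OF xy(1)] d[OF xy(2)] d[OF xy(3)] r[OF xy(1)] r[OF xy(2)] l ext.ker_closed)+
  finally show ?thesis .
qed

text \<open>One transposition for each entry of \<open>vs\<close>. The rule serves twice: to cancel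
  the two deletions at a repeated vector, and to put a factor dx_j back in its place in Cartan's
  formula.\<close>

lemma wker_move:
  assumes "us @ x # vs @ zs \<in> tuples M m"
  shows "gen (us @ vs @ x # zs) - scale ((-1) ^ length vs) (gen (us @ x # vs @ zs)) \<in> wker m"
  using assms
proof (induction vs arbitrary: us)
  case Nil
  then show ?case by (simp add: ext.ker_closed)
next
  case (Cons v vs)
  let ?s = "(-1) ^ length vs :: 'p"
  have 1: "gen ((us @ [v]) @ vs @ x # zs) - scale ?s (gen ((us @ [v]) @ x # vs @ zs)) \<in> wker m"
    by (rule Cons.IH) (use Cons.prems in \<open>auto simp: tuples_def\<close>)
  have 2: "gen (us @ x # [] @ v # (vs @ zs)) + gen (us @ v # [] @ x # (vs @ zs)) \<in> wker m"
    by (rule wker_swap) (use Cons.prems in auto)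
  have "gen (us @ (v # vs) @ x # zs) - scale (- ?s) (gen (us @ x # (v # vs) @ zs))
    = (gen ((us @ [v]) @ vs @ x # zs) - scale ?s (gen ((us @ [v]) @ x # vs @ zs)))
     + scale ?s (gen (us @ x # [] @ v # (vs @ zs)) + gen (us @ v # [] @ x # (vs @ zs)))"
    by (simp add: scale.scale_right_distrib del: scale_gen)
  also have "\<dots> \<in> wker m"
    by (rule 1 2 ext.ker_closed)+
  finally show ?case by simp
qed

end


section \<open>Contractions\<close>

text \<open>The recursion \<open>\<iota>(w \<and> v) = e(w) v - w \<and> \<iota>(v)\<close>, with an arbitrary \<open>\<phi>\<close> in place of
  the embedding of lists into forms so that the tail can be treated by induction.\<close>

primrec koszul :: "('m \<Rightarrow> 'p) \<Rightarrow> ('m list \<Rightarrow> ('c \<Rightarrow>\<^sub>0 'p)) \<Rightarrow> 'm list \<Rightarrow> ('c \<Rightarrow>\<^sub>0 'p::comm_ring_1)" where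
  "koszul e \<phi> [] = 0"
| "koszul e \<phi> (w # ws) = scale (e w) (\<phi> ws) - koszul e (\<lambda>l. \<phi> (w # l)) ws"

declare koszul.simps(2) [simp del]
lemmas koszul_Cons = koszul.simps(2)

lemma koszul_diff: "koszul e (\<lambda>l. \<phi> l - \<psi> l) ws = koszul e \<phi> ws - koszul e \<psi> ws"
  by (induction ws arbitrary: \<phi> \<psi>) (auto simp: koszul_Cons scale.scale_right_diff_distrib)

lemma koszul_scale: "koszul e (\<lambda>l. scale f (\<phi> l)) ws = scale f (koszul e \<phi> ws)"
  by (induction ws arbitrary: \<phi>) (auto simp: koszul_Cons scale.scale_right_diff_distrib mult.commute)

lemma koszul_add: "koszul e (\<lambda>l. \<phi> l + \<psi> l) ws = koszul e \<phi> ws + koszul e \<psi> ws"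
  by (induction ws arbitrary: \<phi> \<psi>) (auto simp: koszul_Cons scale.scale_right_distrib)

text \<open>Splitting off the first letter in both contractions produces \<open>e w\<close> times
  the contraction of the tail twice, with opposite signs. What remains is the double contraction of
  the tail for the shifted \<phi>, so the induction leaves \<phi> arbitrary.\<close>

lemma koszul_koszul: "koszul e (koszul e \<phi>) ws = 0"
proof (induction ws arbitrary: \<phi>)
  case (Cons w ws)
  have "koszul e (\<lambda>l. koszul e \<phi> (w # l)) ws = scale (e w) (koszul e \<phi> ws) - koszul e (koszul e (\<lambda>l. \<phi> (w # l))) ws"
    by (simp add: koszul_Cons koszul_diff koszul_scale)
  with Cons show ?case by (simp add: koszul_Cons)
qed simp

lemma koszul_append:
  "koszul e \<phi> (us @ vs) = koszul e (\<lambda>l. \<phi> (l @ vs)) us + scale ((-1) ^ length us) (koszul e (\<lambda>l. \<phi> (us @ l)) vs)"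
  by (induction us arbitrary: \<phi>) (auto simp: koszul_Cons)

lemma koszul_mem:
  assumes "scale.subspace W"
    and "\<And>l. set l \<subseteq> set ws \<Longrightarrow> Suc (length l) = length ws \<Longrightarrow> \<phi> l \<in> W"
  shows "koszul e \<phi> ws \<in> W"
  using assms(2)
proof (induction ws arbitrary: \<phi>)
  case Nil
  then show ?case by (simp add: scale.subspace_0[OF assms(1)])
next
  case (Cons w ws)
  have "\<phi> ws \<in> W" by (rule Cons.prems) auto
  moreover have "koszul e (\<lambda>l. \<phi> (w # l)) ws \<in> W"
    by (rule Cons.IH, rule Cons.prems) auto
  ultimately show ?case
    unfolding koszul_Cons by (intro scale.subspace_diff[OF assms(1)] scale.subspace_scale[OF assms(1)])
qed

lemma koszul_cong:
  assumes "\<And>l. set l \<subseteq> set ws \<Longrightarrow> Suc (length l) = length ws \<Longrightarrow> \<phi> l = \<psi> l"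
  shows "koszul e \<phi> ws = koszul e \<psi> ws"
proof -
  have "koszul e (\<lambda>l. \<phi> l - \<psi> l) ws \<in> {0}"
    by (rule koszul_mem) (use assms in auto)
  then show ?thesis by (simp add: koszul_diff)
qed

lemma lin_ext_koszul: "lin_ext \<phi> (koszul e \<psi> ws) = koszul e (\<lambda>l. lin_ext \<phi> (\<psi> l)) ws"
  by (induction ws arbitrary: \<psi>) (auto simp: koszul_Cons lin_ext_diff lin_ext_scale)

text \<open>A bridge between the recursion, which suits inductions, and the alternating sum of
  \<open>contract_wedge\<close>, in which Cartan's formula is computed as well.\<close>

lemma koszul_sum:
  "koszul e \<phi> ws = (\<Sum>j<length ws. scale ((-1) ^ j * e (ws ! j)) (\<phi> (take j ws @ drop (Suc j) ws)))"
proof (induction ws arbitrary: \<phi>)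
  case (Cons w ws)
  show ?case
    by (simp add: koszul_Cons Cons sum.lessThan_Suc_shift sum_negf del: sum.lessThan_Suc)
qed simp

text \<open>\<open>e\<close> is a lift to \<open>'p\<close> of a linear form on \<open>M\<close>.
  Such a lift is in general not linear, so linearity is demanded only after
  \<open>res\<close>.\<close>

locale contraction_data = exterior_powers R res M
  for R :: "('r, 'x) ring_scheme" and res :: "'p::comm_ring_1 \<Rightarrow> 'r" and M :: "('r, 'm, 'y) module_scheme" +
  fixes e :: "'m \<Rightarrow> 'p"
  assumes e_add: "\<lbrakk>x \<in> carrier M; y \<in> carrier M\<rbrakk> \<Longrightarrow> res (e (x \<oplus>\<^bsub>M\<^esub> y)) = res (e x + e y)"
    and e_smult: "x \<in> carrier M \<Longrightarrow> res (e (res f \<odot>\<^bsub>M\<^esub> x)) = res (f * e x)"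
begin

text \<open>Symbols that are not \<open>m\<close>-tuples of \<open>M\<close> lie in the kernel, so
  their images must lie in the kernel too; hence the default 0.\<close>

definition contr_rep :: "nat \<Rightarrow> ('m list \<Rightarrow>\<^sub>0 'p) \<Rightarrow> ('m list \<Rightarrow>\<^sub>0 'p)" where
  "contr_rep m = lin_ext (\<lambda>ws. if ws \<in> tuples M m then koszul e gen ws else 0)"

lemma contr_rep_gen: "ws \<in> tuples M m \<Longrightarrow> contr_rep m (gen ws) = koszul e gen ws"
  by (simp add: contr_rep_def)

lemma koszul_slot: "koszul e gen (us @ x # vs) = koszul e (\<lambda>l. gen (l @ x # vs)) us
    + scale ((-1) ^ length us) (scale (e x) (gen (us @ vs)) - koszul e (\<lambda>l. gen (us @ x # l)) vs)"
  by (subst koszul_append) (simp add: koszul_Cons)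

text \<open>Sorted by the deleted entry: before or after the slot, the sum relation survives in a
  shorter wedge; at the slot there remains the failure of \<open>e\<close> to be additive, which
  \<open>res\<close> kills.\<close>

lemma koszul_wker_add:
  assumes t: "us @ x # vs \<in> tuples M (Suc m)" and y: "y \<in> carrier M"
  shows "koszul e gen (us @ (x \<oplus>\<^bsub>M\<^esub> y) # vs) - (koszul e gen (us @ x # vs) + koszul e gen (us @ y # vs)) \<in> wker m"
proof -
  let ?s = "x \<oplus>\<^bsub>M\<^esub> y" and ?D = "\<lambda>a b. gen (a @ (x \<oplus>\<^bsub>M\<^esub> y) # b) - (gen (a @ x # b) + gen (a @ y # b)) :: 'm list \<Rightarrow>\<^sub>0 'p"
  have 1: "koszul e (\<lambda>l. ?D l vs) us \<in> wker m"
    by (rule koszul_mem[OF ext.ker_subspace], rule wker_add) (use t y in \<open>auto simp: tuples_def\<close>)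
  have 2: "koszul e (\<lambda>l. ?D us l) vs \<in> wker m"
    by (rule koszul_mem[OF ext.ker_subspace], rule wker_add) (use t y in \<open>auto simp: tuples_def\<close>)
  have 3: "scale (e ?s - (e x + e y)) (gen (us @ vs)) \<in> wker m"
    by (rule ext.ker_res) (use t y in \<open>auto simp: tuples_def e_add simp flip: res_eq_iff\<close>)
  have "koszul e gen (us @ ?s # vs) - (koszul e gen (us @ x # vs) + koszul e gen (us @ y # vs))
    = koszul e (\<lambda>l. ?D l vs) us + scale ((-1) ^ length us) (scale (e ?s - (e x + e y)) (gen (us @ vs)) - koszul e (\<lambda>l. ?D us l) vs)"
    unfolding koszul_slot koszul_diff koszul_add scale.scale_left_diff_distrib scale.scale_left_distrib
      scale.scale_right_diff_distrib scale.scale_right_distrib by (simp add: algebra_simps del: scale_gen)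
  also have "\<dots> \<in> wker m" by (rule 1 2 3 ext.ker_closed)+
  finally show ?thesis .
qed

lemma koszul_wker_smult:
  assumes t: "us @ x # vs \<in> tuples M (Suc m)"
  shows "koszul e gen (us @ (res f \<odot>\<^bsub>M\<^esub> x) # vs) - scale f (koszul e gen (us @ x # vs)) \<in> wker m"
proof -
  let ?s = "res f \<odot>\<^bsub>M\<^esub> x" and ?D = "\<lambda>a b. gen (a @ (res f \<odot>\<^bsub>M\<^esub> x) # b) - scale f (gen (a @ x # b)) :: 'm list \<Rightarrow>\<^sub>0 'p"
  have 1: "koszul e (\<lambda>l. ?D l vs) us \<in> wker m"
    by (rule koszul_mem[OF ext.ker_subspace], rule wker_smult) (use t in \<open>auto simp: tuples_def\<close>)
  have 2: "koszul e (\<lambda>l. ?D us l) vs \<in> wker m"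
    by (rule koszul_mem[OF ext.ker_subspace], rule wker_smult) (use t in \<open>auto simp: tuples_def\<close>)
  have 3: "scale (e ?s - f * e x) (gen (us @ vs)) \<in> wker m"
    by (rule ext.ker_res) (use t in \<open>auto simp: tuples_def e_smult simp flip: res_eq_iff\<close>)
  have "koszul e gen (us @ ?s # vs) - scale f (koszul e gen (us @ x # vs))
    = koszul e (\<lambda>l. ?D l vs) us + scale ((-1) ^ length us) (scale (e ?s - f * e x) (gen (us @ vs)) - koszul e (\<lambda>l. ?D us l) vs)"
    unfolding koszul_slot koszul_diff koszul_scale scale.scale_left_diff_distrib scale.scale_left_distrib
      scale.scale_right_diff_distrib scale.scale_right_distrib scale.scale_scale by (simp add: algebra_simps del: scale_gen)
  also have "\<dots> \<in> wker m" by (rule 1 2 3 ext.ker_closed)+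
  finally show ?thesis .
qed

text \<open>Deleting any other entry leaves a repeated vector. The two deletions of \<open>x\<close>
  itself differ by a move of \<open>x\<close> across \<open>vs\<close>, whose sign is opposite to
  their relative sign in the alternating sum.\<close>

lemma koszul_wker_alt:
  assumes t: "us @ x # vs @ x # zs \<in> tuples M (Suc m)"
  shows "koszul e gen (us @ x # vs @ x # zs) \<in> wker m"
proof -
  let ?a = "(-1) ^ length us :: 'p" and ?b = "(-1) ^ length vs :: 'p"
  have 1: "koszul e (\<lambda>l. gen (l @ x # vs @ x # zs)) us \<in> wker m"
    by (rule koszul_mem[OF ext.ker_subspace], rule wker_alt) (use t in \<open>auto simp: tuples_def\<close>)
  have 2: "koszul e (\<lambda>l. gen (us @ x # l @ x # zs)) vs \<in> wker m"
    by (rule koszul_mem[OF ext.ker_subspace], rule wker_alt) (use t in \<open>auto simp: tuples_def\<close>)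
  have 3: "koszul e (\<lambda>l. gen (us @ x # vs @ x # l)) zs \<in> wker m"
    by (rule koszul_mem[OF ext.ker_subspace], rule wker_alt) (use t in \<open>auto simp: tuples_def\<close>)
  have 4: "gen (us @ vs @ x # zs) - scale ?b (gen (us @ x # vs @ zs)) \<in> wker m"
    by (rule wker_move) (use t in \<open>auto simp: tuples_def\<close>)
  have "koszul e gen (us @ x # vs @ x # zs) = koszul e (\<lambda>l. gen (l @ x # vs @ x # zs)) us
    + scale ?a (scale (e x) (gen (us @ vs @ x # zs) - scale ?b (gen (us @ x # vs @ zs)))
        - (koszul e (\<lambda>l. gen (us @ x # l @ x # zs)) vs - scale ?b (koszul e (\<lambda>l. gen (us @ x # vs @ x # l)) zs)))"
    unfolding koszul_slot koszul_append[of e _ vs] koszul_Cons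
    by (simp add: scale.scale_right_diff_distrib scale.scale_right_distrib algebra_simps del: scale_gen)
  also have "\<dots> \<in> wker m" by (rule 1 2 3 4 ext.ker_closed)+
  finally show ?thesis .
qed

lemma contr_rep_wker:
  assumes "c \<in> wker (Suc m)"
  shows "contr_rep (Suc m) c \<in> wker m"
proof -
  have "wker (Suc m) \<subseteq> {c. contr_rep (Suc m) c \<in> wker m}"
  proof (rule ext.ker_min)
    show "scale.subspace {c. contr_rep (Suc m) c \<in> wker m}"
      unfolding contr_rep_def by (rule subspace_vimage_lin_ext[OF ext.ker_subspace])
  next
    fix f b assume "res f = \<zero>\<^bsub>R\<^esub>"
    then show "scale f (gen b) \<in> {c. contr_rep (Suc m) c \<in> wker m}"
      by (simp add: contr_rep_def lin_ext_scale ext.ker_res ext.ker_closed del: scale_gen)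
  next
    fix b :: "'m list" assume "b \<notin> tuples M (Suc m)"
    then show "gen b \<in> {c. contr_rep (Suc m) c \<in> wker m}"
      by (simp add: contr_rep_def ext.ker_closed)
  next
    fix c assume "c \<in> ext_relators (Suc m)"
    then consider us x y vs where "us @ x # vs \<in> tuples M (Suc m)" "y \<in> carrier M"
        "c = gen (us @ (x \<oplus>\<^bsub>M\<^esub> y) # vs) - (gen (us @ x # vs) + gen (us @ y # vs))"
      | us x f vs where "us @ x # vs \<in> tuples M (Suc m)"
        "c = gen (us @ (res f \<odot>\<^bsub>M\<^esub> x) # vs) - scale f (gen (us @ x # vs))"
      | us x vs zs where "us @ x # vs @ x # zs \<in> tuples M (Suc m)" "c = gen (us @ x # vs @ x # zs)"
      unfolding ext_relators_def by (auto simp del: scale_gen)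
    then show "c \<in> {c. contr_rep (Suc m) c \<in> wker m}"
    proof cases
      case 1
      moreover have "us @ (x \<oplus>\<^bsub>M\<^esub> y) # vs \<in> tuples M (Suc m)" "us @ y # vs \<in> tuples M (Suc m)"
        using 1(1,2) M_add by (auto simp: tuples_def)
      ultimately show ?thesis using koszul_wker_add[of us x vs m y]
        by (simp add: contr_rep_def lin_ext_diff lin_ext_add del: scale_gen)
    next
      case 2
      moreover have "us @ (res f \<odot>\<^bsub>M\<^esub> x) # vs \<in> tuples M (Suc m)"
        using 2(1) M_smult by (auto simp: tuples_def)
      ultimately show ?thesis using koszul_wker_smult[of us x vs m f]
        by (simp add: contr_rep_def lin_ext_diff lin_ext_scale del: scale_gen)
    next
      case 3
      then show ?thesis using koszul_wker_alt by (simp add: contr_rep_def)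
    qed
  qed
  with assms show ?thesis by blast
qed

text \<open>This holds for representatives, before any relation is imposed, because
  \<open>koszul_koszul\<close> is an identity of families for every coefficient function.\<close>

lemma contr_rep_contr_rep: "contr_rep m (contr_rep (Suc m) c) = 0"
proof -
  have "c \<in> {c. contr_rep m (contr_rep (Suc m) c) = 0}"
  proof (rule subspace_sum_gen)
    show "scale.subspace {c. contr_rep m (contr_rep (Suc m) c) = 0}"
      by (auto simp: scale.subspace_def contr_rep_def lin_ext_add lin_ext_scale)
    fix b :: "'m list"
    have "contr_rep m (contr_rep (Suc m) (gen b)) = 0"
    proof (cases "b \<in> tuples M (Suc m)")
      case True
      then have "contr_rep m (contr_rep (Suc m) (gen b)) = koszul e (\<lambda>l. contr_rep m (gen l)) b"
        by (simp add: contr_rep_def lin_ext_koszul)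
      also have "\<dots> = koszul e (koszul e gen) b"
        by (rule koszul_cong, rule contr_rep_gen) (use True in \<open>auto simp: tuples_def\<close>)
      finally show ?thesis by (simp add: koszul_koszul)
    qed (simp add: contr_rep_def)
    then show "scale (lookup c b) (gen b) \<in> {c. contr_rep m (contr_rep (Suc m) c) = 0}"
      by (simp add: contr_rep_def lin_ext_scale del: scale_gen)
  qed
  then show ?thesis by simp
qed

lemma res_sign: "res ((-1) ^ j) = (\<ominus>\<^bsub>R\<^esub> \<one>\<^bsub>R\<^esub>) [^]\<^bsub>R\<^esub> j"
  by (induction j) (auto simp: res_one res_mult res_uminus R.m_comm R.l_minus R.r_minus)

lemma contract_wedge_eq:
  assumes ws: "ws \<in> tuples M (Suc m)" and \<epsilon>: "\<And>w. w \<in> carrier M \<Longrightarrow> \<epsilon> w = res (e w)"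
  shows "contract_wedge R M \<epsilon> ws = ext_cl m (koszul e gen ws)"
proof -
  have l: "length ws = Suc m" using ws by (simp add: tuples_def)
  have "contract_wedge R M \<epsilon> ws = (\<Oplus>\<^bsub>ext_power R M m\<^esub> j\<in>{..<length ws}.
      ext_cl m (scale ((-1) ^ j * e (ws ! j)) (gen (take j ws @ drop (Suc j) ws))))"
    unfolding contract_wedge_def l diff_Suc_1
  proof (rule ext.M.finsum_cong')
    fix j assume j: "j \<in> {..<Suc m}"
    have w: "ws ! j \<in> carrier M" using ws j by (auto simp: tuples_def)
    have t: "take j ws @ drop (Suc j) ws \<in> tuples M m"
      using ws j by (auto simp: tuples_def dest: in_set_takeD in_set_dropD)
    show "(\<ominus>\<^bsub>R\<^esub> \<one>\<^bsub>R\<^esub>) [^]\<^bsub>R\<^esub> j \<otimes>\<^bsub>R\<^esub> \<epsilon> (ws ! j) \<odot>\<^bsub>ext_power R M m\<^esub> wedge R M (take j ws @ drop (Suc j) ws)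
      = ext_cl m (scale ((-1) ^ j * e (ws ! j)) (gen (take j ws @ drop (Suc j) ws)))"
      using w t by (simp add: wedge_eq ext.cl_scale res_mult res_sign \<epsilon> del: scale_gen)
  qed auto
  also have "\<dots> = ext_cl m (koszul e gen ws)"
    by (simp add: koszul_sum ext.cl_sum del: scale_gen)
  finally show ?thesis .
qed

text \<open>\<open>ext.lift\<close> provides a map with these values, and agreement on wedges, which
  generate, identifies it with the one chosen by \<open>THE\<close>. The third claim moves all later
  calculations to representatives.\<close>

lemma contraction_props:
  assumes \<epsilon>: "\<And>w. w \<in> carrier M \<Longrightarrow> \<epsilon> w = res (e w)"
  shows "contraction R M \<epsilon> (Suc m) \<in> mod_hom R (ext_power R M (Suc m)) (ext_power R M m)"
    and "ws \<in> tuples M (Suc m) \<Longrightarrow> contraction R M \<epsilon> (Suc m) (wedge R M ws) = contract_wedge R M \<epsilon> ws"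
    and "contraction R M \<epsilon> (Suc m) (ext_cl (Suc m) c) = ext_cl m (contr_rep (Suc m) c)"
proof -
  have "\<exists>h. h \<in> extensional (carrier (ext_power R M (Suc m))) \<and>
      h \<in> mod_hom R (ext_power R M (Suc m)) (ext_power R M m) \<and> (\<forall>c. h (ext_cl (Suc m) c) = ext_cl m (contr_rep (Suc m) c))"
  proof (rule ext.lift)
    fix c assume "c \<in> wker (Suc m)"
    then show "ext_cl m (contr_rep (Suc m) c) = \<zero>\<^bsub>ext_power R M m\<^esub>" using contr_rep_wker by (auto simp: ext.ker_def)
  qed (auto simp: contr_rep_def lin_ext_add lin_ext_scale ext.cl_add ext.cl_scale)
  then obtain h where h: "h \<in> extensional (carrier (ext_power R M (Suc m)))"
    "h \<in> mod_hom R (ext_power R M (Suc m)) (ext_power R M m)" "\<And>c. h (ext_cl (Suc m) c) = ext_cl m (contr_rep (Suc m) c)"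
    by blast
  have hw: "h (wedge R M ws) = contract_wedge R M \<epsilon> ws" if "ws \<in> tuples M (Suc m)" for ws
    using that by (simp add: wedge_eq h(3) contr_rep_gen contract_wedge_eq[OF that \<epsilon>])
  have "contraction R M \<epsilon> (Suc m) = h"
    unfolding contraction_def diff_Suc_1
  proof (rule the_equality, safe)
    fix h' assume h': "h' \<in> extensional (carrier (ext_power R M (Suc m)))"
      "h' \<in> mod_hom R (ext_power R M (Suc m)) (ext_power R M m)"
      "\<forall>ws\<in>tuples M (Suc m). h' (wedge R M ws) = contract_wedge R M \<epsilon> ws"
    show "h' = h"
    proof (rule extensionalityI[OF h'(1) h(1)], rule ext.hom_ext_gen[OF h'(2) h(2)])
      fix ws assume "ws \<in> tuples M (Suc m)"
      then show "h' (ext_cl (Suc m) (gen ws)) = h (ext_cl (Suc m) (gen ws))"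
        using h'(3) hw by (metis wedge_eq)
    qed (simp_all add: ext.smult_zero)
  qed (use h hw in auto)
  then show "contraction R M \<epsilon> (Suc m) \<in> mod_hom R (ext_power R M (Suc m)) (ext_power R M m)"
    "ws \<in> tuples M (Suc m) \<Longrightarrow> contraction R M \<epsilon> (Suc m) (wedge R M ws) = contract_wedge R M \<epsilon> ws"
    "contraction R M \<epsilon> (Suc m) (ext_cl (Suc m) c) = ext_cl m (contr_rep (Suc m) c)"
    using h hw by auto
qed

text \<open>The zeroth exterior power is \<open>R\<close> itself: the empty tuple is the only
  generator, and every relator has at least one entry. So the coefficient at \<open>[]\<close> is a
  complete invariant.\<close>

lemma wker_0_iff: "c \<in> wker 0 \<longleftrightarrow> res (lookup c []) = \<zero>\<^bsub>R\<^esub>"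
proof
  have "wker 0 \<subseteq> {c. res (lookup c []) = \<zero>\<^bsub>R\<^esub>}"
  proof (rule ext.ker_min)
    show "scale.subspace {c. res (lookup c []) = \<zero>\<^bsub>R\<^esub>}"
      by (auto simp: scale.subspace_def res_zero lookup_add res_add res_mult)
  qed (auto simp: lookup_single when_def res_zero res_one tuples_def ext_relators_def)
  then show "c \<in> wker 0 \<Longrightarrow> res (lookup c []) = \<zero>\<^bsub>R\<^esub>" by blast
next
  assume c: "res (lookup c []) = \<zero>\<^bsub>R\<^esub>"
  show "c \<in> wker 0"
  proof (rule subspace_sum_gen[OF ext.ker_subspace])
    fix b :: "'m list"
    show "scale (lookup c b) (gen b) \<in> wker 0"
    proof (cases "b = []")
      case True
      then show ?thesis using c by (simp add: ext.ker_res del: scale_gen)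
    next
      case False
      then have "ext_cl 0 (gen b) = \<zero>\<^bsub>ext_power R M 0\<^esub>"
        by (intro ext.cl_outside) (auto simp: tuples_def)
      then have "gen b \<in> wker 0" by (simp add: ext.ker_def)
      then show ?thesis by (rule ext.ker_closed)
    qed
  qed
qed

text \<open>\<open>on_ext1\<close> is the contraction from the first to the zeroth exterior power,
  read through the identification of the latter with \<open>R\<close>. This makes \<epsilon> one
  more map of the same family, with values in an ideal \<open>N\<close> of \<open>R\<close>.\<close>

lemma on_ext1_props:
  fixes N :: "('r, 'r, 'z) module_scheme"
  assumes N: "carrier N \<subseteq> carrier R" "ring.add N = ring.add R" "module.smult N = monoid.mult R" "ring.zero N = ring.zero R"
      "\<zero>\<^bsub>R\<^esub> \<in> carrier N"
      "\<And>x y. x \<in> carrier N \<Longrightarrow> y \<in> carrier N \<Longrightarrow> x \<oplus>\<^bsub>R\<^esub> y \<in> carrier N"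
      "\<And>a x. a \<in> carrier R \<Longrightarrow> x \<in> carrier N \<Longrightarrow> a \<otimes>\<^bsub>R\<^esub> x \<in> carrier N"
    and \<epsilon>: "\<And>w. w \<in> carrier M \<Longrightarrow> \<epsilon> w = res (e w)" "\<And>w. w \<in> carrier M \<Longrightarrow> \<epsilon> w \<in> carrier N"
  shows "on_ext1 R M N \<epsilon> \<in> mod_hom R (ext_power R M 1) N"
    and "w \<in> carrier M \<Longrightarrow> on_ext1 R M N \<epsilon> (wedge R M [w]) = \<epsilon> w"
    and "on_ext1 R M N \<epsilon> (ext_cl 1 c) = res (lookup (contr_rep 1 c) [])"
proof -
  have Nz: "\<zero>\<^bsub>R\<^esub> \<odot>\<^bsub>N\<^esub> x = \<zero>\<^bsub>N\<^esub>" if "x \<in> carrier N" for x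
    using N that by auto
  have t1: "b \<in> tuples M 1 \<longleftrightarrow> (\<exists>w\<in>carrier M. b = [w])" for b
    by (auto simp: tuples_def length_Suc_conv)
  have closed: "res (lookup (contr_rep 1 c) []) \<in> carrier N" for c
  proof -
    let ?W = "{c. res (lookup (contr_rep 1 c) []) \<in> carrier N}"
    have W: "scale.subspace ?W"
      using N by (auto simp: scale.subspace_def contr_rep_def res_zero lin_ext_add lin_ext_scale lookup_add res_add res_mult)
    have "c \<in> ?W"
    proof (rule subspace_sum_gen[OF W], rule scale.subspace_scale[OF W])
      fix b
      have "res (lookup (contr_rep 1 (gen b)) []) = (case b of [w] \<Rightarrow> if w \<in> carrier M then \<epsilon> w else \<zero>\<^bsub>R\<^esub> | _ \<Rightarrow> \<zero>\<^bsub>R\<^esub>)"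
        by (auto simp: contr_rep_def t1[simplified] koszul_Cons \<epsilon> res_zero split: list.split)
      then show "gen b \<in> ?W" using N(5) \<epsilon>(2) by (auto split: list.split)
    qed
    then show ?thesis by simp
  qed
  have "\<exists>h. h \<in> extensional (carrier (ext_power R M 1)) \<and>
      h \<in> mod_hom R (ext_power R M 1) N \<and> (\<forall>c. h (ext_cl 1 c) = res (lookup (contr_rep 1 c) []))"
  proof (rule ext.lift)
    fix c assume "c \<in> wker 1"
    then show "res (lookup (contr_rep 1 c) []) = \<zero>\<^bsub>N\<^esub>"
      using contr_rep_wker[of c 0] N by (auto simp: wker_0_iff)
  qed (use N closed in \<open>auto simp: contr_rep_def lin_ext_add lin_ext_scale lookup_add res_add res_mult\<close>)
  then obtain h where h: "h \<in> extensional (carrier (ext_power R M 1))"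
    "h \<in> mod_hom R (ext_power R M 1) N" "\<And>c. h (ext_cl 1 c) = res (lookup (contr_rep 1 c) [])"
    by blast
  have hw: "h (wedge R M [w]) = \<epsilon> w" if "w \<in> carrier M" for w
  proof -
    have w: "[w] \<in> tuples M 1" using that t1 by blast
    show ?thesis
      unfolding wedge_eq[OF w] h(3) contr_rep_gen[OF w] \<epsilon>(1)[OF that] by (simp add: koszul_Cons)
  qed
  have "on_ext1 R M N \<epsilon> = h"
    unfolding on_ext1_def
  proof (rule the_equality, safe)
    fix h' assume h': "h' \<in> extensional (carrier (ext_power R M 1))"
      "h' \<in> mod_hom R (ext_power R M 1) N" "\<forall>w\<in>carrier M. h' (wedge R M [w]) = \<epsilon> w"
    show "h' = h"
    proof (rule extensionalityI[OF h'(1) h(1)], rule ext.hom_ext_gen[OF h'(2) h(2)])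
      fix ws assume "ws \<in> tuples M 1"
      then show "h' (ext_cl 1 (gen ws)) = h (ext_cl 1 (gen ws))"
        using h'(3) hw by (metis wedge_eq t1)
    qed (simp_all add: Nz)
  qed (use h hw in auto)
  then show "on_ext1 R M N \<epsilon> \<in> mod_hom R (ext_power R M 1) N"
    "w \<in> carrier M \<Longrightarrow> on_ext1 R M N \<epsilon> (wedge R M [w]) = \<epsilon> w"
    "on_ext1 R M N \<epsilon> (ext_cl 1 c) = res (lookup (contr_rep 1 c) [])"
    using h hw by auto
qed

end


section \<open>Partial derivatives\<close>

lemma poly_mapping_add_induct [case_names zero single add]:
  fixes f :: "'b \<Rightarrow>\<^sub>0 'c::comm_monoid_add"
  assumes "P 0" "\<And>k v. P (Poly_Mapping.single k v)" "\<And>f g. P f \<Longrightarrow> P g \<Longrightarrow> P (f + g)"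
  shows "P f"
proof -
  have "f = (\<Sum>b\<in>keys f. Poly_Mapping.single b (lookup f b))"
    by (rule poly_mapping_eqI) (simp add: lookup_sum lookup_single when_def in_keys_iff)
  moreover have "P (\<Sum>b\<in>A. Poly_Mapping.single b (lookup f b))" for A
    by (induction A rule: infinite_finite_induct) (auto intro: assms)
  ultimately show ?thesis by metis
qed

definition partial :: "'n \<Rightarrow> ('a::field, 'n::finite) mpoly \<Rightarrow> ('a, 'n) mpoly" where
  "partial j f = Abs_poly_mapping (\<lambda>\<alpha>. of_nat (Suc (lookup \<alpha> j)) * lookup f (\<alpha> + Poly_Mapping.single j 1))"

lemma lookup_partial: "lookup (partial j f) \<alpha> = of_nat (Suc (lookup \<alpha> j)) * lookup f (\<alpha> + Poly_Mapping.single j 1)"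
proof -
  have "finite ((\<lambda>\<alpha>. \<alpha> + Poly_Mapping.single j 1) -` keys f)"
    by (rule finite_vimageI) (auto simp: inj_def)
  then have "finite {\<alpha>. of_nat (Suc (lookup \<alpha> j)) * lookup f (\<alpha> + Poly_Mapping.single j 1) \<noteq> 0}"
    by (rule rev_finite_subset) (auto simp: in_keys_iff)
  then show ?thesis by (simp add: partial_def lookup_Abs_poly_mapping)
qed

lemma partial_zero [simp]: "partial j 0 = 0"
  by (rule poly_mapping_eqI) (simp add: lookup_partial)

lemma partial_add: "partial j (f + g) = partial j f + partial j g"
  by (rule poly_mapping_eqI) (simp add: lookup_partial lookup_add algebra_simps)

lemma partial_uminus: "partial j (- f) = - partial j f"
  by (rule poly_mapping_eqI) (simp add: lookup_partial)

lemma partial_diff: "partial j (f - g) = partial j f - partial j g"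
  by (rule poly_mapping_eqI) (simp add: lookup_partial lookup_minus algebra_simps)

lemma partial_comm: "partial i (partial j f) = partial j (partial i f)"
  by (rule poly_mapping_eqI) (auto simp: lookup_partial lookup_add lookup_single when_def add_ac mult_ac)

text \<open>Subtraction of exponents is truncated, hence the positivity condition. Where it fails in
  the applications, the coefficient is 0 and the exponent does no harm.\<close>

lemma single_minus_add:
  fixes \<alpha> \<beta> :: "'n \<Rightarrow>\<^sub>0 nat"
  assumes "0 < lookup \<alpha> j"
  shows "\<alpha> - Poly_Mapping.single j 1 + \<beta> = \<alpha> + \<beta> - Poly_Mapping.single j 1"
  using assms by (intro poly_mapping_eqI) (auto simp: lookup_add lookup_minus lookup_single when_def)

lemma partial_single:
  fixes c :: "'a::field" and \<beta> :: "'n::finite \<Rightarrow>\<^sub>0 nat"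
  shows "partial j (Poly_Mapping.single \<beta> c) = Poly_Mapping.single (\<beta> - Poly_Mapping.single j 1) (of_nat (lookup \<beta> j) * c)"
proof (cases "lookup \<beta> j = 0")
  case True
  then have "\<beta> \<noteq> \<alpha> + Poly_Mapping.single j 1" for \<alpha>
    by (auto simp: lookup_add)
  with True show ?thesis
    by (intro poly_mapping_eqI) (auto simp: lookup_partial lookup_single when_def)
next
  case False
  have "\<beta> = \<alpha> + Poly_Mapping.single j 1 \<longleftrightarrow> \<beta> - Poly_Mapping.single j 1 = \<alpha>" for \<alpha>
    using single_minus_add[of \<beta> j "Poly_Mapping.single j 1"] False by auto
  moreover have "of_nat (Suc (lookup \<beta> j - 1)) = (of_nat (lookup \<beta> j) :: 'a)"
    using False by simp
  ultimately show ?thesis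
    by (intro poly_mapping_eqI) (auto simp: lookup_partial lookup_single lookup_minus when_def simp del: of_nat_Suc)
qed

lemma partial_mult_single:
  fixes \<alpha> \<beta> :: "'n::finite \<Rightarrow>\<^sub>0 nat" and a b :: "'a::field"
  defines "f \<equiv> Poly_Mapping.single \<alpha> a" and "g \<equiv> Poly_Mapping.single \<beta> b"
  shows "partial j (f * g) = partial j f * g + f * partial j g"
proof -
  let ?e = "Poly_Mapping.single j 1 :: 'n \<Rightarrow>\<^sub>0 nat"
  have "partial j f * g = Poly_Mapping.single (\<alpha> + \<beta> - ?e) (of_nat (lookup \<alpha> j) * (a * b))"
    using single_minus_add[of \<alpha> j \<beta>]
    by (cases "lookup \<alpha> j = 0") (simp_all add: f_def g_def partial_single mult_single mult.assoc)
  moreover have "f * partial j g = Poly_Mapping.single (\<alpha> + \<beta> - ?e) (of_nat (lookup \<beta> j) * (a * b))"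
    using single_minus_add[of \<beta> j \<alpha>]
    by (cases "lookup \<beta> j = 0") (simp_all add: f_def g_def partial_single mult_single add_ac mult_ac)
  moreover have "partial j (f * g) = Poly_Mapping.single (\<alpha> + \<beta> - ?e) (of_nat (lookup \<alpha> j + lookup \<beta> j) * (a * b))"
    by (simp add: f_def g_def partial_single mult_single lookup_add)
  ultimately show ?thesis
    by (simp add: distrib_right flip: single_add)
qed

lemma partial_mult: "partial j (f * g) = partial j f * g + f * partial j g"
proof (induction f rule: poly_mapping_add_induct)
  case (single \<alpha> a)
  show ?case
    by (induction g rule: poly_mapping_add_induct)
      (simp_all add: partial_add partial_mult_single algebra_simps)
qed (simp_all add: partial_add algebra_simps)

lemma partial_const [simp]: "partial j (mpoly_const c) = 0"
  by (simp add: mpoly_const_def partial_single)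

lemma partial_var: "partial i (mpoly_var j) = (if i = j then 1 else 0)"
  by (simp add: mpoly_var_def partial_single lookup_single when_def)

lemma partial_one [simp]: "partial j 1 = 0"
  using partial_const[of j 1] by (simp add: mpoly_const_def)

lemma partial_minus_one_power [simp]: "partial j ((- 1) ^ r) = 0"
  by (induction r) (simp_all add: partial_mult partial_uminus)

lemma const_mult_single: "mpoly_const c * Poly_Mapping.single \<alpha> a = Poly_Mapping.single \<alpha> (c * a)"
  by (simp add: mpoly_const_def mult_single)

lemma mpoly_alg_induct [case_names const var add mult]:
  fixes f :: "('a::field, 'n::finite) mpoly"
  assumes const: "\<And>c. P (mpoly_const c)" and var: "\<And>j. P (mpoly_var j)"
    and add: "\<And>f g. P f \<Longrightarrow> P g \<Longrightarrow> P (f + g)" and mult: "\<And>f g. P f \<Longrightarrow> P g \<Longrightarrow> P (f * g)"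
  shows "P f"
proof -
  have "P (Poly_Mapping.single \<alpha> 1)" for \<alpha>
  proof (induction \<alpha> rule: poly_mapping_add_induct)
    case zero
    then show ?case using const[of 1] by (simp add: mpoly_const_def)
  next
    case (single j n)
    show ?case
    proof (induction n)
      case 0
      then show ?case using const[of 1] by (simp add: mpoly_const_def)
    next
      case (Suc n)
      have "Poly_Mapping.single (Poly_Mapping.single j (Suc n)) 1
          = mpoly_var j * Poly_Mapping.single (Poly_Mapping.single j n) (1 :: 'a)"
        by (simp add: mpoly_var_def mult_single flip: single_add)
      then show ?case using mult[OF var Suc] by simp
    qed
  next
    case (add \<alpha> \<beta>)
    then show ?case using mult[OF add] by (simp add: mult_single)
  qed
  then have "P (Poly_Mapping.single \<alpha> c)" for \<alpha> c
    using mult[OF const[of c]] const_mult_single[of c \<alpha> 1] by (metis mult.right_neutral)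
  then show ?thesis
    using const[of 0] by (induction f rule: poly_mapping_add_induct) (auto simp: mpoly_const_def intro: add)
qed

section \<open>The Euler operator and homogeneous coefficients\<close>

definition euler_op :: "('a::field, 'n::finite) mpoly \<Rightarrow> ('a, 'n) mpoly" where
  "euler_op f = (\<Sum>j\<in>UNIV. mpoly_var j * partial j f)"

lemma euler_op_zero [simp]: "euler_op 0 = 0"
  by (simp add: euler_op_def)

lemma euler_op_add: "euler_op (f + g) = euler_op f + euler_op g"
  by (simp add: euler_op_def partial_add algebra_simps sum.distrib)

lemma euler_op_diff: "euler_op (f - g) = euler_op f - euler_op g"
  by (simp add: euler_op_def partial_diff algebra_simps sum_subtractf)

lemma euler_op_mult: "euler_op (f * g) = euler_op f * g + f * euler_op g"
  by (simp add: euler_op_def partial_mult algebra_simps sum.distrib sum_distrib_left)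

lemma euler_op_const [simp]: "euler_op (mpoly_const c) = 0"
  by (simp add: euler_op_def)

lemma euler_op_var: "euler_op (mpoly_var j) = mpoly_var j"
  by (simp add: euler_op_def partial_var if_distrib cong: if_cong)

definition total_deg :: "('n::finite \<Rightarrow>\<^sub>0 nat) \<Rightarrow> nat" where
  "total_deg \<alpha> = (\<Sum>j\<in>UNIV. lookup \<alpha> j)"

lemma total_deg_add: "total_deg (\<alpha> + \<beta>) = total_deg \<alpha> + total_deg \<beta>"
  by (simp add: total_deg_def lookup_add sum.distrib)

lemma total_deg_single [simp]: "total_deg (Poly_Mapping.single j n) = n"
  by (simp add: total_deg_def lookup_single when_def)

lemma euler_op_single: "euler_op (Poly_Mapping.single \<alpha> c) = Poly_Mapping.single \<alpha> (of_nat (total_deg \<alpha>) * c)"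
proof -
  have "mpoly_var j * partial j (Poly_Mapping.single \<alpha> c) = Poly_Mapping.single \<alpha> (of_nat (lookup \<alpha> j) * c)" for j
    using single_minus_add[of \<alpha> j "Poly_Mapping.single j 1"]
    by (cases "lookup \<alpha> j = 0") (simp_all add: mpoly_var_def partial_single mult_single add_ac)
  then have "euler_op (Poly_Mapping.single \<alpha> c) = (\<Sum>j\<in>UNIV. Poly_Mapping.single \<alpha> (of_nat (lookup \<alpha> j) * c))"
    by (simp add: euler_op_def)
  also have "\<dots> = Poly_Mapping.single \<alpha> (of_nat (total_deg \<alpha>) * c)"
    by (rule poly_mapping_eqI)
      (simp add: lookup_sum lookup_single when_def total_deg_def sum_distrib_right)
  finally show ?thesis .
qed

text \<open>The polynomials that occur as coefficients of \<open>m\<close>-forms of degree \<open>i\<close>. The condition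
  is stated without subtraction, so that only \<open>0\<close> remains if \<open>i < m\<close>.\<close>

definition hcoef :: "nat \<Rightarrow> nat \<Rightarrow> ('a::field, 'n::finite) mpoly set" where
  "hcoef m i = {f. \<forall>\<alpha>\<in>keys f. total_deg \<alpha> + m = i}"

lemma hcoef_zero [simp]: "0 \<in> hcoef m i"
  by (simp add: hcoef_def)

lemma hcoef_add: "f \<in> hcoef m i \<Longrightarrow> g \<in> hcoef m i \<Longrightarrow> f + g \<in> hcoef m i"
  using keys_add[of f g] by (auto simp: hcoef_def)

lemma hcoef_const: "f \<in> hcoef m i \<Longrightarrow> mpoly_const c * f \<in> hcoef m i"
  using keys_mult[of "mpoly_const c" f]
  by (fastforce simp: hcoef_def mpoly_const_def split: if_splits)

lemma hcoef_uminus: "f \<in> hcoef m i \<Longrightarrow> - f \<in> hcoef m i"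
  by (auto simp: hcoef_def in_keys_iff)

lemma hcoef_partial: "f \<in> hcoef m i \<Longrightarrow> partial j f \<in> hcoef (Suc m) i"
  by (force simp: hcoef_def in_keys_iff lookup_partial total_deg_add)

lemma hcoef_var: "f \<in> hcoef (Suc m) i \<Longrightarrow> mpoly_var j * f \<in> hcoef m i"
  using keys_mult[of "mpoly_var j" f] by (fastforce simp: hcoef_def mpoly_var_def total_deg_add)

lemma mpoly_homog_eq: "mpoly_homog d = hcoef 0 d"
  by (simp add: mpoly_homog_def hcoef_def total_deg_def)

lemma hcoef_shift: "d + m = i \<Longrightarrow> hcoef 0 d = hcoef m i"
  by (auto simp: hcoef_def)

text \<open>Euler's identity, checked on monomials. The summand \<open>of_nat m * f\<close> is the
  weight of the \<open>m\<close> factors dx_j, so that the eigenvalue is \<open>i\<close> for forms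
  of every order.\<close>

lemma euler_op_hcoef:
  fixes f :: "('a::field, 'n::finite) mpoly"
  assumes "f \<in> hcoef m i"
  shows "euler_op f + of_nat m * f = of_nat i * f"
proof -
  have sum: "f = (\<Sum>b\<in>keys f. Poly_Mapping.single b (lookup f b))"
    by (rule poly_mapping_eqI) (simp add: lookup_sum lookup_single when_def in_keys_iff)
  have th: "euler_op (sum g A) = (\<Sum>b\<in>A. euler_op (g b))" for g :: "'c \<Rightarrow> ('a, 'n) mpoly" and A
    by (induction A rule: infinite_finite_induct) (auto simp: euler_op_add)
  have n: "of_nat n * g = Poly_Mapping.single 0 (of_nat n) * g" for n and g :: "('a, 'n) mpoly"
    by (simp add: single_of_nat)
  have "euler_op f + of_nat m * f
      = (\<Sum>b\<in>keys f. euler_op (Poly_Mapping.single b (lookup f b)) + of_nat m * Poly_Mapping.single b (lookup f b))"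
    by (subst (1 2) sum) (simp add: th sum_distrib_left sum.distrib)
  also have "\<dots> = (\<Sum>b\<in>keys f. of_nat i * Poly_Mapping.single b (lookup f b))"
  proof (rule sum.cong[OF refl])
    fix b assume "b \<in> keys f"
    then have "total_deg b + m = i" using assms by (auto simp: hcoef_def)
    then show "euler_op (Poly_Mapping.single b (lookup f b)) + of_nat m * Poly_Mapping.single b (lookup f b)
        = of_nat i * Poly_Mapping.single b (lookup f b)"
      unfolding n euler_op_single mult_single by (auto simp: algebra_simps simp flip: single_add)
  qed
  also have "\<dots> = of_nat i * f"
    by (subst (3) sum) (simp add: sum_distrib_left)
  finally show ?thesis .
qed


section \<open>The truncated polynomial ring\<close>

lemma mpoly_ring_simps [simp]:
  "carrier mpoly_ring = UNIV" "x \<oplus>\<^bsub>mpoly_ring\<^esub> y = x + y" "x \<otimes>\<^bsub>mpoly_ring\<^esub> y = x * y"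
  "\<one>\<^bsub>mpoly_ring\<^esub> = 1" "\<zero>\<^bsub>mpoly_ring\<^esub> = 0"
  by (simp_all add: mpoly_ring_def ring_of_type_algebra_def)

lemma mpoly_ring_cring: "cring mpoly_ring"
  unfolding mpoly_ring_def by (rule cring_from_type_algebra)

lemma var_ideal_ideal: "ideal var_ideal mpoly_ring"
  unfolding var_ideal_def
  by (rule ring.genideal_ideal) (auto intro: cring.axioms mpoly_ring_cring)

lemma var_ideal_pow_0: "var_ideal_pow 0 = UNIV"
  by (simp add: var_ideal_pow_def nat_pow_def ideals_set_def)

lemma var_ideal_pow_Suc: "var_ideal_pow (Suc k) = ideal_prod mpoly_ring (var_ideal_pow k) var_ideal"
  by (simp add: var_ideal_pow_def nat_pow_def ideals_set_def)

lemma var_ideal_pow_ideal: "ideal (var_ideal_pow k) mpoly_ring"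
proof (induction k)
  case 0
  then show ?case using ring.oneideal[OF cring.axioms(1)[OF mpoly_ring_cring]]
    by (simp add: var_ideal_pow_0)
next
  case (Suc k)
  then show ?case unfolding var_ideal_pow_Suc
    by (rule ring.ideal_prod_is_ideal[OF cring.axioms(1)[OF mpoly_ring_cring] _ var_ideal_ideal])
qed

lemma var_in_ideal: "mpoly_var j \<in> var_ideal"
  unfolding var_ideal_def
  by (rule subsetD[OF ring.genideal_self[OF cring.axioms(1)[OF mpoly_ring_cring]]]) auto

lemma ideal_mpoly_closed:
  assumes "ideal I mpoly_ring"
  shows "0 \<in> I" "f \<in> I \<Longrightarrow> g \<in> I \<Longrightarrow> f + g \<in> I" "f \<in> I \<Longrightarrow> h * f \<in> I" "f \<in> I \<Longrightarrow> f * h \<in> I"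
  using additive_subgroup.zero_closed[OF ideal.axioms(1)[OF assms]]
    additive_subgroup.a_closed[OF ideal.axioms(1)[OF assms]]
    ideal.I_l_closed[OF assms] ideal.I_r_closed[OF assms] by auto

lemma euler_op_in_ideal: "euler_op f \<in> var_ideal"
proof -
  have "(\<Sum>j\<in>A. mpoly_var j * partial j f) \<in> var_ideal" for A
    by (induction A rule: infinite_finite_induct)
      (auto intro: ideal_mpoly_closed[OF var_ideal_ideal] var_in_ideal)
  then show ?thesis by (simp add: euler_op_def)
qed

text \<open>By the product rule, since all values of the operator lie in q. This is why the Euler
  operator acts on S, while a single partial derivative in general lowers the power of q by
  one.\<close>

lemma euler_op_ideal_pow: "f \<in> var_ideal_pow k \<Longrightarrow> euler_op f \<in> var_ideal_pow k"
proof (induction k arbitrary: f)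
  case 0
  then show ?case by (simp add: var_ideal_pow_0)
next
  case (Suc k)
  from Suc.prems show ?case
    unfolding var_ideal_pow_Suc
  proof (induction f rule: ideal_prod.induct)
    case (prod f g)
    have "euler_op f \<otimes>\<^bsub>mpoly_ring\<^esub> g \<oplus>\<^bsub>mpoly_ring\<^esub> f \<otimes>\<^bsub>mpoly_ring\<^esub> euler_op g
        \<in> ideal_prod mpoly_ring (var_ideal_pow k) var_ideal"
      using prod Suc.IH euler_op_in_ideal by (intro ideal_prod.intros)
    then show ?case by (simp add: euler_op_mult)
  next
    case (sum f g)
    then show ?case using ideal_prod.sum[OF sum(3,4)] by (simp add: euler_op_add)
  qed
qed

lemma trunc_ring_presentation: "ring_presentation (trunc_ring k) (residue k)"
proof -
  interpret I: ideal "var_ideal_pow k" mpoly_ring by (rule var_ideal_pow_ideal)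
  have h: "residue k = (+>\<^bsub>mpoly_ring\<^esub>) (var_ideal_pow k)"
    by (simp add: residue_def fun_eq_iff)
  have hom: "residue k \<in> ring_hom mpoly_ring (trunc_ring k)"
    unfolding h trunc_ring_def by (rule I.rcos_ring_hom)
  show ?thesis
  proof (rule ring_presentation.intro)
    show "cring (trunc_ring k)"
      unfolding trunc_ring_def by (rule I.quotient_is_cring[OF mpoly_ring_cring])
    show "range (residue k) = carrier (trunc_ring k)"
      by (auto simp: h trunc_ring_def FactRing_def A_RCOSETS_def')
  qed (use ring_hom_add[OF hom] ring_hom_mult[OF hom] ring_hom_one[OF hom] in simp_all)
qed

interpretation tr: ring_presentation "trunc_ring k" "residue k" for k
  by (rule trunc_ring_presentation)

lemma residue_zero_iff: "residue k f = \<zero>\<^bsub>trunc_ring k\<^esub> \<longleftrightarrow> f \<in> var_ideal_pow k"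
proof -
  interpret I: ideal "var_ideal_pow k" mpoly_ring by (rule var_ideal_pow_ideal)
  have "\<zero>\<^bsub>trunc_ring k\<^esub> = var_ideal_pow k" by (simp add: trunc_ring_def FactRing_def)
  then show ?thesis
    using I.a_rcos_self[of f] I.a_rcos_const[of f] by (auto simp: residue_def)
qed

lemma residue_euler_op_cong: "residue k f = residue k g \<Longrightarrow> residue k (euler_op f) = residue k (euler_op g)"
  unfolding tr.res_eq_iff[of k f] tr.res_eq_iff[of k "euler_op f"] residue_zero_iff
  by (simp add: euler_op_ideal_pow flip: euler_op_diff)

lemma trunc_max_simps:
  "carrier (trunc_max k) = residue k ` var_ideal" "ring.add (trunc_max k) = ring.add (trunc_ring k)"
  "module.smult (trunc_max k) = monoid.mult (trunc_ring k)"
  "ring.zero (trunc_max k) = ring.zero (trunc_ring k)"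
  by (simp_all add: trunc_max_def)

lemma trunc_max_closed:
  "carrier (trunc_max k) \<subseteq> carrier (trunc_ring k)"
  "\<zero>\<^bsub>trunc_ring k\<^esub> \<in> carrier (trunc_max k)"
  "\<lbrakk>x \<in> carrier (trunc_max k); y \<in> carrier (trunc_max k)\<rbrakk> \<Longrightarrow> x \<oplus>\<^bsub>trunc_ring k\<^esub> y \<in> carrier (trunc_max k)"
  "\<lbrakk>a \<in> carrier (trunc_ring k); x \<in> carrier (trunc_max k)\<rbrakk> \<Longrightarrow> a \<otimes>\<^bsub>trunc_ring k\<^esub> x \<in> carrier (trunc_max k)"
proof -
  show "\<zero>\<^bsub>trunc_ring k\<^esub> \<in> carrier (trunc_max k)"
    using ideal_mpoly_closed(1)[OF var_ideal_ideal] by (auto simp: trunc_max_simps simp flip: tr.res_zero)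
  show "x \<oplus>\<^bsub>trunc_ring k\<^esub> y \<in> carrier (trunc_max k)"
    if "x \<in> carrier (trunc_max k)" "y \<in> carrier (trunc_max k)"
    using that ideal_mpoly_closed(2)[OF var_ideal_ideal]
    by (force simp: trunc_max_simps simp flip: tr.res_add)
  show "a \<otimes>\<^bsub>trunc_ring k\<^esub> x \<in> carrier (trunc_max k)"
    if "a \<in> carrier (trunc_ring k)" "x \<in> carrier (trunc_max k)"
    using that ideal_mpoly_closed(3)[OF var_ideal_ideal]
    by (force simp: trunc_max_simps dest!: tr.res_surj simp flip: tr.res_mult)
qed (auto simp: trunc_max_simps)

lemma trunc_scalars_subset: "trunc_scalars k \<subseteq> carrier (trunc_ring k)"
  by (auto simp: trunc_scalars_def)


section \<open>The Euler form\<close>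

abbreviation diff_cl :: "nat \<Rightarrow> (('a::field, 'n::finite) trunc \<Rightarrow>\<^sub>0 ('a, 'n) mpoly) \<Rightarrow> ('a, 'n) diff1" where
  "diff_cl k \<equiv> tr.kaehler_cl k (trunc_scalars k)"

interpretation kd: module_presentation "trunc_ring k" "residue k" "kdiffs k" "diff_cl k"
    "carrier (trunc_ring k)" "tr.kaehler_relators k (trunc_scalars k)" for k
  unfolding kdiffs_def by (rule tr.kaehler_pres[OF trunc_scalars_subset])

lemma diff_d_eq: "diff_d k (residue k f) = diff_cl k (gen (residue k f))"
  by (simp add: diff_d_def tr.kaehler_d_eq)

definition var_res :: "nat \<Rightarrow> 'n \<Rightarrow> ('a::field, 'n::finite) trunc" where
  "var_res k j = residue k (mpoly_var j)"

definition dx :: "nat \<Rightarrow> 'n \<Rightarrow> ('a::field, 'n::finite) diff1" where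
  "dx k j = diff_d k (residue k (mpoly_var j))"

lemma dx_eq: "dx k j = diff_cl k (gen (var_res k j))"
  by (simp add: dx_def var_res_def diff_d_eq)

lemma dx_closed [simp]: "dx k j \<in> carrier (kdiffs k)"
  by (simp add: dx_eq)

definition grad :: "('a::field, 'n::finite) mpoly \<Rightarrow> ('n \<Rightarrow>\<^sub>0 ('a, 'n) mpoly)" where
  "grad f = (\<Sum>j\<in>UNIV. Poly_Mapping.single j (partial j f))"

lemma lookup_grad [simp]: "lookup (grad f) j = partial j f"
  by (simp add: grad_def lookup_sum lookup_single when_def)

lemma grad_add: "grad (f + g) = grad f + grad g"
  by (rule poly_mapping_eqI) (simp add: lookup_add partial_add)

lemma grad_diff: "grad (f - g) = grad f - grad g"
  by (rule poly_mapping_eqI) (simp add: lookup_minus partial_diff)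

lemma grad_mult: "grad (f * g) = scale f (grad g) + scale g (grad f)"
  by (rule poly_mapping_eqI) (simp add: lookup_add partial_mult mult.commute)

lemma grad_const [simp]: "grad (mpoly_const c) = 0"
  by (rule poly_mapping_eqI) simp

lemma grad_var: "grad (mpoly_var j) = gen j"
  by (rule poly_mapping_eqI) (simp add: partial_var lookup_single when_def)

lemma kaehler_relators_ker: "c \<in> tr.kaehler_relators k (trunc_scalars k) \<Longrightarrow> c \<in> kd.ker k"
  by (simp add: kd.ker_def kd.cl_rels)

text \<open>The chain rule for df. Both sides are additive and satisfy the Leibniz rule modulo the
  kernel, so constants and variables suffice.\<close>

lemma d_expand: "gen (residue k f) - lin_ext (\<lambda>j. gen (var_res k j)) (grad f) \<in> kd.ker k"
proof (induction f rule: mpoly_alg_induct)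
  case (const c)
  have "gen (residue k (mpoly_const c)) \<in> kd.ker k"
    by (rule kaehler_relators_ker) (auto simp: tr.kaehler_relators_def trunc_scalars_def)
  then show ?case by simp
next
  case (var j)
  then show ?case by (simp add: grad_var var_res_def kd.ker_closed)
next
  case (add f g)
  let ?L = "lin_ext (\<lambda>j. gen (var_res k j))"
  have *: "gen (residue k f \<oplus>\<^bsub>trunc_ring k\<^esub> residue k g) - (gen (residue k f) + gen (residue k g)) \<in> kd.ker k"
    by (rule kaehler_relators_ker) (use tr.res_closed in \<open>unfold tr.kaehler_relators_def, blast\<close>)
  have "gen (residue k (f + g)) - ?L (grad (f + g))
      = (gen (residue k f \<oplus>\<^bsub>trunc_ring k\<^esub> residue k g) - (gen (residue k f) + gen (residue k g)))
        + (gen (residue k f) - ?L (grad f)) + (gen (residue k g) - ?L (grad g))"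
    by (simp add: tr.res_add grad_add lin_ext_add algebra_simps)
  also have "\<dots> \<in> kd.ker k" by (rule * add kd.ker_closed)+
  finally show ?case .
next
  case (mult f g)
  let ?L = "lin_ext (\<lambda>j. gen (var_res k j))"
  have *: "gen (residue k (f * g)) - (scale f (gen (residue k g)) + scale g (gen (residue k f))) \<in> kd.ker k"
    by (rule kaehler_relators_ker) (unfold tr.kaehler_relators_def, blast)
  have "gen (residue k (f * g)) - ?L (grad (f * g))
      = (gen (residue k (f * g)) - (scale f (gen (residue k g)) + scale g (gen (residue k f))))
        + scale f (gen (residue k g) - ?L (grad g)) + scale g (gen (residue k f) - ?L (grad f))"
    by (simp add: grad_mult lin_ext_add lin_ext_scale scale.scale_right_diff_distrib algebra_simps del: scale_gen)
  also have "\<dots> \<in> kd.ker k" by (rule * mult kd.ker_closed)+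
  finally show ?case .
qed

lemma kd_span:
  fixes W :: "(('a::field, 'n::finite) trunc \<Rightarrow>\<^sub>0 ('a, 'n) mpoly) set"
  assumes W: "scale.subspace W" "kd.ker k \<subseteq> W" "\<And>j. gen (var_res k j) \<in> W"
  shows "W = UNIV"
proof -
  have "gen b \<in> W" for b
  proof (cases "b \<in> carrier (trunc_ring k)")
    case True
    then obtain f where f: "b = residue k f" using tr.res_surj by blast
    have "lin_ext (\<lambda>j. gen (var_res k j)) (grad f) \<in> W"
      unfolding lin_ext_def by (intro scale.subspace_sum[OF W(1)] scale.subspace_scale[OF W(1)] W(3))
    then show ?thesis
      using scale.subspace_add[OF W(1) subsetD[OF W(2) d_expand[of k f]]] f by fastforce
  next
    case False
    then show ?thesis using W(2) kd.cl_outside by (auto simp: kd.ker_def)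
  qed
  then show ?thesis
    using subspace_sum_gen[OF W(1) scale.subspace_scale[OF W(1)]] by blast
qed

text \<open>\<open>lin_ext\<close> yields families, so scalars are written as families over the
  one-element type. A symbol goes to the Euler operator of a lift; the choice of lift disappears
  under \<open>residue\<close> because the operator preserves q^k.\<close>

definition euler_rep :: "nat \<Rightarrow> (('a::field, 'n::finite) trunc \<Rightarrow>\<^sub>0 ('a, 'n) mpoly) \<Rightarrow> ('a, 'n) mpoly" where
  "euler_rep k c = lookup (lin_ext (\<lambda>a. Poly_Mapping.single ()
     (if a \<in> carrier (trunc_ring k) then euler_op (tr.rep k a) else 0)) c) ()"

lemma euler_rep_simps:
  "euler_rep k 0 = 0" "euler_rep k (c + d) = euler_rep k c + euler_rep k d" "euler_rep k (c - d) = euler_rep k c - euler_rep k d"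
  "euler_rep k (scale f c) = f * euler_rep k c"
  by (simp_all add: euler_rep_def lin_ext_add lin_ext_diff lin_ext_scale lookup_add lookup_minus)

lemma euler_rep_gen: "euler_rep k (gen a) = (if a \<in> carrier (trunc_ring k) then euler_op (tr.rep k a) else 0)"
  by (simp add: euler_rep_def)

lemma residue_euler_rep_gen: "residue k (euler_rep k (gen (residue k f))) = residue k (euler_op f)"
  by (simp add: euler_rep_gen) (rule residue_euler_op_cong, simp)

lemma residue_euler_rep_closed: "residue k (euler_rep k c) \<in> carrier (trunc_max k)"
proof -
  have "c \<in> {c. euler_rep k c \<in> var_ideal}"
  proof (rule subspace_sum_gen)
    show W: "scale.subspace {c. euler_rep k c \<in> var_ideal}"
      by (auto simp: scale.subspace_def euler_rep_simps intro: ideal_mpoly_closed[OF var_ideal_ideal])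
    show "scale (lookup c b) (gen b) \<in> {c. euler_rep k c \<in> var_ideal}" for b
      by (rule scale.subspace_scale[OF W])
        (auto simp: euler_rep_gen euler_op_in_ideal ideal_mpoly_closed[OF var_ideal_ideal])
  qed
  then show ?thesis by (simp add: trunc_max_simps)
qed

text \<open>The Euler operator is a derivation that kills constants, and the relators ask for
  exactly this.\<close>

lemma euler_rep_ker:
  assumes "c \<in> kd.ker k"
  shows "residue k (euler_rep k c) = \<zero>\<^bsub>trunc_ring k\<^esub>"
proof -
  have "kd.ker k \<subseteq> {c. residue k (euler_rep k c) = \<zero>\<^bsub>trunc_ring k\<^esub>}"
  proof (rule kd.ker_min)
    fix c assume "c \<in> tr.kaehler_relators k (trunc_scalars k)"
    then consider f g where "c = gen (residue k (f + g)) - (gen (residue k f) + gen (residue k g))"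
      | f g where "c = gen (residue k (f * g)) - (scale f (gen (residue k g)) + scale g (gen (residue k f)))"
      | a where "c = gen (residue k (mpoly_const a))"
      unfolding tr.kaehler_relators_def trunc_scalars_def
      by (auto simp del: scale_gen dest!: tr.res_surj simp flip: tr.res_add)
    then have "residue k (euler_rep k c) = \<zero>\<^bsub>trunc_ring k\<^esub>"
    proof cases
      case 1
      have "residue k (euler_rep k c) = residue k (euler_rep k (gen (residue k (f + g)))) \<ominus>\<^bsub>trunc_ring k\<^esub>
          (residue k (euler_rep k (gen (residue k f))) \<oplus>\<^bsub>trunc_ring k\<^esub> residue k (euler_rep k (gen (residue k g))))"
        unfolding 1 by (simp only: euler_rep_simps tr.res_diff tr.res_add[of k "euler_rep k _"])
      also have "\<dots> = residue k (euler_op (f + g)) \<ominus>\<^bsub>trunc_ring k\<^esub> residue k (euler_op f + euler_op g)"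
        by (simp only: residue_euler_rep_gen tr.res_add[of k "euler_op f"])
      also have "\<dots> = residue k 0"
        by (simp only: euler_op_add flip: tr.res_diff) simp
      finally show ?thesis by (simp only: tr.res_zero)
    next
      case 2
      have "residue k (euler_rep k c) = residue k (euler_rep k (gen (residue k (f * g)))) \<ominus>\<^bsub>trunc_ring k\<^esub>
          (residue k f \<otimes>\<^bsub>trunc_ring k\<^esub> residue k (euler_rep k (gen (residue k g))) \<oplus>\<^bsub>trunc_ring k\<^esub>
           residue k g \<otimes>\<^bsub>trunc_ring k\<^esub> residue k (euler_rep k (gen (residue k f))))"
        unfolding 2 by (simp only: euler_rep_simps tr.res_diff tr.res_add tr.res_mult[of k _ "euler_rep k _"])
      also have "\<dots> = residue k (euler_op (f * g)) \<ominus>\<^bsub>trunc_ring k\<^esub> residue k (f * euler_op g + g * euler_op f)"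
        by (simp only: residue_euler_rep_gen tr.res_add tr.res_mult[of k f "euler_op g"] tr.res_mult[of k g "euler_op f"])
      also have "\<dots> = residue k 0"
        by (simp only: euler_op_mult flip: tr.res_diff) (simp add: mult.commute)
      finally show ?thesis by (simp only: tr.res_zero)
    next
      case 3
      then show ?thesis by (simp add: residue_euler_rep_gen tr.res_zero)
    qed
    then show "c \<in> {c. residue k (euler_rep k c) = \<zero>\<^bsub>trunc_ring k\<^esub>}" by simp
  qed (auto simp: scale.subspace_def euler_rep_simps euler_rep_gen tr.res_zero tr.res_add tr.res_mult simp del: scale_gen)
  with assms show ?thesis by blast
qed

lemma add_pow_residue: "[d] \<cdot>\<^bsub>trunc_ring k\<^esub> residue k f = residue k (of_nat d * f)" for d :: nat
  by (induction d) (simp_all add: tr.res_zero tr.res_add tr.R.a_ac distrib_right)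

text \<open>Existence comes from \<open>kd.lift\<close>, and Euler's identity gives the values on
  homogeneous elements. For uniqueness the condition in degree 1 is enough, because the
  differentials of the variables generate.\<close>

lemma euler_form_props:
  fixes c :: "('a::field, 'n::finite) trunc \<Rightarrow>\<^sub>0 ('a, 'n) mpoly"
  shows "(euler_form k :: ('a, 'n) diff1 \<Rightarrow> ('a, 'n) trunc) \<in> mod_hom (trunc_ring k) (kdiffs k) (trunc_max k)"
    and "euler_form k (diff_cl k c) = residue k (euler_rep k c)"
    and "f \<in> trunc_comp k d \<Longrightarrow> euler_form k (diff_d k f :: ('a, 'n) diff1) = [d] \<cdot>\<^bsub>trunc_ring k\<^esub> f"
proof -
  have "\<exists>h :: ('a, 'n) diff1 \<Rightarrow> ('a, 'n) trunc. h \<in> extensional (carrier (kdiffs k)) \<and>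
      h \<in> mod_hom (trunc_ring k) (kdiffs k) (trunc_max k) \<and> (\<forall>c. h (diff_cl k c) = residue k (euler_rep k c))"
    by (rule kd.lift)
      (use trunc_max_closed(1) in \<open>auto simp: trunc_max_simps euler_rep_simps tr.res_add tr.res_mult euler_rep_ker
        residue_euler_rep_closed[unfolded trunc_max_simps]\<close>)
  then obtain h :: "('a, 'n) diff1 \<Rightarrow> ('a, 'n) trunc" where h: "h \<in> extensional (carrier (kdiffs k))"
    "h \<in> mod_hom (trunc_ring k) (kdiffs k) (trunc_max k)" "\<And>c. h (diff_cl k c) = residue k (euler_rep k c)"
    by blast
  have hd: "h (diff_d k f) = [d] \<cdot>\<^bsub>trunc_ring k\<^esub> f" if f: "f \<in> trunc_comp k d" for d f
  proof -
    obtain p where p: "p \<in> hcoef 0 d" "f = residue k p"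
      using f by (auto simp: trunc_comp_def mpoly_homog_eq)
    then show ?thesis
      using euler_op_hcoef[OF p(1)] by (simp add: diff_d_eq h(3) residue_euler_rep_gen add_pow_residue)
  qed
  have "euler_form k = h"
    unfolding euler_form_def
  proof (rule the_equality, safe)
    fix h' :: "('a, 'n) diff1 \<Rightarrow> ('a, 'n) trunc"
    assume h': "h' \<in> extensional (carrier (kdiffs k))"
      "h' \<in> mod_hom (trunc_ring k) (kdiffs k) (trunc_max k)"
      "\<forall>d. \<forall>f\<in>trunc_comp k d. h' (diff_d k f) = [d] \<cdot>\<^bsub>trunc_ring k\<^esub> f"
    have x: "var_res k j \<in> trunc_comp k 1" for j
      by (auto simp: var_res_def trunc_comp_def mpoly_homog_eq hcoef_def mpoly_var_def)
    show "h' = h"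
    proof (rule extensionalityI[OF h'(1) h(1)], rule kd.hom_ext[OF h'(2) h(2)])
      fix W :: "(('a, 'n) trunc \<Rightarrow>\<^sub>0 ('a, 'n) mpoly) set"
      assume "scale.subspace W" "kd.ker k \<subseteq> W" "\<And>c. c \<in> range (\<lambda>j. gen (var_res k j)) \<Longrightarrow> c \<in> W"
      then show "W = UNIV" by (intro kd_span) auto
    next
      fix c :: "('a, 'n) trunc \<Rightarrow>\<^sub>0 ('a, 'n) mpoly" assume "c \<in> range (\<lambda>j. gen (var_res k j))"
      then obtain j where "diff_cl k c = diff_d k (var_res k j)" by (auto simp: diff_d_eq var_res_def)
      then show "h' (diff_cl k c) = h (diff_cl k c)" using h'(3) hd x by metis
    next
      fix x assume "x \<in> carrier (trunc_max k)"
      then show "\<zero>\<^bsub>trunc_ring k\<^esub> \<odot>\<^bsub>trunc_max k\<^esub> x = \<zero>\<^bsub>trunc_max k\<^esub>"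
        using trunc_max_closed(1) by (auto simp: trunc_max_simps)
    qed
  qed (use h hd in auto)
  with h hd show "(euler_form k :: ('a, 'n) diff1 \<Rightarrow> ('a, 'n) trunc) \<in> mod_hom (trunc_ring k) (kdiffs k) (trunc_max k)"
    "euler_form k (diff_cl k c) = residue k (euler_rep k c)"
    "f \<in> trunc_comp k d \<Longrightarrow> euler_form k (diff_d k f :: ('a, 'n) diff1) = [d] \<cdot>\<^bsub>trunc_ring k\<^esub> f"
    by auto
qed

definition euler_coef :: "nat \<Rightarrow> ('a::field, 'n::finite) diff1 \<Rightarrow> ('a, 'n) mpoly" where
  "euler_coef k w = tr.rep k (euler_form k w)"

lemma euler_form_add:
  "\<lbrakk>x \<in> carrier (kdiffs k); y \<in> carrier (kdiffs k)\<rbrakk> \<Longrightarrow>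
    euler_form k (x \<oplus>\<^bsub>kdiffs k\<^esub> y) = euler_form k x \<oplus>\<^bsub>trunc_ring k\<^esub> euler_form k y"
  using euler_form_props(1) unfolding mod_hom_def trunc_max_simps by blast

lemma euler_form_smult:
  "\<lbrakk>a \<in> carrier (trunc_ring k); x \<in> carrier (kdiffs k)\<rbrakk> \<Longrightarrow>
    euler_form k (a \<odot>\<^bsub>kdiffs k\<^esub> x) = a \<otimes>\<^bsub>trunc_ring k\<^esub> euler_form k x"
  using euler_form_props(1) unfolding mod_hom_def trunc_max_simps by blast

lemma residue_euler_coef: "w \<in> carrier (kdiffs k) \<Longrightarrow> residue k (euler_coef k w) = euler_form k w"
  using kd.cl_surj[of w k] by (auto simp: euler_coef_def euler_form_props)

lemma residue_euler_coef_dx: "residue k (euler_coef k (dx k j)) = var_res k j"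
  by (simp add: residue_euler_coef dx_eq euler_form_props(2) var_res_def residue_euler_rep_gen euler_op_var)

interpretation om: contraction_data "trunc_ring k" "residue k" "kdiffs k" "euler_coef k" for k
proof unfold_locales
  show "residue k (euler_coef k (x \<oplus>\<^bsub>kdiffs k\<^esub> y)) = residue k (euler_coef k x + euler_coef k y)"
    if "x \<in> carrier (kdiffs k)" "y \<in> carrier (kdiffs k)" for x y
    using that by (simp add: residue_euler_coef kd.M.a_closed tr.res_add euler_form_add)
  have smult: "residue k f \<odot>\<^bsub>kdiffs k\<^esub> x \<in> carrier (kdiffs k)" if "x \<in> carrier (kdiffs k)" for f x
    using kd.cl_surj[OF that] by (auto simp flip: kd.cl_scale)
  then show "a \<odot>\<^bsub>kdiffs k\<^esub> x \<in> carrier (kdiffs k)"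
    if "a \<in> carrier (trunc_ring k)" "x \<in> carrier (kdiffs k)" for a x
    using that tr.res_surj by blast
  show "residue k (euler_coef k (residue k f \<odot>\<^bsub>kdiffs k\<^esub> x)) = residue k (f * euler_coef k x)"
    if "x \<in> carrier (kdiffs k)" for x f
    using that smult[OF that] by (simp add: residue_euler_coef tr.res_mult euler_form_smult)
qed (rule kd.M.a_closed)


section \<open>The exterior derivative\<close>

lemma lin_ext_mem:
  assumes "scale.subspace W" "\<And>b. b \<in> keys c \<Longrightarrow> \<phi> b \<in> W"
  shows "lin_ext \<phi> c \<in> W"
  unfolding lin_ext_def by (intro scale.subspace_sum[OF assms(1)] scale.subspace_scale[OF assms(1)] assms(2))

lemma lin_ext_UNIV: "lin_ext \<phi> (c :: 'n::finite \<Rightarrow>\<^sub>0 _) = (\<Sum>j\<in>UNIV. scale (lookup c j) (\<phi> j))"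
  by (rule lin_ext_superset) auto

lemma lin_ext_lin_ext: "lin_ext \<phi> (lin_ext \<psi> c) = lin_ext (\<lambda>b. lin_ext \<phi> (\<psi> b)) c"
  by (simp add: lin_ext_def[of \<psi>] lin_ext_def[of "\<lambda>b. lin_ext \<phi> (\<psi> b)"] lin_ext_sum lin_ext_scale)

lemma lin_ext_swap: "lin_ext (\<lambda>r. lin_ext (\<lambda>j. \<phi> j r) a) b = lin_ext (\<lambda>j. lin_ext (\<lambda>r. \<phi> j r) b) a"
  unfolding lin_ext_def scale.scale_sum_right by (subst sum.swap) (simp add: mult.commute)

lemma lin_ext_fun_diff: "lin_ext (\<lambda>b. \<phi> b - \<psi> b) c = lin_ext \<phi> c - lin_ext \<psi> c"
  by (simp add: lin_ext_def scale.scale_right_diff_distrib sum_subtractf)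

lemma lin_ext_fun_scale: "lin_ext (\<lambda>b. scale f (\<phi> b)) c = scale f (lin_ext \<phi> c)"
  by (simp add: lin_ext_def scale.scale_sum_right mult.commute)

lemma scale_single: "scale g (Poly_Mapping.single b f) = Poly_Mapping.single b (g * f)"
  by (auto intro!: poly_mapping_eqI simp: lookup_single when_def)

lemma sum_single: "(\<Sum>b\<in>keys c. Poly_Mapping.single b (lookup c b)) = c"
  by (rule poly_mapping_eqI) (simp add: lookup_sum lookup_single when_def in_keys_iff)

lemma lin_ext_gen_id [simp]: "lin_ext gen c = c"
  by (simp add: lin_ext_def sum_single)

lemma (in module_presentation) ker_outside: "b \<notin> B \<Longrightarrow> gen b \<in> ker"
  by (simp add: ker_def cl_outside)

lemma dx_image [simp]: "dx k ` A \<subseteq> carrier (kdiffs k)"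
  by auto

section \<open>One-forms in coordinates, and wedges expanded in one slot\<close>

definition dx_comb :: "nat \<Rightarrow> ('n \<Rightarrow>\<^sub>0 ('a, 'n) mpoly) \<Rightarrow> ('a::field, 'n::finite) diff1" where
  "dx_comb k a = diff_cl k (lin_ext (\<lambda>j. gen (var_res k j)) a)"

lemma dx_comb_closed [simp]: "dx_comb k a \<in> carrier (kdiffs k)"
  by (simp add: dx_comb_def)

lemma dx_comb_add: "dx_comb k (a + b) = dx_comb k a \<oplus>\<^bsub>kdiffs k\<^esub> dx_comb k b"
  by (simp add: dx_comb_def lin_ext_add kd.cl_add)

lemma dx_comb_scale: "dx_comb k (scale f a) = residue k f \<odot>\<^bsub>kdiffs k\<^esub> dx_comb k a"
  by (simp add: dx_comb_def lin_ext_scale kd.cl_scale)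

lemma dx_comb_zero: "dx_comb k 0 = \<zero>\<^bsub>kdiffs k\<^esub>"
  by (simp add: dx_comb_def kd.cl_zero)

lemma dx_comb_gen: "dx_comb k (gen j) = dx k j"
  by (simp add: dx_comb_def dx_eq)

lemma dx_comb_diff: "dx_comb k a = dx_comb k b \<Longrightarrow> dx_comb k (a - b) = \<zero>\<^bsub>kdiffs k\<^esub>"
  by (simp add: dx_comb_def lin_ext_diff kd.cl_cancel)

lemma dx_comb_grad: "dx_comb k (grad f) = diff_cl k (gen (residue k f))"
  using d_expand[of k f] by (simp add: dx_comb_def flip: kd.cl_eq_iff)

lemma dx_comb_grad_zero:
  assumes "residue k f = \<zero>\<^bsub>trunc_ring k\<^esub>"
  shows "dx_comb k (grad f) = \<zero>\<^bsub>kdiffs k\<^esub>"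
proof -
  have "grad 0 = (0 :: 'a \<Rightarrow>\<^sub>0 ('b, 'a) mpoly)" by (rule poly_mapping_eqI) simp
  moreover have "dx_comb k (grad f) = dx_comb k (grad 0)"
    using assms by (simp only: dx_comb_grad tr.res_zero)
  ultimately show ?thesis by (simp add: dx_comb_zero)
qed

lemma dx_comb_surj:
  assumes "w \<in> carrier (kdiffs k)"
  shows "\<exists>a. dx_comb k a = w"
proof -
  let ?W = "{c. \<exists>a. dx_comb k a = diff_cl k c}"
  have "?W = UNIV"
  proof (rule kd_span[of _ k])
    show "scale.subspace ?W"
      unfolding scale.subspace_def
      by (auto simp: kd.cl_zero kd.cl_add kd.cl_scale) (metis dx_comb_zero, metis dx_comb_add, metis dx_comb_scale)
    show "kd.ker k \<subseteq> ?W" unfolding kd.ker_def using dx_comb_zero by force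
    show "gen (var_res k j) \<in> ?W" for j using dx_comb_gen by (auto simp flip: dx_eq)
  qed
  then show ?thesis using kd.cl_surj[OF assms] by auto
qed

text \<open>Coordinates are a choice, since the dx_j satisfy relations. Two choices differ by a
  relation, and \<open>dx_comb_zero_d_null1\<close> controls its effect on derivatives.\<close>

definition dx_coords :: "nat \<Rightarrow> ('a::field, 'n::finite) diff1 \<Rightarrow> ('n \<Rightarrow>\<^sub>0 ('a, 'n) mpoly)" where
  "dx_coords k w = (SOME a. dx_comb k a = w)"

lemma dx_comb_dx_coords: "w \<in> carrier (kdiffs k) \<Longrightarrow> dx_comb k (dx_coords k w) = w"
  unfolding dx_coords_def by (rule someI_ex[OF dx_comb_surj])

abbreviation form_ker :: "nat \<Rightarrow> nat \<Rightarrow> (('a::field, 'n::finite) diff1 list \<Rightarrow>\<^sub>0 ('a, 'n) mpoly) set" where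
  "form_ker k m \<equiv> om.ext.ker k m"

text \<open>The coordinate vectors for which the expansion holds form a submodule that contains the
  unit vectors. For lists of another length than \<open>m\<close>, all symbols involved lie in the
  kernel.\<close>

lemma form_ker_slot:
  assumes us: "set us \<subseteq> carrier (kdiffs k)" "set vs \<subseteq> carrier (kdiffs k)"
  shows "gen (us @ dx_comb k a # vs) - lin_ext (\<lambda>j. gen (us @ dx k j # vs)) a \<in> form_ker k m"
proof (cases "length us + Suc (length vs) = m")
  case True
  have t: "us @ x # vs \<in> tuples (kdiffs k) m" if "x \<in> carrier (kdiffs k)" for x
    using that us True by (auto simp: tuples_def)
  let ?\<phi> = "\<lambda>j. gen (us @ dx k j # vs)"
  let ?W = "{a. gen (us @ dx_comb k a # vs) - lin_ext ?\<phi> a \<in> form_ker k m}"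
  have smult: "gen (us @ dx_comb k (scale f a) # vs) - lin_ext ?\<phi> (scale f a) \<in> form_ker k m"
    if "a \<in> ?W" for f a
  proof -
    have "gen (us @ dx_comb k (scale f a) # vs) - lin_ext ?\<phi> (scale f a)
      = (gen (us @ dx_comb k (scale f a) # vs) - scale f (gen (us @ dx_comb k a # vs)))
        + scale f (gen (us @ dx_comb k a # vs) - lin_ext ?\<phi> a)"
      by (simp add: lin_ext_scale scale.scale_right_diff_distrib del: scale_gen)
    also have "\<dots> \<in> form_ker k m"
      using om.wker_smult[OF t[of "dx_comb k a"], of f] that
      by (intro om.ext.ker_closed(2,5)) (auto simp: dx_comb_scale simp del: scale_gen)
    finally show ?thesis .
  qed
  have "scale.subspace ?W"
    unfolding scale.subspace_def
  proof (intro conjI ballI allI)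
    show "0 \<in> ?W"
      using om.wker_smult[OF t[of "dx_comb k 0"], of 0] unfolding dx_comb_scale[symmetric] by simp
  next
    fix a b assume ab: "a \<in> ?W" "b \<in> ?W"
    have "gen (us @ dx_comb k (a + b) # vs) - lin_ext ?\<phi> (a + b)
      = (gen (us @ dx_comb k (a + b) # vs) - (gen (us @ dx_comb k a # vs) + gen (us @ dx_comb k b # vs)))
        + (gen (us @ dx_comb k a # vs) - lin_ext ?\<phi> a) + (gen (us @ dx_comb k b # vs) - lin_ext ?\<phi> b)"
      by (simp add: lin_ext_add)
    also have "\<dots> \<in> form_ker k m"
      using om.wker_add[OF t[of "dx_comb k a"], of "dx_comb k b"] ab
      by (intro om.ext.ker_closed(2)) (auto simp: dx_comb_add)
    finally show "a + b \<in> ?W" by simp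
  qed (use smult in auto)
  moreover have "gen j \<in> ?W" for j
    by (simp add: dx_comb_gen om.ext.ker_closed)
  ultimately have "a \<in> ?W"
    using subspace_sum_gen[OF _ scale.subspace_scale, of ?W a] by blast
  then show ?thesis by simp
next
  case False
  then have "gen (us @ x # vs) \<in> form_ker k m" for x
    by (intro om.ext.ker_outside) (auto simp: tuples_def)
  then show ?thesis
    by (intro om.ext.ker_closed(3) lin_ext_mem om.ext.ker_subspace)
qed

lemma form_ker_slot_zero:
  assumes "set us \<subseteq> carrier (kdiffs k)" "set vs \<subseteq> carrier (kdiffs k)" "dx_comb k a = \<zero>\<^bsub>kdiffs k\<^esub>"
  shows "lin_ext (\<lambda>j. gen (us @ dx k j # vs)) a \<in> form_ker k m"
proof -
  have "gen (us @ dx_comb k a # vs) \<in> form_ker k m"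
    using form_ker_slot[OF assms(1,2), of 0 m] assms(3) by (simp add: dx_comb_zero)
  from om.ext.ker_closed(3)[OF this form_ker_slot[OF assms(1,2), of a]] show ?thesis by simp
qed

text \<open>Symmetric coefficients against alternating wedges: off-diagonal terms cancel in pairs by
  \<open>om.wker_swap\<close>, diagonal terms vanish by \<open>om.wker_alt\<close>, and no division
  by 2 occurs.\<close>

lemma form_ker_sym:
  assumes us: "set us \<subseteq> carrier (kdiffs k)" "set vs \<subseteq> carrier (kdiffs k)" "set zs \<subseteq> carrier (kdiffs k)"
    and s: "\<And>i j. s i j = s j i" and A: "finite A"
  shows "(\<Sum>i\<in>A. \<Sum>j\<in>A. scale (s i j) (gen (us @ dx k i # vs @ dx k j # zs))) \<in> form_ker k m"
    (is "(\<Sum>i\<in>A. \<Sum>j\<in>A. scale (s i j) (?g i j)) \<in> _")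
proof (cases "length us + length vs + length zs + 2 = m")
  case True
  then have t: "us @ dx k i # vs @ dx k j # zs \<in> tuples (kdiffs k) m" for i j
    using us by (auto simp: tuples_def)
  show ?thesis
    using A
  proof (induction A)
    case empty
    then show ?case by (simp add: om.ext.ker_closed)
  next
    case (insert a A)
    have e: "(\<Sum>i\<in>A. scale (s i a) (?g i a)) = (\<Sum>i\<in>A. scale (s a i) (?g i a))"
      by (rule sum.cong[OF refl]) (subst s, rule refl)
    have "(\<Sum>i\<in>insert a A. \<Sum>j\<in>insert a A. scale (s i j) (?g i j)) = scale (s a a) (?g a a)
      + (\<Sum>j\<in>A. scale (s a j) (?g a j + ?g j a)) + (\<Sum>i\<in>A. \<Sum>j\<in>A. scale (s i j) (?g i j))"
      using insert(1,2)
      by (simp add: sum.distrib scale.scale_right_distrib e add_ac del: scale_gen)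
    also have "\<dots> \<in> form_ker k m"
      by (rule insert.IH om.wker_alt[OF t[of a a]] om.wker_swap[OF t] om.ext.ker_closed(2,5,6))+
    finally show ?case .
  qed
next
  case False
  then have "?g i j \<in> form_ker k m" for i j
    by (intro om.ext.ker_outside) (auto simp: tuples_def)
  then show ?thesis by (intro om.ext.ker_closed(5,6))
qed

section \<open>The derivative of coordinate families and the relations it respects\<close>

definition coord_form :: "nat \<Rightarrow> ('n list \<Rightarrow>\<^sub>0 ('a, 'n) mpoly) \<Rightarrow> (('a::field, 'n::finite) diff1 list \<Rightarrow>\<^sub>0 ('a, 'n) mpoly)" where
  "coord_form k = lin_ext (\<lambda>js. gen (map (dx k) js))"

text \<open>The rule d(f dx_J) = df \<and> dx_J. It is additive but not linear over polynomials,
  hence a sum over the support and not a \<open>lin_ext\<close>.\<close>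

definition coord_d :: "('n list \<Rightarrow>\<^sub>0 ('a, 'n) mpoly) \<Rightarrow> ('n list \<Rightarrow>\<^sub>0 ('a::field, 'n::finite) mpoly)" where
  "coord_d \<omega> = (\<Sum>js\<in>keys \<omega>. lin_ext (\<lambda>h. gen (h # js)) (grad (lookup \<omega> js)))"

lemma grad_zero [simp]: "grad 0 = 0"
  by (rule poly_mapping_eqI) simp

lemma coord_d_superset:
  assumes "finite A" "keys \<omega> \<subseteq> A"
  shows "coord_d \<omega> = (\<Sum>js\<in>A. lin_ext (\<lambda>h. gen (h # js)) (grad (lookup \<omega> js)))"
  unfolding coord_d_def by (rule sum.mono_neutral_left) (use assms in \<open>auto simp: in_keys_iff\<close>)

lemma coord_d_single: "coord_d (Poly_Mapping.single js f) = lin_ext (\<lambda>h. gen (h # js)) (grad f)"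
  by (subst coord_d_superset[of "{js}"]) auto

lemma coord_d_add: "coord_d (\<omega> + \<eta>) = coord_d \<omega> + coord_d \<eta>"
proof -
  let ?A = "keys \<omega> \<union> keys \<eta>"
  have "keys (\<omega> + \<eta>) \<subseteq> ?A" by (rule keys_add)
  then show ?thesis
    by (simp add: coord_d_superset[of ?A] lookup_add grad_add lin_ext_add sum.distrib)
qed

lemma coord_d_zero [simp]: "coord_d 0 = 0"
  by (simp add: coord_d_def)

lemma coord_d_sum: "coord_d (sum f A) = (\<Sum>x\<in>A. coord_d (f x))"
  by (induction A rule: infinite_finite_induct) (auto simp: coord_d_add)

lemma coord_form_coord_d_single:
  "coord_form k (coord_d (Poly_Mapping.single js f)) = lin_ext (\<lambda>h. gen (dx k h # map (dx k) js)) (grad f)"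
  by (simp add: coord_form_def coord_d_single lin_ext_lin_ext)

text \<open>The quantification over multiples makes this a submodule, although the derivative is not
  linear over polynomials.\<close>

definition d_null :: "nat \<Rightarrow> nat \<Rightarrow> ('n list \<Rightarrow>\<^sub>0 ('a::field, 'n::finite) mpoly) set" where
  "d_null k m = {\<omega>. \<forall>g. coord_form k (coord_d (scale g \<omega>)) \<in> form_ker k (Suc m)}"

lemma d_null_subspace: "scale.subspace (d_null k m)"
  by (auto simp: scale.subspace_def d_null_def scale.scale_right_distrib coord_d_add coord_form_def lin_ext_add om.ext.ker_closed)

text \<open>If \<open>f\<close> lies in q^k, so does each multiple \<open>g * f\<close>; its
  differential is then zero, and so is a wedge with this differential in one slot.\<close>

lemma d_null_res:
  fixes f :: "('a::field, 'n::finite) mpoly" and c :: "'n list \<Rightarrow>\<^sub>0 ('a, 'n) mpoly"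
  assumes "residue k f = \<zero>\<^bsub>trunc_ring k\<^esub>"
  shows "scale f c \<in> d_null k m"
proof -
  let ?W = "{c. scale f c \<in> d_null k m}"
  have W: "scale.subspace ?W"
    using d_null_subspace[of k m] unfolding scale.subspace_def
    by (auto simp: scale.scale_right_distrib scale.scale_left_commute[of f] simp del: scale.scale_scale)
  have "gen js \<in> ?W" for js
  proof -
    have "coord_form k (coord_d (scale g (scale f (gen js)))) \<in> form_ker k (Suc m)" for g
    proof -
      have "dx_comb k (grad (g * f)) = \<zero>\<^bsub>kdiffs k\<^esub>"
        by (rule dx_comb_grad_zero) (rule tr.res_ideal[OF assms])
      then have "lin_ext (\<lambda>h. gen ([] @ dx k h # map (dx k) js)) (grad (g * f)) \<in> form_ker k (Suc m)"
        by (intro form_ker_slot_zero) auto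
      then show ?thesis by (simp add: scale_single coord_form_coord_d_single mult.commute)
    qed
    then show ?thesis by (auto simp: d_null_def scale_single)
  qed
  then have "c \<in> ?W"
    using subspace_sum_gen[OF W scale.subspace_scale[OF W]] by blast
  then show ?thesis by simp
qed

text \<open>Coordinate vectors that \<open>d_null\<close> absorbs at any place of any list. The aim
  is that every relation between the dx_j is one of them.\<close>

definition d_null1 :: "nat \<Rightarrow> nat \<Rightarrow> ('n \<Rightarrow>\<^sub>0 ('a::field, 'n::finite) mpoly) set" where
  "d_null1 k m = {a. \<forall>l r. lin_ext (\<lambda>j. gen (l @ j # r)) a \<in> d_null k m}"

lemma d_null1_subspace: "scale.subspace (d_null1 k m)"
  using d_null_subspace[of k m] by (auto simp: scale.subspace_def d_null1_def lin_ext_add lin_ext_scale)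

lemma d_null1_res: "residue k f = \<zero>\<^bsub>trunc_ring k\<^esub> \<Longrightarrow> scale f a \<in> d_null1 k m"
  by (simp add: d_null1_def lin_ext_scale d_null_res)

text \<open>Among fixed other factors, the derivative of g df consists of dg \<and> df and g ddf.
  The first vanishes because df = 0 for f in q^k, the second because second partial derivatives are
  symmetric. The partial derivatives of f themselves need not lie in q^k.\<close>

lemma d_null1_grad:
  assumes f: "residue k f = \<zero>\<^bsub>trunc_ring k\<^esub>"
  shows "grad f \<in> d_null1 k m"
proof -
  have "coord_form k (coord_d (scale g (lin_ext (\<lambda>j. gen (l @ j # r)) (grad f)))) \<in> form_ker k (Suc m)" for g l r
  proof -
    let ?g = "\<lambda>i j. gen (dx k i # map (dx k) l @ dx k j # map (dx k) r)"
    have "coord_form k (coord_d (scale g (lin_ext (\<lambda>j. gen (l @ j # r)) (grad f))))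
      = (\<Sum>j\<in>UNIV. lin_ext (\<lambda>i. ?g i j) (grad (g * partial j f)))"
      by (simp add: lin_ext_UNIV[of _ "grad f"] scale.scale_sum_right coord_d_sum coord_form_def lin_ext_sum)
        (simp add: scale_single coord_form_coord_d_single mult.assoc flip: coord_form_def)
    also have "\<dots> = scale g (\<Sum>j\<in>UNIV. lin_ext (\<lambda>i. ?g i j) (grad (partial j f)))
        + (\<Sum>j\<in>UNIV. scale (partial j f) (lin_ext (\<lambda>i. ?g i j) (grad g)))"
      by (simp add: grad_mult lin_ext_add lin_ext_scale sum.distrib scale.scale_sum_right)
    \<comment> \<open>Interchanging the sums gathers df in the inner slot, while the new factor at
      the head runs through dg.\<close>
    also have "(\<Sum>j\<in>UNIV. scale (partial j f) (lin_ext (\<lambda>i. ?g i j) (grad g)))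
        = (\<Sum>i\<in>UNIV. scale (partial i g) (lin_ext (\<lambda>j. ?g i j) (grad f)))"
      unfolding lin_ext_UNIV scale.scale_sum_right
      by (subst sum.swap) (simp add: scale_single mult.commute)
    also have "(\<Sum>j\<in>UNIV. lin_ext (\<lambda>i. ?g i j) (grad (partial j f)))
        = (\<Sum>i\<in>UNIV. \<Sum>j\<in>UNIV. scale (partial i (partial j f)) (?g i j))"
      unfolding lin_ext_UNIV by (subst sum.swap) simp
    also have "scale g \<dots> + (\<Sum>i\<in>UNIV. scale (partial i g) (lin_ext (\<lambda>j. ?g i j) (grad f))) \<in> form_ker k (Suc m)"
    proof -
      have "(\<Sum>i\<in>UNIV. \<Sum>j\<in>UNIV. scale (partial i (partial j f)) (?g i j)) \<in> form_ker k (Suc m)"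
        by (rule form_ker_sym[of "[]", unfolded append_Nil]) (auto intro: partial_comm)
      moreover have "lin_ext (\<lambda>j. ?g i j) (grad f) \<in> form_ker k (Suc m)" for i
        using form_ker_slot_zero[of "dx k i # map (dx k) l" k "map (dx k) r" "grad f" "Suc m"]
          dx_comb_grad_zero[OF f] by auto
      ultimately show ?thesis
        by (rule om.ext.ker_closed(2)[OF om.ext.ker_closed(5) om.ext.ker_closed(6)[OF om.ext.ker_closed(5)]])
    qed
    finally show ?thesis .
  qed
  then show ?thesis by (auto simp: d_null1_def d_null_def)
qed

lemma d_null1_grad_cong:
  assumes "residue k f = residue k g"
  shows "grad f - grad g \<in> d_null1 k m"
  using d_null1_grad[of k "f - g" m] assms by (simp add: grad_diff flip: tr.res_eq_iff)

text \<open>A relation between the dx_j is one between the symbols db for all b in S. Replacing db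
  by the gradient of a lift of b respects the sum and Leibniz rules up to gradients of elements of
  q^k, which \<open>d_null1\<close> absorbs.\<close>

lemma dx_comb_zero_d_null1:
  fixes a :: "'n::finite \<Rightarrow>\<^sub>0 ('a::field, 'n) mpoly"
  assumes "dx_comb k a = \<zero>\<^bsub>kdiffs k\<^esub>"
  shows "a \<in> d_null1 k m"
proof -
  define G :: "(('a, 'n) trunc \<Rightarrow>\<^sub>0 ('a, 'n) mpoly) \<Rightarrow> 'n \<Rightarrow>\<^sub>0 ('a, 'n) mpoly" where "G = lin_ext (\<lambda>b. if b \<in> carrier (trunc_ring k) then grad (tr.rep k b) else 0)"
  have G_res: "G (gen (residue k f)) - grad f \<in> d_null1 k m" for f
    by (simp add: G_def d_null1_grad_cong)
  have sub: "scale.subspace {c. G c \<in> d_null1 k m}"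
    unfolding G_def by (rule subspace_vimage_lin_ext[OF d_null1_subspace])
  note N = scale.subspace_add[OF d_null1_subspace] scale.subspace_diff[OF d_null1_subspace] scale.subspace_scale[OF d_null1_subspace]
  have "kd.ker k \<subseteq> {c. G c \<in> d_null1 k m}"
  proof (rule kd.ker_min[OF sub])
    fix c :: "('a, 'n) trunc \<Rightarrow>\<^sub>0 ('a, 'n) mpoly"
    assume "c \<in> tr.kaehler_relators k (trunc_scalars k)"
    then consider f g where "c = gen (residue k (f + g)) - (gen (residue k f) + gen (residue k g))"
      | f g where "c = gen (residue k (f * g)) - (scale f (gen (residue k g)) + scale g (gen (residue k f)))"
      | a where "c = gen (residue k (mpoly_const a))"
      unfolding tr.kaehler_relators_def trunc_scalars_def
      by (auto simp del: scale_gen dest!: tr.res_surj simp flip: tr.res_add)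
    then have "G c \<in> d_null1 k m"
    proof cases
      case 1
      have "G c = (G (gen (residue k (f + g))) - grad (f + g))
        - (G (gen (residue k f)) - grad f) - (G (gen (residue k g)) - grad g)"
        unfolding 1 by (simp add: G_def lin_ext_diff lin_ext_add grad_add)
      also have "\<dots> \<in> d_null1 k m" by (intro N G_res)
      finally show ?thesis .
    next
      case 2
      have "G c = (G (gen (residue k (f * g))) - grad (f * g))
        - scale f (G (gen (residue k g)) - grad g) - scale g (G (gen (residue k f)) - grad f)"
        unfolding 2
        by (simp add: G_def lin_ext_diff lin_ext_add lin_ext_scale grad_mult scale.scale_right_diff_distrib del: scale_gen)
      also have "\<dots> \<in> d_null1 k m" by (intro N G_res)
      finally show ?thesis .
    next
      case 3
      then show ?thesis using G_res[of "mpoly_const a"] by simp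
    qed
    then show "c \<in> {c. G c \<in> d_null1 k m}" by simp
  qed (auto simp: G_def lin_ext_scale d_null1_res scale.subspace_0[OF d_null1_subspace] simp del: scale_gen)
  moreover have "lin_ext (\<lambda>j. gen (var_res k j)) a \<in> kd.ker k"
    using assms by (simp add: dx_comb_def kd.ker_def)
  ultimately have 1: "G (lin_ext (\<lambda>j. gen (var_res k j)) a) \<in> d_null1 k m" by blast
  \<comment> \<open>On the symbols of the variables the substitution \<open>G\<close> yields unit
    vectors up to \<open>d_null1\<close>, so it gives back \<open>a\<close> itself.\<close>
  have "lin_ext (\<lambda>j. G (gen (var_res k j)) - gen j) a \<in> d_null1 k m"
    by (rule lin_ext_mem[OF d_null1_subspace]) (use G_res[of "mpoly_var _"] in \<open>simp add: var_res_def grad_var\<close>)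
  moreover have "G (lin_ext (\<lambda>j. gen (var_res k j)) a) = lin_ext (\<lambda>j. G (gen (var_res k j))) a"
    unfolding G_def by (rule lin_ext_lin_ext)
  ultimately have "G (lin_ext (\<lambda>j. gen (var_res k j)) a) - a \<in> d_null1 k m"
    by (simp add: lin_ext_fun_diff)
  from N(2)[OF 1 this] show ?thesis by simp
qed

section \<open>Tensors of coordinate vectors and the descent of the derivative\<close>

primrec tensor :: "('n \<Rightarrow>\<^sub>0 'p) list \<Rightarrow> ('n list \<Rightarrow>\<^sub>0 'p::comm_ring_1)" where
  "tensor [] = gen []"
| "tensor (a # as) = lin_ext (\<lambda>j. lin_ext (\<lambda>js. gen (j # js)) (tensor as)) a"

text \<open>Isolates one factor between lists taken from the others. This shows linearity in that
  factor and is the form in which \<open>d_null1\<close> applies.\<close>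

lemma tensor_slot:
  "tensor (us @ a # vs) = lin_ext (\<lambda>l. lin_ext (\<lambda>r. lin_ext (\<lambda>j. gen (l @ j # r)) a) (tensor vs)) (tensor us)"
  by (induction us) (simp_all add: lin_ext_lin_ext, rule lin_ext_swap)

lemma tensor_diff: "tensor (us @ (a - b) # vs) = tensor (us @ a # vs) - tensor (us @ b # vs)"
  by (simp add: tensor_slot lin_ext_diff lin_ext_fun_diff)

lemma tensor_add: "tensor (us @ (a + b) # vs) = tensor (us @ a # vs) + tensor (us @ b # vs)"
  using tensor_diff[of us "a + b" b vs] by simp

lemma tensor_scale: "tensor (us @ scale f a # vs) = scale f (tensor (us @ a # vs))"
  by (simp add: tensor_slot lin_ext_scale lin_ext_fun_scale)

lemma tensor_gen: "tensor (map gen js) = gen js"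
  by (induction js) simp_all

lemma tensor_d_null1: "a \<in> d_null1 k m \<Longrightarrow> tensor (us @ a # vs) \<in> d_null k m"
  unfolding tensor_slot by (rule lin_ext_mem[OF d_null_subspace], rule lin_ext_mem[OF d_null_subspace]) (auto simp: d_null1_def)

text \<open>The coefficient of dx_i and dx_j in the two equal slots is a_i a_j. It stays symmetric
  after multiplication by \<open>g\<close> and after a partial derivative, so
  \<open>form_ker_sym\<close> applies for each new factor dx_h.\<close>

lemma tensor_alt: "tensor (us @ a # vs @ a # zs) \<in> d_null k m"
proof -
  have *: "lin_ext (\<lambda>i. lin_ext (\<lambda>j. gen (l @ j # l' @ i # r)) a) a \<in> d_null k m" for l l' r
  proof -
    have "coord_form k (coord_d (scale g (lin_ext (\<lambda>i. lin_ext (\<lambda>j. gen (l @ j # l' @ i # r)) a) a))) \<in> form_ker k (Suc m)" for g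
    proof -
      let ?g = "\<lambda>h j i. gen (dx k h # map (dx k) l @ dx k j # map (dx k) l' @ dx k i # map (dx k) r)"
      let ?s = "\<lambda>i j. g * (lookup a i * lookup a j)"
      have "coord_form k (coord_d (scale g (lin_ext (\<lambda>i. lin_ext (\<lambda>j. gen (l @ j # l' @ i # r)) a) a)))
        = (\<Sum>i\<in>UNIV. \<Sum>j\<in>UNIV. lin_ext (\<lambda>h. ?g h j i) (grad (?s i j)))"
        by (simp add: lin_ext_UNIV[of _ a] scale.scale_sum_right coord_d_sum coord_form_def lin_ext_sum)
          (simp add: scale_single coord_form_coord_d_single mult.assoc flip: coord_form_def)
      also have "\<dots> = (\<Sum>h\<in>UNIV. \<Sum>j\<in>UNIV. \<Sum>i\<in>UNIV. scale (partial h (?s i j)) (?g h j i))"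
        unfolding lin_ext_UNIV lookup_grad
        by (subst (2) sum.swap, subst sum.swap, subst (2) sum.swap) (rule refl)
      also have "\<dots> \<in> form_ker k (Suc m)"
      proof (rule om.ext.ker_closed(6))
        fix h
        have "(\<Sum>j\<in>UNIV. \<Sum>i\<in>UNIV. scale (partial h (?s i j))
            (gen ((dx k h # map (dx k) l) @ dx k j # map (dx k) l' @ dx k i # map (dx k) r))) \<in> form_ker k (Suc m)"
          by (rule form_ker_sym) (auto simp: mult.commute)
        then show "(\<Sum>j\<in>UNIV. \<Sum>i\<in>UNIV. scale (partial h (?s i j)) (?g h j i)) \<in> form_ker k (Suc m)"
          unfolding append_Cons .
      qed
      finally show ?thesis .
    qed
    then show ?thesis by (auto simp: d_null_def)
  qed
  show ?thesis
    unfolding tensor_slot[of us] tensor_slot[of vs] lin_ext_lin_ext lin_ext_gen append_assoc append_Cons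
    by (rule lin_ext_mem[OF d_null_subspace], rule lin_ext_mem[OF d_null_subspace], rule lin_ext_mem[OF d_null_subspace])
      (rule *)
qed

text \<open>One factor is replaced at a time; \<open>us\<close> collects those already
  replaced.\<close>

lemma tensor_cong:
  assumes "\<And>j. f j - g j \<in> d_null1 k m"
  shows "tensor (us @ map f js) - tensor (us @ map g js) \<in> d_null k m"
proof (induction js arbitrary: us)
  case Nil
  then show ?case by (simp add: scale.subspace_0[OF d_null_subspace])
next
  case (Cons j js)
  have "tensor (us @ f j # map f js) - tensor (us @ g j # map f js) \<in> d_null k m"
    using tensor_d_null1[OF assms[of j], of us "map f js"] by (simp add: tensor_diff)
  from scale.subspace_add[OF d_null_subspace this Cons[of "us @ [g j]"]] show ?case by simp
qed

text \<open>\<open>G\<close> writes wedges of one-forms in the chosen coordinates. It carries the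
  relators of the exterior power into \<open>d_null\<close> and undoes \<open>coord_form\<close> up
  to \<open>d_null\<close>, so a family that represents zero is itself in
  \<open>d_null\<close>.\<close>

lemma coord_form_ker_d_null:
  fixes \<omega> :: "'n::finite list \<Rightarrow>\<^sub>0 ('a::field, 'n) mpoly"
  assumes "coord_form k \<omega> \<in> form_ker k m"
  shows "\<omega> \<in> d_null k m"
proof -
  define G :: "(('a, 'n) diff1 list \<Rightarrow>\<^sub>0 ('a, 'n) mpoly) \<Rightarrow> 'n list \<Rightarrow>\<^sub>0 ('a, 'n) mpoly"
    where "G = lin_ext (\<lambda>ws. if ws \<in> tuples (kdiffs k) m then tensor (map (dx_coords k) ws) else 0)"
  \<comment> \<open>The coordinates chosen for dx_j may differ from the unit vector, but only by a
    relation.\<close>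
  have dx_coords_dx: "dx_coords k (dx k j) - gen j \<in> d_null1 k m" for j
    by (rule dx_comb_zero_d_null1, rule dx_comb_diff) (simp add: dx_comb_gen dx_comb_dx_coords)
  have "form_ker k m \<subseteq> {c. G c \<in> d_null k m}"
  proof (rule om.ext.ker_min)
    show "scale.subspace {c. G c \<in> d_null k m}"
      unfolding G_def by (rule subspace_vimage_lin_ext[OF d_null_subspace])
  next
    fix c :: "('a, 'n) diff1 list \<Rightarrow>\<^sub>0 ('a, 'n) mpoly"
    assume "c \<in> om.ext_relators k m"
    then consider us x y vs where "us @ x # vs \<in> tuples (kdiffs k) m" "y \<in> carrier (kdiffs k)"
        "c = gen (us @ (x \<oplus>\<^bsub>kdiffs k\<^esub> y) # vs) - (gen (us @ x # vs) + gen (us @ y # vs))"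
      | us x f vs where "us @ x # vs \<in> tuples (kdiffs k) m"
        "c = gen (us @ (residue k f \<odot>\<^bsub>kdiffs k\<^esub> x) # vs) - scale f (gen (us @ x # vs))"
      | us x vs zs where "us @ x # vs @ x # zs \<in> tuples (kdiffs k) m" "c = gen (us @ x # vs @ x # zs)"
      unfolding om.ext_relators_def by (auto simp del: scale_gen)
    then show "c \<in> {c. G c \<in> d_null k m}"
    proof cases
      case 1
      let ?s = "x \<oplus>\<^bsub>kdiffs k\<^esub> y"
      have x: "x \<in> carrier (kdiffs k)" using 1(1) by (auto simp: tuples_def)
      then have s: "?s \<in> carrier (kdiffs k)" using 1(2) by (rule kd.M.a_closed)
      have t: "us @ z # vs \<in> tuples (kdiffs k) m" if "z \<in> carrier (kdiffs k)" for z
        using 1(1) that by (auto simp: tuples_def)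
      have "dx_coords k ?s - dx_coords k x - dx_coords k y \<in> d_null1 k m"
      proof -
        have "dx_comb k (dx_coords k ?s - (dx_coords k x + dx_coords k y)) = \<zero>\<^bsub>kdiffs k\<^esub>"
          by (rule dx_comb_diff) (simp add: dx_comb_add dx_comb_dx_coords x s 1(2))
        from dx_comb_zero_d_null1[OF this] show ?thesis by (simp add: diff_diff_eq)
      qed
      from tensor_d_null1[OF this, of "map (dx_coords k) us" "map (dx_coords k) vs"] show ?thesis
        using t[OF x] t[OF s] t[OF 1(2)]
        by (simp add: 1(3) G_def lin_ext_diff lin_ext_add tensor_diff tensor_add diff_diff_eq)
    next
      case 2
      let ?s = "residue k f \<odot>\<^bsub>kdiffs k\<^esub> x"
      have x: "x \<in> carrier (kdiffs k)" using 2(1) by (auto simp: tuples_def)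
      then have s: "?s \<in> carrier (kdiffs k)" by (intro om.M_smult) auto
      have t: "us @ z # vs \<in> tuples (kdiffs k) m" if "z \<in> carrier (kdiffs k)" for z
        using 2(1) that by (auto simp: tuples_def)
      have "dx_coords k ?s - scale f (dx_coords k x) \<in> d_null1 k m"
        by (rule dx_comb_zero_d_null1, rule dx_comb_diff) (simp add: dx_comb_scale dx_comb_dx_coords x s)
      from tensor_d_null1[OF this, of "map (dx_coords k) us" "map (dx_coords k) vs"] show ?thesis
        using t[OF x] t[OF s]
        by (simp add: 2(2) G_def lin_ext_diff lin_ext_scale tensor_diff tensor_scale del: scale_gen)
    next
      case 3
      then show ?thesis using tensor_alt[of "map (dx_coords k) us" "dx_coords k x" "map (dx_coords k) vs"]
        by (simp add: G_def)
    qed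
  qed (auto simp: G_def lin_ext_scale d_null_res scale.subspace_0[OF d_null_subspace] simp del: scale_gen)
  with assms have 1: "G (coord_form k \<omega>) \<in> d_null k m" by blast
  have "lin_ext (\<lambda>js. G (gen (map (dx k) js)) - gen js) \<omega> \<in> d_null k m"
  proof (rule lin_ext_mem[OF d_null_subspace])
    fix js :: "'n list"
    show "G (gen (map (dx k) js)) - gen js \<in> d_null k m"
    proof (cases "length js = m")
      case True
      then have "(map (dx k) js :: ('a, 'n) diff1 list) \<in> tuples (kdiffs k) m" by (auto simp: tuples_def)
      then show ?thesis
        using tensor_cong[of "\<lambda>j. dx_coords k (dx k j)" gen k m "[]" js, OF dx_coords_dx]
        by (simp add: G_def tensor_gen comp_def)
    next
      case False
      \<comment> \<open>For a list of the wrong length, the derivative has the wrong length as well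
        and thus lies in the kernel.\<close>
      have "gen js \<in> d_null k m"
        unfolding d_null_def
      proof safe
        fix g
        have "lin_ext (\<lambda>h. gen (dx k h # map (dx k) js)) (grad g) \<in> form_ker k (Suc m)"
          by (rule lin_ext_mem[OF om.ext.ker_subspace], rule om.ext.ker_outside)
            (use False in \<open>auto simp: tuples_def\<close>)
        then show "coord_form k (coord_d (scale g (gen js))) \<in> form_ker k (Suc m)"
          by (simp add: coord_form_coord_d_single)
      qed
      moreover have "G (gen (map (dx k) js)) = 0"
        using False by (simp add: G_def tuples_def)
      ultimately show ?thesis
        using scale.subspace_neg[OF d_null_subspace] by simp
    qed
  qed
  moreover have "G (coord_form k \<omega>) = lin_ext (\<lambda>js. G (gen (map (dx k) js))) \<omega>"
    unfolding G_def coord_form_def by (rule lin_ext_lin_ext)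
  ultimately have "G (coord_form k \<omega>) - \<omega> \<in> d_null k m"
    by (simp add: lin_ext_fun_diff)
  from scale.subspace_diff[OF d_null_subspace 1 this] show ?thesis by simp
qed

text \<open>The multiple by 1 in \<open>d_null\<close>. With this, the exterior derivative descends
  to forms over S.\<close>

lemma coord_form_coord_d_ker: "coord_form k \<omega> \<in> form_ker k m \<Longrightarrow> coord_form k (coord_d \<omega>) \<in> form_ker k (Suc m)"
  using coord_form_ker_d_null[of k \<omega> m] by (auto simp: d_null_def dest: spec[of _ 1])


section \<open>Cartan's formula\<close>

text \<open>Contraction with the variables themselves as coefficients, instead of the lifts
  \<open>euler_coef k (dx k j)\<close>, so that Cartan's formula becomes a calculation with
  polynomials.\<close>

definition coord_contr :: "('n list \<Rightarrow>\<^sub>0 ('a, 'n) mpoly) \<Rightarrow> ('n list \<Rightarrow>\<^sub>0 ('a::field, 'n::finite) mpoly)" where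
  "coord_contr = lin_ext (koszul mpoly_var gen)"

lemma coord_contr_single: "coord_contr (Poly_Mapping.single js f) = scale f (koszul mpoly_var gen js)"
  unfolding coord_contr_def by (subst scale_gen[symmetric], subst lin_ext_scale) simp

lemma koszul_map: "koszul e \<phi> (map f ws) = koszul (\<lambda>w. e (f w)) (\<lambda>l. \<phi> (map f l)) ws"
  by (induction ws arbitrary: \<phi>) (simp_all add: koszul_Cons)

lemma koszul_coef_diff: "koszul (\<lambda>w. e w - e' w) \<phi> ws = koszul e \<phi> ws - koszul e' \<phi> ws"
  by (induction ws arbitrary: \<phi>) (simp_all add: koszul_Cons scale.scale_left_diff_distrib algebra_simps)

lemma koszul_coef_mem:
  assumes "scale.subspace W" "\<And>w v. scale (e w) v \<in> W"
  shows "koszul e \<phi> ws \<in> W"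
  by (induction ws arbitrary: \<phi>)
    (auto simp: koszul_Cons intro: scale.subspace_0[OF assms(1)] scale.subspace_diff[OF assms(1)] assms(2))

text \<open>The coefficients \<open>euler_coef k (dx k j)\<close> and x_j agree modulo q^k, and a
  multiple by an element of q^k is in the kernel.\<close>

lemma coord_form_coord_contr:
  fixes \<omega> :: "'n::finite list \<Rightarrow>\<^sub>0 ('a::field, 'n) mpoly"
  shows "om.contr_rep k (Suc m) (coord_form k \<omega>) - coord_form k (coord_contr \<omega>) \<in> form_ker k m"
proof -
  let ?\<phi> = "\<lambda>l. gen (map (dx k) l) :: ('a, 'n) diff1 list \<Rightarrow>\<^sub>0 ('a, 'n) mpoly"
  have "om.contr_rep k (Suc m) (?\<phi> js) - coord_form k (koszul mpoly_var gen js) \<in> form_ker k m" for js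
  proof -
    have s: "coord_form k (koszul mpoly_var gen js) = koszul mpoly_var ?\<phi> js"
      by (simp add: coord_form_def lin_ext_koszul)
    show ?thesis
    proof (cases "length js = Suc m")
      case True
      then have "om.contr_rep k (Suc m) (?\<phi> js) = koszul (\<lambda>j. euler_coef k (dx k j)) ?\<phi> js"
        by (subst om.contr_rep_gen) (auto simp: tuples_def koszul_map)
      moreover have "koszul (\<lambda>j. euler_coef k (dx k j) - mpoly_var j) ?\<phi> js \<in> form_ker k m"
        by (intro koszul_coef_mem om.ext.ker_subspace om.ext.ker_res)
          (simp add: residue_euler_coef_dx var_res_def flip: tr.res_eq_iff)
      ultimately show ?thesis by (simp add: s koszul_coef_diff)
    next
      case False
      then have "om.contr_rep k (Suc m) (?\<phi> js) = 0"
        by (simp add: om.contr_rep_def tuples_def)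
      moreover have "koszul mpoly_var ?\<phi> js \<in> form_ker k m"
        by (rule koszul_mem[OF om.ext.ker_subspace], rule om.ext.ker_outside)
          (use False in \<open>auto simp: tuples_def\<close>)
      ultimately show ?thesis by (simp add: s om.ext.ker_closed)
    qed
  qed
  then have "lin_ext (\<lambda>js. om.contr_rep k (Suc m) (?\<phi> js) - coord_form k (koszul mpoly_var gen js)) \<omega> \<in> form_ker k m"
    by (intro lin_ext_mem om.ext.ker_subspace)
  moreover have "om.contr_rep k (Suc m) (coord_form k \<omega>) = lin_ext (\<lambda>js. om.contr_rep k (Suc m) (?\<phi> js)) \<omega>"
    unfolding om.contr_rep_def coord_form_def by (rule lin_ext_lin_ext)
  moreover have "coord_form k (coord_contr \<omega>) = lin_ext (\<lambda>js. coord_form k (koszul mpoly_var gen js)) \<omega>"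
    unfolding coord_contr_def coord_form_def by (rule lin_ext_lin_ext)
  ultimately show ?thesis by (simp add: lin_ext_fun_diff)
qed

lemma grad_minus_one_power [simp]: "grad ((- 1) ^ r) = 0"
  by (rule poly_mapping_eqI) simp

abbreviation omit_nth :: "nat \<Rightarrow> 'b list \<Rightarrow> 'b list" where
  "omit_nth r js \<equiv> take r js @ drop (Suc r) js"

text \<open>Contracting the new factor at the head produces the Euler operator. Contracting the old
  factors produces the sum, which recurs with the opposite sign in
  \<open>coord_d_coord_contr_single\<close>.\<close>

lemma coord_contr_coord_d_single:
  "coord_contr (coord_d (Poly_Mapping.single js f)) = Poly_Mapping.single js (euler_op f)
    - (\<Sum>r<length js. scale ((- 1) ^ r * mpoly_var (js ! r)) (lin_ext (\<lambda>h. gen (h # omit_nth r js)) (grad f)))"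
proof -
  have "coord_contr (coord_d (Poly_Mapping.single js f)) = lin_ext (\<lambda>h. koszul mpoly_var gen (h # js)) (grad f)"
    by (simp add: coord_contr_def coord_d_single lin_ext_lin_ext)
  also have "\<dots> = lin_ext (\<lambda>h. scale (mpoly_var h) (gen js)) (grad f) - lin_ext (\<lambda>h. koszul mpoly_var (\<lambda>l. gen (h # l)) js) (grad f)"
    by (simp only: koszul_Cons lin_ext_fun_diff)
  also have "lin_ext (\<lambda>h. scale (mpoly_var h) (gen js)) (grad f) = Poly_Mapping.single js (euler_op f)"
    unfolding lin_ext_UNIV scale.scale_scale lookup_grad scale.scale_sum_left[symmetric]
    by (simp add: euler_op_def mult.commute)
  also have "lin_ext (\<lambda>h. koszul mpoly_var (\<lambda>l. gen (h # l)) js) (grad f)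
      = (\<Sum>r<length js. scale ((- 1) ^ r * mpoly_var (js ! r)) (lin_ext (\<lambda>h. gen (h # omit_nth r js)) (grad f)))"
    unfolding lin_ext_UNIV koszul_sum scale.scale_sum_right
    by (subst sum.swap) (simp add: scale_single mult_ac)
  finally show ?thesis .
qed

lemma coord_d_coord_contr_single:
  "coord_d (coord_contr (Poly_Mapping.single js f))
    = (\<Sum>r<length js. scale ((- 1) ^ r * mpoly_var (js ! r)) (lin_ext (\<lambda>h. gen (h # omit_nth r js)) (grad f)))
      + (\<Sum>r<length js. scale (f * (- 1) ^ r) (gen (js ! r # omit_nth r js)))"
proof -
  have g: "grad (f * ((- 1) ^ r * mpoly_var (js ! r)))
      = scale ((- 1) ^ r * mpoly_var (js ! r)) (grad f) + scale (f * (- 1) ^ r) (gen (js ! r))" for r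
    by (simp only: grad_mult grad_minus_one_power grad_var scale.scale_zero_right scale.scale_scale add_0_right)
      (simp add: add.commute)
  have "coord_d (coord_contr (Poly_Mapping.single js f)) = (\<Sum>r<length js. lin_ext (\<lambda>h. gen (h # omit_nth r js)) (grad (f * ((- 1) ^ r * mpoly_var (js ! r)))))"
    by (simp add: coord_contr_single koszul_sum scale.scale_sum_right coord_d_sum) (simp add: scale_single coord_d_single)
  then show ?thesis
    by (simp only: g lin_ext_add lin_ext_scale lin_ext_gen sum.distrib)
qed

section \<open>Homogeneous families, Cartan's formula and the homotopy\<close>

definition coord_comp :: "nat \<Rightarrow> nat \<Rightarrow> ('n list \<Rightarrow>\<^sub>0 ('a::field, 'n::finite) mpoly) set" where
  "coord_comp m i = {\<omega>. \<forall>js\<in>keys \<omega>. length js = m \<and> lookup \<omega> js \<in> hcoef m i}"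

lemma single_of_nat_mult:
  "Poly_Mapping.single b (of_nat m * f) = (\<Sum>r<m. Poly_Mapping.single b (f :: 'p::comm_semiring_1))"
  by (induction m) (simp_all add: single_add distrib_right add.commute)

text \<open>After the cancellation there remain, besides the Euler operator, the \<open>m\<close>
  terms in which d hits a variable produced by the contraction. Moving the new factor back to its
  old place turns each of them into f dx_J, and \<open>euler_op_hcoef\<close> evaluates the total as
  i f dx_J.\<close>

lemma cartan_single:
  fixes f :: "('a::field, 'n::finite) mpoly"
  assumes f: "f \<in> hcoef m i" and js: "length js = m"
  defines "\<omega> \<equiv> Poly_Mapping.single js f"
  shows "coord_form k (coord_contr (coord_d \<omega>)) + coord_form k (coord_d (coord_contr \<omega>)) - scale (of_nat i) (coord_form k \<omega>) \<in> form_ker k m"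
proof -
  let ?x = "dx k :: 'n \<Rightarrow> ('a, 'n) diff1"
  let ?d = "\<lambda>r. scale ((- 1) ^ r) (gen (?x (js ! r) # map ?x (omit_nth r js)))"
  have th: "of_nat i * f = euler_op f + of_nat m * f" using euler_op_hcoef[OF f] by simp
  have move: "gen (map ?x js) - ?d r \<in> form_ker k m" if r: "r < m" for r
  proof -
    have "gen ([] @ map ?x (take r js) @ ?x (js ! r) # map ?x (drop (Suc r) js))
      - scale ((- 1) ^ length (map ?x (take r js)))
          (gen ([] @ ?x (js ! r) # map ?x (take r js) @ map ?x (drop (Suc r) js))) \<in> form_ker k m"
      by (rule om.wker_move[where us = "[]" and x = "?x (js ! r)" and vs = "map ?x (take r js)"
            and zs = "map ?x (drop (Suc r) js)"])
        (use r js in \<open>auto simp: tuples_def dest!: in_set_takeD in_set_dropD\<close>)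
    moreover have "map ?x (take r js) @ ?x (js ! r) # map ?x (drop (Suc r) js) = map ?x js"
      using id_take_nth_drop[of r js] r js by (metis list.simps(9) map_append)
    ultimately show ?thesis using r js by (simp add: min_def)
  qed
  have "coord_form k (coord_contr (coord_d \<omega>)) + coord_form k (coord_d (coord_contr \<omega>)) - scale (of_nat i) (coord_form k \<omega>)
    = coord_form k (coord_contr (coord_d \<omega>) + coord_d (coord_contr \<omega>) - scale (of_nat i) \<omega>)"
    by (simp add: coord_form_def lin_ext_add lin_ext_diff lin_ext_scale)
  also have "coord_contr (coord_d \<omega>) + coord_d (coord_contr \<omega>) - scale (of_nat i) \<omega>
    = (\<Sum>r<length js. scale (f * (- 1) ^ r) (gen (js ! r # omit_nth r js))) - scale (of_nat m * f) (gen js)"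
    unfolding \<omega>_def coord_contr_coord_d_single coord_d_coord_contr_single scale_single th by (simp add: single_add algebra_simps)
  also have "\<dots> = - (\<Sum>r<m. scale f (gen js - scale ((- 1) ^ r) (gen (js ! r # omit_nth r js))))"
    by (simp add: js scale.scale_right_diff_distrib sum_subtractf scale_single single_of_nat_mult)
  also have "coord_form k \<dots> = - (\<Sum>r<m. scale f (gen (map (dx k) js) - ?d r))"
    by (simp add: coord_form_def lin_ext_uminus lin_ext_sum lin_ext_scale lin_ext_diff del: scale_gen)
  also have "\<dots> \<in> form_ker k m"
    by (rule om.ext.ker_closed(4)[OF om.ext.ker_closed(6)[OF om.ext.ker_closed(5)]]) (use move in auto)
  finally show ?thesis .
qed

lemma coord_comp_single: "length js = m \<Longrightarrow> f \<in> hcoef m i \<Longrightarrow> Poly_Mapping.single js f \<in> coord_comp m i"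
  by (auto simp: coord_comp_def lookup_single when_def)

lemma coord_comp_zero [simp]: "0 \<in> coord_comp m i"
  by (simp add: coord_comp_def)

lemma coord_comp_add: "\<omega> \<in> coord_comp m i \<Longrightarrow> \<eta> \<in> coord_comp m i \<Longrightarrow> \<omega> + \<eta> \<in> coord_comp m i"
  unfolding coord_comp_def using keys_add[of \<omega> \<eta>]
  by (auto simp: lookup_add in_keys_iff intro!: hcoef_add)

lemma coord_comp_uminus: "\<omega> \<in> coord_comp m i \<Longrightarrow> - \<omega> \<in> coord_comp m i"
  by (auto simp: coord_comp_def in_keys_iff hcoef_uminus)

lemma coord_comp_const: "\<omega> \<in> coord_comp m i \<Longrightarrow> scale (mpoly_const c) \<omega> \<in> coord_comp m i"
proof -
  have "keys (scale (mpoly_const c) \<omega>) \<subseteq> keys \<omega>" by (auto simp: in_keys_iff)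
  then show "\<omega> \<in> coord_comp m i \<Longrightarrow> scale (mpoly_const c) \<omega> \<in> coord_comp m i"
    by (auto simp: coord_comp_def intro!: hcoef_const)
qed

lemma coord_comp_sum: "(\<And>x. x \<in> A \<Longrightarrow> f x \<in> coord_comp m i) \<Longrightarrow> sum f A \<in> coord_comp m i"
  by (induction A rule: infinite_finite_induct) (auto simp: coord_comp_add)

lemma coord_comp_induct [consumes 1, case_names zero single add]:
  assumes "\<omega> \<in> coord_comp m i" "P 0"
    "\<And>js f. length js = m \<Longrightarrow> f \<in> hcoef m i \<Longrightarrow> P (Poly_Mapping.single js f)"
    "\<And>\<omega> \<eta>. P \<omega> \<Longrightarrow> P \<eta> \<Longrightarrow> P (\<omega> + \<eta>)"
  shows "P \<omega>"
proof -
  have "P (\<Sum>b\<in>A. Poly_Mapping.single b (lookup \<omega> b))" if "A \<subseteq> keys \<omega>" for A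
    using finite_subset[OF that finite_keys] that
    by induction (use assms in \<open>auto simp: coord_comp_def\<close>)
  from this[OF order_refl] show ?thesis by (simp add: sum_single)
qed

lemma coord_comp_coord_d:
  assumes "\<omega> \<in> coord_comp m i"
  shows "coord_d \<omega> \<in> coord_comp (Suc m) i"
  using assms
proof (induction rule: coord_comp_induct)
  case (single js f)
  then show ?case
    unfolding coord_d_single lin_ext_UNIV
    by (auto intro!: coord_comp_sum coord_comp_single hcoef_partial)
qed (auto simp: coord_d_add coord_comp_add)

lemma coord_comp_coord_contr:
  assumes "\<omega> \<in> coord_comp (Suc m) i"
  shows "coord_contr \<omega> \<in> coord_comp m i"
  using assms
proof (induction rule: coord_comp_induct)
  case (single js f)
  have "(- 1) ^ r * g \<in> hcoef m i" if "g \<in> hcoef m i" for r and g :: "('b, 'a) mpoly"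
    using that by (induction r) (auto simp: hcoef_uminus)
  note c = this[OF hcoef_var[OF single(2)]]
  show ?case
    unfolding coord_contr_single koszul_sum scale.scale_sum_right
  proof (rule coord_comp_sum)
    fix r assume "r \<in> {..<length js}"
    then have "length (omit_nth r js) = m" using single(1) by auto
    then show "scale f (scale ((- 1) ^ r * mpoly_var (js ! r)) (gen (omit_nth r js))) \<in> coord_comp m i"
      using coord_comp_single[OF _ c[of r "js ! r"]] by (simp add: scale_single mult_ac)
  qed
qed (auto simp: coord_contr_def lin_ext_add coord_comp_add)

lemma cartan:
  assumes "\<omega> \<in> coord_comp m i"
  shows "coord_form k (coord_contr (coord_d \<omega>)) + coord_form k (coord_d (coord_contr \<omega>)) - scale (of_nat i) (coord_form k \<omega>) \<in> form_ker k m"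
  using assms
proof (induction rule: coord_comp_induct)
  case (add \<omega> \<eta>)
  from om.ext.ker_closed(2)[OF this] show ?case
    by (simp add: coord_d_add coord_contr_def coord_form_def lin_ext_add scale.scale_right_distrib algebra_simps)
next
  case (single js f)
  show ?case by (rule cartan_single[OF single(2,1)])
qed (simp add: coord_contr_def coord_form_def om.ext.ker_closed)

lemma of_nat_mpoly: "of_nat n = (mpoly_const (of_nat n) :: ('a::field, 'n::finite) mpoly)"
  by (simp add: mpoly_const_def)

lemma mpoly_const_inverse:
  assumes "of_nat i \<noteq> (0 :: 'a::field)"
  shows "mpoly_const (inverse (of_nat i)) * of_nat i = (1 :: ('a, 'n::finite) mpoly)"
  unfolding of_nat_mpoly mpoly_const_def mult_single using assms by simp

text \<open>The witness is d\<omega> divided by i. Contraction is linear, so Cartan's formula leaves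
  only the term that \<open>z\<close> puts in the kernel. With \<open>z\<close> in place of
  closedness of \<omega>, the lemma serves 0-forms as well.\<close>

lemma homotopy:
  fixes \<omega> :: "'n::finite list \<Rightarrow>\<^sub>0 ('a::field, 'n) mpoly"
  assumes \<omega>: "\<omega> \<in> coord_comp m i" and i: "of_nat i \<noteq> (0 :: 'a)"
    and z: "coord_form k (coord_d (coord_contr \<omega>)) \<in> form_ker k m"
  shows "\<exists>\<eta>\<in>coord_comp (Suc m) i. om.contr_rep k (Suc m) (coord_form k \<eta>) - coord_form k \<omega> \<in> form_ker k m"
proof
  let ?c = "mpoly_const (inverse (of_nat i)) :: ('a, 'n) mpoly"
  let ?\<eta> = "scale ?c (coord_d \<omega>)"
  show "?\<eta> \<in> coord_comp (Suc m) i" by (rule coord_comp_const[OF coord_comp_coord_d[OF \<omega>]])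
  have c: "?c * of_nat i = 1" by (rule mpoly_const_inverse[OF i])
  have "om.contr_rep k (Suc m) (coord_form k ?\<eta>) - coord_form k \<omega> = (om.contr_rep k (Suc m) (coord_form k ?\<eta>) - coord_form k (coord_contr ?\<eta>))
     + scale ?c ((coord_form k (coord_contr (coord_d \<omega>)) + coord_form k (coord_d (coord_contr \<omega>)) - scale (of_nat i) (coord_form k \<omega>)) - coord_form k (coord_d (coord_contr \<omega>)))"
    by (simp add: c coord_contr_def coord_form_def lin_ext_scale scale.scale_right_diff_distrib)
  also have "\<dots> \<in> form_ker k m"
    by (rule coord_form_coord_contr cartan[OF \<omega>] z om.ext.ker_closed(2,3,5))+
  finally show "om.contr_rep k (Suc m) (coord_form k ?\<eta>) - coord_form k \<omega> \<in> form_ker k m" .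
qed

text \<open>The contraction of \<omega> is a family that represents zero without having to be zero.
  This is where the descent of d to forms is needed.\<close>

lemma exact_coord:
  fixes \<omega> :: "'n::finite list \<Rightarrow>\<^sub>0 ('a::field, 'n) mpoly"
  assumes \<omega>: "\<omega> \<in> coord_comp (Suc m) i" and i: "of_nat i \<noteq> (0 :: 'a)"
    and z: "om.contr_rep k (Suc m) (coord_form k \<omega>) \<in> form_ker k m"
  shows "\<exists>\<eta>\<in>coord_comp (Suc (Suc m)) i. om.contr_rep k (Suc (Suc m)) (coord_form k \<eta>) - coord_form k \<omega> \<in> form_ker k (Suc m)"
proof (rule homotopy[OF \<omega> i])
  from om.ext.ker_closed(3)[OF z coord_form_coord_contr[of k m \<omega>]] have "coord_form k (coord_contr \<omega>) \<in> form_ker k m" by simp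
  then show "coord_form k (coord_d (coord_contr \<omega>)) \<in> form_ker k (Suc m)" by (rule coord_form_coord_d_ker)
qed

lemma coord_form_top:
  fixes \<omega> :: "'n::finite list \<Rightarrow>\<^sub>0 ('a::field, 'n) mpoly"
  assumes \<omega>: "\<omega> \<in> coord_comp m i" and m: "CARD('n) < m"
  shows "coord_form k \<omega> \<in> form_ker k m"
  unfolding coord_form_def
proof (rule lin_ext_mem[OF om.ext.ker_subspace])
  fix js assume "js \<in> keys \<omega>"
  then have l: "length js = m" using \<omega> by (auto simp: coord_comp_def)
  \<comment> \<open>Pigeonhole: the list is longer than the number of variables, so some dx_j is
    repeated.\<close>
  have "\<not> distinct js"
    using m l distinct_card[of js] card_mono[of UNIV "set js"] by auto
  then obtain us x vs zs where "js = us @ [x] @ vs @ [x] @ zs"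
    using not_distinct_decomp by blast
  then show "gen (map (dx k) js) \<in> form_ker k m"
    using om.wker_alt[of "map (dx k) us" "dx k x" "map (dx k) vs" "map (dx k) zs" k m] l
    by (auto simp: tuples_def)
qed


section \<open>Homogeneous components\<close>

lemma dforms_eq: "dforms k m = ext_power (trunc_ring k) (kdiffs k) m"
  by (simp add: dforms_def)

lemma trunc_comp_eq: "trunc_comp k d = residue k ` hcoef 0 d"
  by (simp add: trunc_comp_def mpoly_homog_eq)

lemma dform_gen_eq:
  fixes f :: "('a::field, 'n::finite) mpoly"
  assumes "length js = m"
  shows "residue k f \<odot>\<^bsub>dforms k m\<^esub> dwedge k (map (dx k) js) = om.ext_cl k m (coord_form k (Poly_Mapping.single js f))"
proof -
  have t: "(map (dx k) js :: ('a, 'n) diff1 list) \<in> tuples (kdiffs k) m"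
    using assms by (auto simp: tuples_def)
  have "coord_form k (Poly_Mapping.single js f) = scale f (gen (map (dx k) js))"
    unfolding coord_form_def by (subst scale_gen[symmetric], subst lin_ext_scale) simp
  then show ?thesis
    by (simp only: dforms_eq dwedge_def om.wedge_eq[OF t] om.ext.cl_scale)
qed

text \<open>Homogeneous families are closed under sums and negatives, so each element of the
  generated subgroup has one homogeneous representative, and homogeneous calculations can start from
  it.\<close>

lemma dforms_comp_eq:
  "(dforms_comp k m i :: ('a::field, 'n::finite) dform set) = (\<lambda>\<omega>. om.ext_cl k m (coord_form k \<omega>)) ` coord_comp m i"
proof -
  let ?G = "{s \<odot>\<^bsub>dforms k m\<^esub> dwedge k (map (\<lambda>j. diff_d k (residue k (mpoly_var j))) js) | s d js.
        length js = m \<and> s \<in> trunc_comp k d \<and> d + m = i} :: ('a, 'n) dform set"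
  have G: "?G = {om.ext_cl k m (coord_form k (Poly_Mapping.single js f)) | js f. length js = m \<and> f \<in> hcoef m i \<and> m \<le> i}"
  proof safe
    fix s :: "('a, 'n) trunc" and d and js :: "'n list" assume a: "s \<in> trunc_comp k d" "m = length js" "i = d + length js"
    then obtain f where "f \<in> hcoef 0 d" "s = residue k f" by (auto simp: trunc_comp_eq)
    then show "\<exists>js' f. s \<odot>\<^bsub>dforms k (length js)\<^esub> dwedge k (map (\<lambda>j. diff_d k (residue k (mpoly_var j))) js)
        = om.ext_cl k (length js) (coord_form k (Poly_Mapping.single js' f)) \<and> length js' = length js \<and>
          f \<in> hcoef (length js) (d + length js) \<and> length js \<le> d + length js"
      using dform_gen_eq[of js _ k f] hcoef_shift[of d "length js"]
      by (intro exI[of _ js] exI[of _ f]) (auto simp flip: dx_def)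
  next
    fix js :: "'n list" and f :: "('a, 'n) mpoly"
    assume "f \<in> hcoef (length js) i" "length js \<le> i"
    then show "\<exists>s d js'. om.ext_cl k (length js) (coord_form k (Poly_Mapping.single js f))
        = s \<odot>\<^bsub>dforms k (length js)\<^esub> dwedge k (map (\<lambda>j. diff_d k (residue k (mpoly_var j))) js') \<and>
          length js' = length js \<and> s \<in> trunc_comp k d \<and> d + length js = i"
      using dform_gen_eq[of js _ k f] hcoef_shift[of "i - length js" "length js" i]
      by (intro exI[of _ "residue k f"] exI[of _ "i - length js"] exI[of _ js])
        (auto simp: trunc_comp_eq simp flip: dx_def)
  qed
  have minus: "inv\<^bsub>add_monoid (dforms k m)\<^esub> om.ext_cl k m c = om.ext_cl k m (- c)" for c :: "('a, 'n) diff1 list \<Rightarrow>\<^sub>0 ('a, 'n) mpoly"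
    by (simp add: dforms_eq om.ext.cl_uminus a_inv_def)
  have sub: "om.ext_cl k m (coord_form k \<omega>) \<in> generate (add_monoid (dforms k m)) ?G" if "\<omega> \<in> coord_comp m i"
    for \<omega> :: "'n list \<Rightarrow>\<^sub>0 ('a, 'n) mpoly"
    using that
  proof (induction rule: coord_comp_induct)
    case zero
    show ?case
      using generate.one[of "add_monoid (dforms k m)"] by (simp add: coord_form_def dforms_eq om.ext.cl_zero)
  next
    case (single js f)
    show ?case
    \<comment> \<open>A nonzero \<open>f\<close> has a monomial, which forces
      \<open>m \<le> i\<close>. If \<open>m > i\<close> there are no generators, so zero has to come
      from the neutral element of the subgroup.\<close>
    proof (cases "f = 0")
      case True
      then show ?thesis
        using generate.one[of "add_monoid (dforms k m)"] by (simp add: coord_form_def dforms_eq om.ext.cl_zero)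
    next
      case False
      then have "m \<le> i" using single(2) by (auto simp: hcoef_def simp flip: keys_eq_empty)
      then show ?thesis unfolding G using single by (intro generate.incl) blast
    qed
  next
    case (add \<omega> \<eta>)
    from generate.eng[OF this] show ?case
      by (simp add: coord_form_def lin_ext_add dforms_eq om.ext.cl_add)
  qed
  have "w \<in> (\<lambda>\<omega>. om.ext_cl k m (coord_form k \<omega>)) ` coord_comp m i"
    if "w \<in> generate (add_monoid (dforms k m)) ?G" for w
    using that
  proof induction
    case one
    show ?case by (rule image_eqI[of _ _ 0]) (auto simp: coord_form_def dforms_eq om.ext.cl_zero)
  next
    case (incl h)
    then show ?case unfolding G by (auto intro: coord_comp_single)
  next
    case (inv h)
    then obtain js f where "h = om.ext_cl k m (coord_form k (Poly_Mapping.single js f))" "length js = m" "f \<in> hcoef m i"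
      unfolding G by blast
    then show ?case
      by (intro image_eqI[of _ _ "- Poly_Mapping.single js f"])
        (auto simp: minus coord_form_def lin_ext_uminus intro!: coord_comp_uminus coord_comp_single)
  next
    case (eng h1 h2)
    then obtain \<omega> \<eta> where "h1 = om.ext_cl k m (coord_form k \<omega>)" "\<omega> \<in> coord_comp m i" "h2 = om.ext_cl k m (coord_form k \<eta>)" "\<eta> \<in> coord_comp m i"
      by blast
    then show ?case
      by (intro image_eqI[of _ _ "\<omega> + \<eta>"])
        (auto simp: coord_form_def lin_ext_add dforms_eq om.ext.cl_add intro!: coord_comp_add)
  qed
  with sub show ?thesis unfolding dforms_comp_def by blast
qed


section \<open>The Koszul complex\<close>

lemma euler_map_props:
  "euler_map k (Suc m) \<in> mod_hom (trunc_ring k) (dforms k (Suc m)) (dforms k m)"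
  "ws \<in> tuples (kdiffs k) (Suc m) \<Longrightarrow>
    euler_map k (Suc m) (dwedge k ws) = contract_wedge (trunc_ring k) (kdiffs k) (euler_form k) ws"
  "euler_map k (Suc m) (om.ext_cl k (Suc m) c) = om.ext_cl k m (om.contr_rep k (Suc m) c)"
  unfolding euler_map_def dforms_eq dwedge_def
  by (rule om.contraction_props(1), simp add: residue_euler_coef)
    (rule om.contraction_props(2), simp_all add: residue_euler_coef om.contraction_props(3))

lemma euler_map1_props:
  "euler_map1 k \<in> mod_hom (trunc_ring k) (dforms k 1) (trunc_max k)"
  "w \<in> carrier (kdiffs k) \<Longrightarrow> euler_map1 k (dwedge k [w]) = euler_form k w"
  "euler_map1 k (om.ext_cl k (Suc 0) c) = residue k (lookup (om.contr_rep k (Suc 0) c) [])"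
proof -
  have e: "euler_form k w \<in> carrier (trunc_max k)" if "w \<in> carrier (kdiffs k)" for w
    using euler_form_props(1)[of k] that by (auto simp: mod_hom_def)
  note * = om.on_ext1_props[of "trunc_max k" k "euler_form k", OF trunc_max_closed(1) trunc_max_simps(2,3,4) trunc_max_closed(2-4)]
  show "euler_map1 k \<in> mod_hom (trunc_ring k) (dforms k 1) (trunc_max k)"
    unfolding euler_map1_def dforms_eq by (rule *(1)) (auto simp: residue_euler_coef e)
  show "w \<in> carrier (kdiffs k) \<Longrightarrow> euler_map1 k (dwedge k [w]) = euler_form k w"
    unfolding euler_map1_def dwedge_def by (rule *(2)) (auto simp: residue_euler_coef e)
  show "euler_map1 k (om.ext_cl k (Suc 0) c) = residue k (lookup (om.contr_rep k (Suc 0) c) [])"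
    unfolding euler_map1_def One_nat_def[symmetric] by (rule *(3)) (auto simp: residue_euler_coef e)
qed

lemma dforms_surj: "w \<in> carrier (dforms k m) \<Longrightarrow> \<exists>c. w = om.ext_cl k m c"
  unfolding dforms_eq by (rule om.ext.cl_surj)

lemma ext_cl_zero_iff: "om.ext_cl k m c = \<zero>\<^bsub>dforms k m\<^esub> \<longleftrightarrow> c \<in> form_ker k m"
  by (simp add: om.ext.ker_def dforms_eq)

lemma euler_map1_zero_iff: "euler_map1 k (om.ext_cl k (Suc 0) c) = \<zero>\<^bsub>trunc_max k\<^esub> \<longleftrightarrow> om.contr_rep k (Suc 0) c \<in> form_ker k 0"
  by (simp add: euler_map1_props(3) om.wker_0_iff trunc_max_simps)

lemma euler_map_zero_iff:
  "euler_map k (Suc m) (om.ext_cl k (Suc m) c) = \<zero>\<^bsub>dforms k m\<^esub> \<longleftrightarrow> om.contr_rep k (Suc m) c \<in> form_ker k m"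
  by (simp add: euler_map_props(3) ext_cl_zero_iff)

lemma euler_map1_euler_map: "euler_map1 k (euler_map k 2 (om.ext_cl k 2 c)) = \<zero>\<^bsub>trunc_max k\<^esub>"
  using om.contr_rep_contr_rep[of k 1 c]
  by (simp add: numeral_2_eq_2 euler_map_props(3) euler_map1_zero_iff om.ext.ker_closed)

lemma euler_map_euler_map:
  "euler_map k (Suc m) (euler_map k (Suc (Suc m)) (om.ext_cl k (Suc (Suc m)) c)) = \<zero>\<^bsub>dforms k m\<^esub>"
  by (simp add: euler_map_props(3) om.contr_rep_contr_rep ext_cl_zero_iff om.ext.ker_closed)

text \<open>The kernel is expressed through a representative and \<open>contr_rep\<close> instead of
  \<open>euler_map\<close>. Thus one statement also covers \<open>m = 0\<close>, where the outgoing
  map is \<open>euler_map1\<close> and has another type.\<close>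

lemma exact_step:
  fixes k :: nat
  assumes i: "of_nat i \<noteq> (0 :: 'a::field)"
  defines "D \<equiv> \<lambda>m. (dforms_comp k m i :: ('a, 'n::finite) dform set)"
  shows "{w \<in> D (Suc m). \<exists>c. w = om.ext_cl k (Suc m) c \<and> om.contr_rep k (Suc m) c \<in> form_ker k m}
    = euler_map k (Suc (Suc m)) ` D (Suc (Suc m))"
proof safe
  fix w c assume w: "om.ext_cl k (Suc m) c \<in> D (Suc m)" and c: "om.contr_rep k (Suc m) c \<in> form_ker k m"
  obtain \<omega> :: "'n list \<Rightarrow>\<^sub>0 ('a, 'n) mpoly" where \<omega>: "\<omega> \<in> coord_comp (Suc m) i" "om.ext_cl k (Suc m) c = om.ext_cl k (Suc m) (coord_form k \<omega>)"
    using w by (auto simp: D_def dforms_comp_eq)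
  \<comment> \<open>The given representative \<open>c\<close> need not be homogeneous. It is
    exchanged for \<omega>, which represents the same form.\<close>
  have "om.ext_cl k m (om.contr_rep k (Suc m) c) = om.ext_cl k m (om.contr_rep k (Suc m) (coord_form k \<omega>))"
    by (simp add: \<omega>(2) flip: euler_map_props(3))
  with c have "om.contr_rep k (Suc m) (coord_form k \<omega>) \<in> form_ker k m" by (simp add: om.ext.ker_def)
  from exact_coord[OF \<omega>(1) i this] obtain \<eta>
    where \<eta>: "\<eta> \<in> coord_comp (Suc (Suc m)) i" "om.contr_rep k (Suc (Suc m)) (coord_form k \<eta>) - coord_form k \<omega> \<in> form_ker k (Suc m)" by blast
  then have "om.ext_cl k (Suc m) c = euler_map k (Suc (Suc m)) (om.ext_cl k (Suc (Suc m)) (coord_form k \<eta>))"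
    by (simp add: euler_map_props(3) \<omega>(2) om.ext.cl_eq_iff[symmetric])
  then show "om.ext_cl k (Suc m) c \<in> euler_map k (Suc (Suc m)) ` D (Suc (Suc m))"
    using \<eta>(1) by (auto simp: D_def dforms_comp_eq)
next
  fix w :: "('a, 'n) dform" assume "w \<in> D (Suc (Suc m))"
  then obtain \<omega> where \<omega>: "\<omega> \<in> coord_comp (Suc (Suc m)) i" "w = om.ext_cl k (Suc (Suc m)) (coord_form k \<omega>)"
    by (auto simp: D_def dforms_comp_eq)
  have "euler_map k (Suc (Suc m)) w = om.ext_cl k (Suc m) (coord_form k (coord_contr \<omega>))"
    by (simp add: \<omega>(2) euler_map_props(3) om.ext.cl_eq_iff coord_form_coord_contr)
  then show "euler_map k (Suc (Suc m)) w \<in> D (Suc m)"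
    using coord_comp_coord_contr[OF \<omega>(1)] by (auto simp: D_def dforms_comp_eq)
  show "\<exists>c. euler_map k (Suc (Suc m)) w = om.ext_cl k (Suc m) c \<and> om.contr_rep k (Suc m) c \<in> form_ker k m"
    by (intro exI[of _ "om.contr_rep k (Suc (Suc m)) (coord_form k \<omega>)"])
      (simp add: \<omega>(2) euler_map_props(3) om.contr_rep_contr_rep om.ext.ker_closed)
qed

text \<open>Forms of order n + 1 vanish because an index must repeat. Exactness at order n, with
  this map in front, then says that the leftmost map of the complex is injective.\<close>

lemma exact_top:
  fixes k :: nat
  assumes i: "of_nat i \<noteq> (0 :: 'a::field)" and m: "m = CARD('n::finite)"
  shows "euler_map k (Suc m) ` (dforms_comp k (Suc m) i :: ('a, 'n) dform set) = {\<zero>\<^bsub>dforms k m\<^esub>}"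
proof -
  have "euler_map k (Suc m) w = \<zero>\<^bsub>dforms k m\<^esub>" if "w \<in> dforms_comp k (Suc m) i" for w :: "('a, 'n) dform"
  proof -
    obtain \<omega> :: "'n list \<Rightarrow>\<^sub>0 ('a, 'n) mpoly" where \<omega>: "\<omega> \<in> coord_comp (Suc m) i" "w = om.ext_cl k (Suc m) (coord_form k \<omega>)"
      using \<open>w \<in> dforms_comp k (Suc m) i\<close> by (auto simp: dforms_comp_eq)
    then have "coord_form k \<omega> \<in> form_ker k (Suc m)" using m by (intro coord_form_top) auto
    then show ?thesis by (simp add: \<omega>(2) euler_map_props(3) ext_cl_zero_iff om.contr_rep_wker)
  qed
  moreover have "om.ext_cl k (Suc m) (coord_form k 0) \<in> (dforms_comp k (Suc m) i :: ('a, 'n) dform set)"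
    unfolding dforms_comp_eq by (rule imageI) simp
  ultimately show ?thesis by blast
qed

text \<open>An element f of S is a 0-form, whose contraction is the empty sum. So Cartan's formula
  exhibits f as the contraction of df divided by i.\<close>

lemma euler_map1_surj:
  fixes k :: nat
  assumes i: "of_nat i \<noteq> (0 :: 'a::field)"
  shows "euler_map1 k ` (dforms_comp k 1 i :: ('a, 'n::finite) dform set) = trunc_max_comp k i"
proof safe
  fix w :: "('a, 'n) dform" assume "w \<in> dforms_comp k 1 i"
  then obtain \<omega> :: "'n list \<Rightarrow>\<^sub>0 ('a, 'n) mpoly" where \<omega>: "\<omega> \<in> coord_comp (Suc 0) i" "w = om.ext_cl k 1 (coord_form k \<omega>)"
    by (auto simp: dforms_comp_eq)
  have "residue k (lookup (om.contr_rep k 1 (coord_form k \<omega>) - coord_form k (coord_contr \<omega>)) []) = \<zero>\<^bsub>trunc_ring k\<^esub>"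
    using coord_form_coord_contr[of k 0 \<omega>] by (simp add: om.wker_0_iff)
  then have e: "euler_map1 k w = residue k (lookup (coord_form k (coord_contr \<omega>)) [])"
    by (simp add: \<omega>(2) euler_map1_props(3) lookup_minus flip: tr.res_eq_iff)
  have "lookup (coord_form k \<eta>) [] \<in> hcoef 0 i" if "\<eta> \<in> coord_comp 0 i" for \<eta> :: "'n list \<Rightarrow>\<^sub>0 ('a, 'n) mpoly"
    using that
  proof (induction rule: coord_comp_induct)
    case (single js f)
    then show ?case
      unfolding coord_form_def by (subst scale_gen[symmetric], subst lin_ext_scale) simp
  qed (auto simp: coord_form_def lin_ext_add lookup_add hcoef_add)
  with e coord_comp_coord_contr[OF \<omega>(1)] have "euler_map1 k w \<in> trunc_comp k i" by (auto simp: trunc_comp_eq)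
  moreover have "euler_map1 k w \<in> carrier (trunc_max k)"
    using euler_map1_props(1)[of k] om.ext.cl_closed[of k 1 "coord_form k \<omega>"]
    by (auto simp: mod_hom_def \<omega>(2) dforms_eq)
  ultimately show "euler_map1 k w \<in> trunc_max_comp k i" by (simp add: trunc_max_comp_def)
next
  fix x :: "('a, 'n) trunc" assume "x \<in> trunc_max_comp k i"
  then obtain f where f: "f \<in> hcoef 0 i" "x = residue k f"
    by (auto simp: trunc_max_comp_def trunc_comp_eq)
  let ?\<omega> = "Poly_Mapping.single [] f :: 'n list \<Rightarrow>\<^sub>0 ('a, 'n) mpoly"
  have "?\<omega> \<in> coord_comp 0 i" using f(1) by (simp add: coord_comp_single)
  moreover have "coord_form k (coord_d (coord_contr ?\<omega>)) \<in> form_ker k 0"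
    by (simp add: coord_contr_single coord_form_def om.ext.ker_closed)
  ultimately obtain \<eta> where \<eta>: "\<eta> \<in> coord_comp (Suc 0) i" "om.contr_rep k (Suc 0) (coord_form k \<eta>) - coord_form k ?\<omega> \<in> form_ker k 0"
    using homotopy[OF _ i] by blast
  have "lookup (coord_form k ?\<omega>) [] = f"
    unfolding coord_form_def by (subst scale_gen[symmetric], subst lin_ext_scale) simp
  then have "euler_map1 k (om.ext_cl k 1 (coord_form k \<eta>)) = x"
    using \<eta>(2) by (simp add: f(2) euler_map1_props(3) om.wker_0_iff lookup_minus flip: tr.res_eq_iff)
  then show "x \<in> euler_map1 k ` dforms_comp k 1 i"
    using \<eta>(1) by (auto simp: dforms_comp_eq)
qed

theorem proposition7p9:
  fixes k n :: nat
    and S :: "('a::field, 'n::finite) trunc ring"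
    and Q :: "(('a, 'n) trunc, ('a, 'n) trunc) module"
    and \<Omega>\<^sub>1 :: "(('a, 'n) trunc, ('a, 'n) diff1) module"
    and \<Omega> :: "nat \<Rightarrow> (('a, 'n) trunc, ('a, 'n) dform) module"
    and \<epsilon> :: "('a, 'n) diff1 \<Rightarrow> ('a, 'n) trunc"
    and \<epsilon>\<^sub>1 :: "('a, 'n) dform \<Rightarrow> ('a, 'n) trunc"
    and E :: "nat \<Rightarrow> ('a, 'n) dform \<Rightarrow> ('a, 'n) dform"
  assumes "perfect_field TYPE('a)" and "n = CARD('n)" and "1 \<le> n" and "1 \<le> k"
    and "S = trunc_ring k" and "Q = trunc_max k"
    and "\<Omega>\<^sub>1 = kdiffs k" and "\<Omega> = dforms k"
    and "\<epsilon> = euler_form k" and "\<epsilon>\<^sub>1 = euler_map1 k" and "E = euler_map k"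
  shows
    "(\<epsilon> \<in> mod_hom S \<Omega>\<^sub>1 Q
      \<and> (\<forall>d. \<forall>f\<in>trunc_comp k d. \<epsilon> (diff_d k f) = [d] \<cdot>\<^bsub>S\<^esub> f)
      \<and> \<epsilon>\<^sub>1 \<in> mod_hom S (\<Omega> 1) Q
      \<and> (\<forall>w\<in>carrier \<Omega>\<^sub>1. \<epsilon>\<^sub>1 (dwedge k [w]) = \<epsilon> w)
      \<and> (\<forall>m\<in>{2..n}. E m \<in> mod_hom S (\<Omega> m) (\<Omega> (m - 1))
          \<and> (\<forall>ws\<in>tuples \<Omega>\<^sub>1 m. E m (dwedge k ws) = contract_wedge S \<Omega>\<^sub>1 \<epsilon> ws))
      \<and> (2 \<le> n \<longrightarrow> (\<forall>w\<in>carrier (\<Omega> 2). \<epsilon>\<^sub>1 (E 2 w) = \<zero>\<^bsub>Q\<^esub>))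
      \<and> (\<forall>m\<in>{3..n}. \<forall>w\<in>carrier (\<Omega> m). E (m - 1) (E m w) = \<zero>\<^bsub>\<Omega> (m - 2)\<^esub>))
     \<and>
     (\<forall>i\<ge>1. CHAR('a) = 0 \<or> CHAR('a) > 0 \<and> \<not> CHAR('a) dvd i \<longrightarrow>
        \<epsilon>\<^sub>1 ` dforms_comp k 1 i = trunc_max_comp k i
      \<and> (2 \<le> n \<longrightarrow> {w \<in> dforms_comp k 1 i. \<epsilon>\<^sub>1 w = \<zero>\<^bsub>Q\<^esub>} = E 2 ` dforms_comp k 2 i)
      \<and> (\<forall>m\<in>{2..<n}. {w \<in> dforms_comp k m i. E m w = \<zero>\<^bsub>\<Omega> (m - 1)\<^esub>}
                       = E (m + 1) ` dforms_comp k (m + 1) i)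
      \<and> (if n = 1 then {w \<in> dforms_comp k 1 i. \<epsilon>\<^sub>1 w = \<zero>\<^bsub>Q\<^esub>} = {\<zero>\<^bsub>\<Omega> 1\<^esub>}
         else {w \<in> dforms_comp k n i. E n w = \<zero>\<^bsub>\<Omega> (n - 1)\<^esub>} = {\<zero>\<^bsub>\<Omega> n\<^esub>}))"
proof (intro conjI allI ballI impI)
  note defs = \<open>S = _\<close> \<open>Q = _\<close> \<open>\<Omega>\<^sub>1 = _\<close> \<open>\<Omega> = _\<close> \<open>\<epsilon> = _\<close> \<open>\<epsilon>\<^sub>1 = _\<close> \<open>E = _\<close>
  show "\<epsilon> \<in> mod_hom S \<Omega>\<^sub>1 Q" by (simp add: defs euler_form_props)
  show "\<epsilon> (diff_d k f) = [d] \<cdot>\<^bsub>S\<^esub> f" if "f \<in> trunc_comp k d" for d f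
    using that by (simp add: defs euler_form_props)
  show "\<epsilon>\<^sub>1 \<in> mod_hom S (\<Omega> 1) Q" unfolding defs by (rule euler_map1_props)
  show "\<epsilon>\<^sub>1 (dwedge k [w]) = \<epsilon> w" if "w \<in> carrier \<Omega>\<^sub>1" for w
    using that unfolding defs by (rule euler_map1_props)
  show "E m \<in> mod_hom S (\<Omega> m) (\<Omega> (m - 1))" if "m \<in> {2..n}" for m
    using that euler_map_props(1)[of k "m - 1"] by (simp add: defs)
  show "E m (dwedge k ws) = contract_wedge S \<Omega>\<^sub>1 \<epsilon> ws" if "m \<in> {2..n}" "ws \<in> tuples \<Omega>\<^sub>1 m" for m ws
    using that euler_map_props(2)[of ws k "m - 1"] by (simp add: defs)
  show "\<epsilon>\<^sub>1 (E 2 w) = \<zero>\<^bsub>Q\<^esub>" if "w \<in> carrier (\<Omega> 2)" for w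
    using dforms_surj[of w k 2] that euler_map1_euler_map by (auto simp: defs)
  show "E (m - 1) (E m w) = \<zero>\<^bsub>\<Omega> (m - 2)\<^esub>" if m: "m \<in> {3..n}" and w: "w \<in> carrier (\<Omega> m)" for m w
  proof -
    obtain m' where m': "m = Suc (Suc m')" using m by (cases m; cases "m - 1") auto
    show ?thesis
      using dforms_surj[of w k m] w euler_map_euler_map[of k m'] by (auto simp: defs m')
  qed
  fix i :: nat
  assume "1 \<le> i" and c: "CHAR('a) = 0 \<or> CHAR('a) > 0 \<and> \<not> CHAR('a) dvd i"
  \<comment> \<open>The degree is invertible in K, as the division in the homotopy requires.\<close>
  have i: "of_nat i \<noteq> (0 :: 'a)"
    using c \<open>1 \<le> i\<close> by (auto simp: of_nat_eq_0_iff_char_dvd)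
  have surj: "\<exists>c. w = om.ext_cl k m c" if "w \<in> dforms_comp k m i" for w :: "('a, 'n) dform" and m
    using that by (auto simp: dforms_comp_eq)
  have 1: "{w \<in> dforms_comp k 1 i. \<epsilon>\<^sub>1 w = \<zero>\<^bsub>Q\<^esub>} = E 2 ` dforms_comp k 2 i"
  proof -
    have iff: "euler_map1 k w = \<zero>\<^bsub>trunc_max k\<^esub>
        \<longleftrightarrow> (\<exists>c. w = om.ext_cl k (Suc 0) c \<and> om.contr_rep k (Suc 0) c \<in> form_ker k 0)"
      if w: "w \<in> dforms_comp k (Suc 0) i" for w :: "('a, 'n) dform"
    proof -
      obtain c where c: "w = om.ext_cl k (Suc 0) c" using surj[OF w] by blast
      then show ?thesis by (auto simp flip: euler_map1_zero_iff)
    qed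
    have "{w \<in> dforms_comp k 1 i. \<epsilon>\<^sub>1 w = \<zero>\<^bsub>Q\<^esub>}
      = {w \<in> dforms_comp k (Suc 0) i. \<exists>c. w = om.ext_cl k (Suc 0) c \<and> om.contr_rep k (Suc 0) c \<in> form_ker k 0}"
      using iff by (auto simp: defs)
    also have "\<dots> = E 2 ` dforms_comp k 2 i"
      using exact_step[OF i, of k 0] by (simp add: defs numeral_2_eq_2)
    finally show ?thesis .
  qed
  have 2: "{w \<in> dforms_comp k m i. E m w = \<zero>\<^bsub>\<Omega> (m - 1)\<^esub>} = E (m + 1) ` dforms_comp k (m + 1) i"
    if "2 \<le> m" for m
  proof -
    obtain m' where m': "m = Suc m'" using \<open>2 \<le> m\<close> by (cases m) auto
    have iff: "euler_map k (Suc m') w = \<zero>\<^bsub>dforms k m'\<^esub>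
        \<longleftrightarrow> (\<exists>c. w = om.ext_cl k (Suc m') c \<and> om.contr_rep k (Suc m') c \<in> form_ker k m')"
      if w: "w \<in> dforms_comp k (Suc m') i" for w :: "('a, 'n) dform"
    proof -
      obtain c where c: "w = om.ext_cl k (Suc m') c" using surj[OF w] by blast
      then show ?thesis by (auto simp flip: euler_map_zero_iff)
    qed
    have "{w \<in> dforms_comp k m i. E m w = \<zero>\<^bsub>\<Omega> (m - 1)\<^esub>}
      = {w \<in> dforms_comp k (Suc m') i. \<exists>c. w = om.ext_cl k (Suc m') c \<and> om.contr_rep k (Suc m') c \<in> form_ker k m'}"
      using iff by (auto simp: defs m')
    also have "\<dots> = E (m + 1) ` dforms_comp k (m + 1) i"
      using exact_step[OF i, of k m'] by (simp add: defs m')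
    finally show ?thesis .
  qed
  have top: "E (n + 1) ` dforms_comp k (n + 1) i = {\<zero>\<^bsub>\<Omega> n\<^esub>}"
    using exact_top[OF i \<open>n = CARD('n)\<close>] by (simp add: defs)
  show "\<epsilon>\<^sub>1 ` dforms_comp k 1 i = trunc_max_comp k i"
    unfolding defs by (rule euler_map1_surj[OF i])
  show "{w \<in> dforms_comp k 1 i. \<epsilon>\<^sub>1 w = \<zero>\<^bsub>Q\<^esub>} = E 2 ` dforms_comp k 2 i"
    by (rule 1)
  show "{w \<in> dforms_comp k m i. E m w = \<zero>\<^bsub>\<Omega> (m - 1)\<^esub>} = E (m + 1) ` dforms_comp k (m + 1) i"
    if "m \<in> {2..<n}" for m
    using that by (intro 2) auto
  show "if n = 1 then {w \<in> dforms_comp k 1 i. \<epsilon>\<^sub>1 w = \<zero>\<^bsub>Q\<^esub>} = {\<zero>\<^bsub>\<Omega> 1\<^esub>}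
         else {w \<in> dforms_comp k n i. E n w = \<zero>\<^bsub>\<Omega> (n - 1)\<^esub>} = {\<zero>\<^bsub>\<Omega> n\<^esub>}"
  proof (cases "n = 1")
    \<comment> \<open>With one variable the leftmost map is \<open>\<epsilon>\<^sub>1\<close>, so
      injectivity is read off from exactness at one-forms.\<close>
    case True
    then show ?thesis using 1 top by (simp add: numeral_2_eq_2)
  next
    case False
    then show ?thesis using 2[of n] top \<open>1 \<le> n\<close> by simp
  qed
qed

end
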